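(* Let $M^2$ be a compact oriented Riemannian surface with connected totally geodesic boundary and fixed spin structure, and let $N$ be a Riemannian manifold. Assume $f\colon M^2\to N$ to be a harmonic map satisfying the Neumann boundary condition, and $\psi\in\Gamma(M,\Sigma M)$ to be an $\alpha$-Killing spinor on $M$, for some $\alpha\in\mathbb{R}\cup i\mathbb{R}$, satisfying $\nu\cdot\mathcal{G}\psi=\psi$ at a point in $\partial M$. Then $\left(f,\ \phi:=\sum_{j=1}^2e_j\cdot\psi\otimes f_*(e_j)\right)$ is a Dirac-harmonic map with Neumann boundary condition $f_*(\nu)=0$ for $f$ and chirality boundary condition $\nu\cdot G\phi=\phi$ on $\partial M$ for $\phi$.
   Context: $\Sigma M$ is the complex spinor bundle of $M$ with its Hermitian metric, spin connection $\nabla$ and Clifford multiplication "$\cdot$" (with $X\cdot X\cdot=-|X|^2$); $\nu$ is the inner unit normal along $\partial M$; $(e_1,e_2)$ is any local orthonormal basis of $TM$; $f_*=df$. $\mathcal{G}\in\Gamma(M,\mathrm{End}(\Sigma M))$ is a chirality operator, i.e. a parallel involutive Hermitian field of endomorphisms of $\Sigma M$ anti-commuting with Clifford multiplication by tangent vectors on $M$, and $G:=\mathcal{G}\otimes\mathrm{id}_{f^*TN}$; $\nu\cdot$ also denotes $\nu\cdot\otimes\mathrm{id}$. An $\alpha$-Killing spinor is a section $\psi$ of $\Sigma M$ with $\nabla_X\psi=\alpha X\cdot\psi$ for all tangent vectors $X$. Let $h$ be the metric of $N$. The bundle $\Sigma M\otimes f^*TN$ carries the tensor product connection of the spin connection and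 the pull-back Levi-Civita connection, and $D^f\phi:=\sum_j(e_j\cdot\otimes\mathrm{id})\nabla_{e_j}\phi$. The section $V_\phi\in\Gamma(f^*TN)$ is defined by $h(V_\phi,Y)=\sum_j\langle(e_j\cdot\otimes R^N_{df(e_j),Y})\phi,\phi\rangle$ for all tangent vectors $Y$ to $N$, where $R^N$ is the curvature tensor of $N$. $f$ is harmonic if $\mathrm{tr}(\nabla df)=0$; the Neumann boundary condition is $df(\nu)=0$ on $\partial M$. A pair $(f,\phi)$ is a Dirac-harmonic map (with prescribed boundary conditions) if $D^f\phi=0$ and $\mathrm{tr}(\nabla df)=\frac12V_\phi$ on $M$ and $f,\phi$ satisfy the prescribed boundary conditions. *)

theory Defs
  imports "HOL-Analysis.Analysis"
begin

section \<open>Smooth maps between subsets of Euclidean spaces\<close>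

text \<open>On an open set of a Euclidean space, \<open>Ck_on k\<close> is the class of \<open>k\<close> times continuously
  differentiable maps. On an arbitrary set, smooth means: locally the restriction of a map that is
  smooth on an open set. This is the usual convention for manifolds with boundary.\<close>

fun Ck_on :: "nat \<Rightarrow> 'a::euclidean_space set \<Rightarrow> ('a \<Rightarrow> 'b::real_normed_vector) \<Rightarrow> bool" where
  "Ck_on 0 U f \<longleftrightarrow> continuous_on U f"
| "Ck_on (Suc k) U f \<longleftrightarrow> (\<forall>x\<in>U. f differentiable (at x)) \<and>
      (\<forall>v. Ck_on k U (\<lambda>x. frechet_derivative f (at x) v))"

definition smooth_on :: "'a::euclidean_space set \<Rightarrow> ('a \<Rightarrow> 'b::real_normed_vector) \<Rightarrow> bool" where
  "smooth_on S f \<longleftrightarrow>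
     (\<forall>x\<in>S. \<exists>U g. open U \<and> x \<in> U \<and> (\<forall>k. Ck_on k U g) \<and> (\<forall>y\<in>S \<inter> U. g y = f y))"

section \<open>Riemannian manifolds with boundary\<close>

text \<open>The manifold is the whole type \<open>'m\<close>, whose Hausdorff and second countable topology is given by
  type classes. A chart maps an open set of \<open>'m\<close> homeomorphically onto a relatively open subset of
  a model space: the whole vector space, or a half-space for manifolds with boundary.

  Tensors and tensor fields are given by their components in the charts of the atlas, that is, by
  families indexed by charts which satisfy the transformation law of the bundle in question. A tangent
  vector at \<open>p\<close> is thus represented in a chart \<open>c\<close> around \<open>p\<close> by a vector of the model space.\<close>

record ('m, 'e) chart =
  cdom :: "'m set"
  coord :: "'m \<Rightarrow> 'e"

record ('m, 'e) riem =
  model :: "'e set"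
  charts :: "('m, 'e) chart set"
  metric :: "('m, 'e) chart \<Rightarrow> 'm \<Rightarrow> 'e \<Rightarrow> 'e \<Rightarrow> real"

definition param :: "('m, 'e) chart \<Rightarrow> 'e \<Rightarrow> 'm" where
  "param c = inv_into (cdom c) (coord c)"

definition charts_at :: "('m, 'e, 'z) riem_scheme \<Rightarrow> 'm \<Rightarrow> ('m, 'e) chart set" where
  "charts_at M p = {c \<in> charts M. p \<in> cdom c}"

definition smooth_in :: "('m, 'e::euclidean_space) chart \<Rightarrow> 'm set \<Rightarrow>
    ('m \<Rightarrow> 'b::real_normed_vector) \<Rightarrow> bool" where
  "smooth_in c S u \<longleftrightarrow> smooth_on (coord c ` S) (u \<circ> param c)"

text \<open>The derivative \<open>X(u)\<close> at \<open>p\<close>, for the tangent vector \<open>X\<close> with components \<open>X\<close> in the chart \<open>c\<close>.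
  Differentiating within the model space gives one-sided derivatives at boundary points. For
  \<open>u = coord c'\<close> this yields the components of \<open>X\<close> in the chart \<open>c'\<close>.\<close>

definition dirder :: "('m, 'e::euclidean_space, 'z) riem_scheme \<Rightarrow> ('m, 'e) chart \<Rightarrow>
    ('m \<Rightarrow> 'b::real_normed_vector) \<Rightarrow> 'm \<Rightarrow> 'e \<Rightarrow> 'b" where
  "dirder M c u p X = frechet_derivative (u \<circ> param c) (at (coord c p) within model M) X"

definition smooth_manifold ::
    "('m::{t2_space,second_countable_topology}, 'e::euclidean_space, 'z) riem_scheme \<Rightarrow> bool" where
  "smooth_manifold M \<longleftrightarrow>
     (\<Union>c\<in>charts M. cdom c) = UNIV \<and>
     (\<forall>c\<in>charts M. open (cdom c) \<and> openin (top_of_set (model M)) (coord c ` cdom c) \<and>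
        homeomorphism (cdom c) (coord c ` cdom c) (coord c) (param c)) \<and>
     (\<forall>c\<in>charts M. \<forall>c'\<in>charts M. smooth_in c (cdom c \<inter> cdom c') (coord c'))"

definition riemannian_manifold ::
    "('m::{t2_space,second_countable_topology}, 'e::euclidean_space, 'z) riem_scheme \<Rightarrow> bool" where
  "riemannian_manifold M \<longleftrightarrow> smooth_manifold M \<and>
     (\<forall>c\<in>charts M. (\<forall>v w. smooth_in c (cdom c) (\<lambda>p. metric M c p v w)) \<and>
        (\<forall>p\<in>cdom c. bilinear (metric M c p) \<and>
           (\<forall>v w. metric M c p v w = metric M c p w v) \<and>
           (\<forall>v. v \<noteq> 0 \<longrightarrow> 0 < metric M c p v v))) \<and>
     (\<forall>p. \<forall>c\<in>charts_at M p. \<forall>c'\<in>charts_at M p. \<forall>v w.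
        metric M c' p (dirder M c (coord c') p v) (dirder M c (coord c') p w) = metric M c p v w)"

text \<open>\<open>christoffel M c p u v\<close> has the components \<open>\<Sum>\<^sub>i\<^sub>j \<Gamma>\<^sup>k\<^sub>i\<^sub>j u\<^sup>i v\<^sup>j\<close>; it is the Levi-Civita derivative
  along \<open>u\<close> of the vector field with constant components \<open>v\<close>, given by the Koszul formula.\<close>

definition christoffel :: "('m, 'e::euclidean_space, 'z) riem_scheme \<Rightarrow> ('m, 'e) chart \<Rightarrow>
    'm \<Rightarrow> 'e \<Rightarrow> 'e \<Rightarrow> 'e" where
  "christoffel M c p u v = (THE w. \<forall>z. 2 * metric M c p w z =
     dirder M c (\<lambda>q. metric M c q v z) p u + dirder M c (\<lambda>q. metric M c q u z) p v
       - dirder M c (\<lambda>q. metric M c q u v) p z)"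

definition covder :: "('m, 'e::euclidean_space, 'z) riem_scheme \<Rightarrow> ('m, 'e) chart \<Rightarrow>
    ('m \<Rightarrow> 'e) \<Rightarrow> 'm \<Rightarrow> 'e \<Rightarrow> 'e" where
  "covder M c Y p X = dirder M c Y p X + christoffel M c p X (Y p)"

text \<open>\<open>R(u,v)w = \<nabla>\<^sub>u\<nabla>\<^sub>v w - \<nabla>\<^sub>v\<nabla>\<^sub>u w\<close> for constant component fields \<open>u\<close>, \<open>v\<close>, \<open>w\<close> (so \<open>[u,v] = 0\<close>).\<close>

definition curvature :: "('m, 'e::euclidean_space, 'z) riem_scheme \<Rightarrow> ('m, 'e) chart \<Rightarrow>
    'm \<Rightarrow> 'e \<Rightarrow> 'e \<Rightarrow> 'e \<Rightarrow> 'e" where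
  "curvature M c p u v w =
     covder M c (\<lambda>q. christoffel M c q v w) p u - covder M c (\<lambda>q. christoffel M c q u w) p v"

section \<open>Spin surfaces with boundary\<close>

text \<open>The complex Clifford module \<open>\<complex>\<^sup>2\<close> of \<open>\<real>\<^sup>2\<close>: \<open>gamma j\<close> is Clifford multiplication by the \<open>j\<close>-th
  standard basis vector.\<close>

definition gamma :: "2 \<Rightarrow> complex^2^2" where
  "gamma j = (if j = 1 then vector [vector [0, -1], vector [1, 0]]
              else vector [vector [0, \<i>], vector [\<i>, 0]])"

definition gamma12 :: "complex^2^2" where
  "gamma12 = gamma 1 ** gamma 2"

text \<open>The unit complex number \<open>z = cos t + \<i> sin t\<close> stands for the element \<open>cos t + sin t E\<^sub>1E\<^sub>2\<close> of
  \<open>Spin(2)\<close>, where \<open>E\<^sub>1, E\<^sub>2\<close> is the standard basis of \<open>\<real>\<^sup>2\<close>; \<open>spin_rep z\<close> is its action on \<open>\<complex>\<^sup>2\<close>. Under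
  the double covering \<open>Spin(2) \<rightarrow> SO(2)\<close> it is mapped to the rotation by the angle \<open>2t\<close>, that is, to
  \<open>z\<^sup>2\<close>; see \<open>spin_rep_covering\<close> below.\<close>

definition spin_rep :: "complex \<Rightarrow> complex^2^2" where
  "spin_rep z = Re z *\<^sub>R mat 1 + Im z *\<^sub>R gamma12"

lemma gamma_clifford_relation:
  "gamma i ** gamma j + gamma j ** gamma i = (if i = j then (-2) *\<^sub>R mat 1 else 0)"
  using exhaust_2[of i] exhaust_2[of j]
  by (auto simp: gamma_def vec_eq_iff forall_2 matrix_matrix_mult_def sum_2 mat_def vector_def
      scaleR_conv_of_real)

lemma spin_rep_covering:
  assumes "norm z = 1"
  shows "spin_rep z ** gamma 1 ** spin_rep (cnj z) = Re (z\<^sup>2) *\<^sub>R gamma 1 + Im (z\<^sup>2) *\<^sub>R gamma 2"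
    and "spin_rep z ** gamma 2 ** spin_rep (cnj z) = - Im (z\<^sup>2) *\<^sub>R gamma 1 + Re (z\<^sup>2) *\<^sub>R gamma 2"
  by (auto simp: spin_rep_def gamma12_def gamma_def vec_eq_iff forall_2 matrix_matrix_mult_def
      sum_2 mat_def vector_def complex_eq_iff power2_eq_square algebra_simps)

text \<open>A surface together with a spin structure: over the domain of each chart \<open>c\<close> there is a section
  \<open>s\<^sub>c\<close> of the \<open>Spin(2)\<close>-principal bundle; \<open>frame\<close> is the local orthonormal frame of the surface below
  \<open>s\<^sub>c\<close>, and \<open>spin_lift c c'\<close> is the transition function, \<open>s\<^sub>c\<^sub>' = s\<^sub>c \<cdot> spin_lift c c'\<close>. Such sections
  always exist, since a circle bundle over an open subset of a half-plane is trivial.\<close>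

record 'm spin_surface = "('m, real^2) riem" +
  frame :: "('m, real^2) chart \<Rightarrow> 'm \<Rightarrow> 2 \<Rightarrow> real^2"
  spin_lift :: "('m, real^2) chart \<Rightarrow> ('m, real^2) chart \<Rightarrow> 'm \<Rightarrow> complex"

definition half_plane :: "(real^2) set" where
  "half_plane = {x. 0 \<le> x $ 2}"

definition orthonormal_basis :: "('m, real^2, 'z) riem_scheme \<Rightarrow> ('m, real^2) chart \<Rightarrow> 'm \<Rightarrow>
    (2 \<Rightarrow> real^2) \<Rightarrow> bool" where
  "orthonormal_basis M c p b \<longleftrightarrow> (\<forall>i j. metric M c p (b i) (b j) = (if i = j then 1 else 0))"

definition oriented_riemannian_surface_with_boundary ::
    "('m::{t2_space,second_countable_topology}, real^2, 'z) riem_scheme \<Rightarrow> bool" where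
  "oriented_riemannian_surface_with_boundary M \<longleftrightarrow>
     riemannian_manifold M \<and> model M = half_plane \<and>
     (\<forall>p. \<forall>c\<in>charts_at M p. \<forall>c'\<in>charts_at M p. 0 < det (matrix (dirder M c (coord c') p)))"

definition spin_structure :: "'m::{t2_space,second_countable_topology} spin_surface \<Rightarrow> bool" where
  "spin_structure M \<longleftrightarrow>
     (\<forall>c\<in>charts M. (\<forall>j. smooth_in c (cdom c) (\<lambda>p. frame M c p j)) \<and>
        (\<forall>p\<in>cdom c. orthonormal_basis M c p (frame M c p) \<and> 0 < det (\<chi> i. frame M c p i))) \<and>
     (\<forall>c\<in>charts M. \<forall>c'\<in>charts M. smooth_in c (cdom c \<inter> cdom c') (spin_lift M c c')) \<and>
     (\<forall>p. \<forall>c\<in>charts_at M p. \<forall>c'\<in>charts_at M p. let z = spin_lift M c c' p in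
        norm z = 1 \<and>
        dirder M c' (coord c) p (frame M c' p 1) =
          Re (z\<^sup>2) *\<^sub>R frame M c p 1 + Im (z\<^sup>2) *\<^sub>R frame M c p 2 \<and>
        dirder M c' (coord c) p (frame M c' p 2) =
          - Im (z\<^sup>2) *\<^sub>R frame M c p 1 + Re (z\<^sup>2) *\<^sub>R frame M c p 2) \<and>
     (\<forall>p. \<forall>c\<in>charts_at M p. \<forall>c'\<in>charts_at M p. \<forall>c''\<in>charts_at M p.
        spin_lift M c c' p * spin_lift M c' c'' p = spin_lift M c c'' p)"

definition boundary :: "('m, real^2, 'z) riem_scheme \<Rightarrow> 'm set" where
  "boundary M = {p. \<exists>c\<in>charts_at M p. coord c p $ 2 = 0}"

text \<open>At boundary points the tangent space of the boundary is spanned by the first coordinate vector,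
  and the vectors with positive second component point inwards.\<close>

definition inner_normal :: "('m, real^2, 'z) riem_scheme \<Rightarrow> ('m, real^2) chart \<Rightarrow> 'm \<Rightarrow> real^2" where
  "inner_normal M c p =
     (THE n. metric M c p n (axis 1 1) = 0 \<and> metric M c p n n = 1 \<and> 0 < n $ 2)"

text \<open>Vanishing of the second fundamental form \<open>\<langle>\<nabla>\<^sub>X Y, \<nu>\<rangle>\<close> of the boundary, with \<open>X\<close> and \<open>Y\<close>
  extended by constant components in the chart.\<close>

definition totally_geodesic_boundary :: "('m, real^2, 'z) riem_scheme \<Rightarrow> bool" where
  "totally_geodesic_boundary M \<longleftrightarrow>
     (\<forall>p\<in>boundary M. \<forall>c\<in>charts_at M p. \<forall>X Y. X $ 2 = 0 \<and> Y $ 2 = 0 \<longrightarrow>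
        metric M c p (covder M c (\<lambda>q. Y) p X) (inner_normal M c p) = 0)"

section \<open>Spinors\<close>

definition clifford :: "'m spin_surface \<Rightarrow> ('m, real^2) chart \<Rightarrow> 'm \<Rightarrow> real^2 \<Rightarrow> complex^2^2" where
  "clifford M c p X = (\<Sum>j\<in>UNIV. metric M c p X (frame M c p j) *\<^sub>R gamma j)"

definition herm :: "complex^2 \<Rightarrow> complex^2 \<Rightarrow> complex" where
  "herm \<sigma> \<tau> = (\<Sum>i\<in>UNIV. \<sigma> $ i * cnj (\<tau> $ i))"

definition spinor_field :: "'m spin_surface \<Rightarrow> (('m, real^2) chart \<Rightarrow> 'm \<Rightarrow> complex^2) \<Rightarrow> bool" where
  "spinor_field M \<psi> \<longleftrightarrow>
     (\<forall>c\<in>charts M. smooth_in c (cdom c) (\<psi> c)) \<and>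
     (\<forall>p. \<forall>c\<in>charts_at M p. \<forall>c'\<in>charts_at M p. \<psi> c p = spin_rep (spin_lift M c c' p) *v \<psi> c' p)"

text \<open>The spin connection is \<open>\<nabla>\<^sub>X = X + (1/4) \<Sum>\<^sub>j\<^sub>k \<langle>\<nabla>\<^sub>X e\<^sub>j, e\<^sub>k\<rangle> e\<^sub>j \<cdot> e\<^sub>k \<cdot>\<close> in the local frame, and in
  dimension two the second summand equals \<open>spin_conn_form\<close>.\<close>

definition spin_conn_form :: "'m spin_surface \<Rightarrow> ('m, real^2) chart \<Rightarrow> 'm \<Rightarrow> real^2 \<Rightarrow> complex^2^2" where
  "spin_conn_form M c p X =
     (1/2 * metric M c p (covder M c (\<lambda>q. frame M c q 1) p X) (frame M c p 2)) *\<^sub>R gamma12"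

definition spin_deriv :: "'m spin_surface \<Rightarrow> ('m, real^2) chart \<Rightarrow>
    (('m, real^2) chart \<Rightarrow> 'm \<Rightarrow> complex^2) \<Rightarrow> 'm \<Rightarrow> real^2 \<Rightarrow> complex^2" where
  "spin_deriv M c \<psi> p X = dirder M c (\<psi> c) p X + spin_conn_form M c p X *v \<psi> c p"

definition killing_spinor :: "'m spin_surface \<Rightarrow> complex \<Rightarrow>
    (('m, real^2) chart \<Rightarrow> 'm \<Rightarrow> complex^2) \<Rightarrow> bool" where
  "killing_spinor M \<alpha> \<psi> \<longleftrightarrow> spinor_field M \<psi> \<and>
     (\<forall>p. \<forall>c\<in>charts_at M p. \<forall>X. spin_deriv M c \<psi> p X = \<alpha> *s (clifford M c p X *v \<psi> c p))"

text \<open>The conjuncts: smooth section of the endomorphism bundle, involutive, Hermitian, anti-commuting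
  with Clifford multiplication, parallel for the connection induced on the endomorphism bundle.\<close>

definition chirality_operator :: "'m spin_surface \<Rightarrow>
    (('m, real^2) chart \<Rightarrow> 'm \<Rightarrow> complex^2^2) \<Rightarrow> bool" where
  "chirality_operator M G \<longleftrightarrow>
     (\<forall>c\<in>charts M. smooth_in c (cdom c) (G c)) \<and>
     (\<forall>p. \<forall>c\<in>charts_at M p. \<forall>c'\<in>charts_at M p.
        G c p = spin_rep (spin_lift M c c' p) ** G c' p ** spin_rep (cnj (spin_lift M c c' p))) \<and>
     (\<forall>p. \<forall>c\<in>charts_at M p.
        G c p ** G c p = mat 1 \<and>
        (\<forall>\<sigma> \<tau>. herm (G c p *v \<sigma>) \<tau> = herm \<sigma> (G c p *v \<tau>)) \<and>
        (\<forall>X. G c p ** clifford M c p X = - (clifford M c p X ** G c p)) \<and>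
        (\<forall>X. dirder M c (G c) p X + spin_conn_form M c p X ** G c p
               - G c p ** spin_conn_form M c p X = 0))"

section \<open>Maps into a Riemannian manifold\<close>

definition smooth_map :: "('m::topological_space, 'e::euclidean_space, 'z) riem_scheme \<Rightarrow>
    ('q::topological_space, 'f::euclidean_space, 'y) riem_scheme \<Rightarrow> ('m \<Rightarrow> 'q) \<Rightarrow> bool" where
  "smooth_map M N f \<longleftrightarrow> continuous_on UNIV f \<and>
     (\<forall>c\<in>charts M. \<forall>d\<in>charts N. smooth_in c (cdom c \<inter> f -` cdom d) (coord d \<circ> f))"

definition differential :: "('m, 'e::euclidean_space, 'z) riem_scheme \<Rightarrow> ('m \<Rightarrow> 'q) \<Rightarrow>
    ('m, 'e) chart \<Rightarrow> ('q, 'f::euclidean_space) chart \<Rightarrow> 'm \<Rightarrow> 'e \<Rightarrow> 'f" where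
  "differential M f c d p X = dirder M c (coord d \<circ> f) p X"

text \<open>\<open>(\<nabla>df)(X,Y) = \<nabla>\<^sub>X(df(Y)) - df(\<nabla>\<^sub>X Y)\<close>, with \<open>Y\<close> extended by constant components.\<close>

definition nabla_df :: "('m, 'e::euclidean_space, 'z) riem_scheme \<Rightarrow>
    ('q, 'f::euclidean_space, 'y) riem_scheme \<Rightarrow> ('m \<Rightarrow> 'q) \<Rightarrow>
    ('m, 'e) chart \<Rightarrow> ('q, 'f) chart \<Rightarrow> 'm \<Rightarrow> 'e \<Rightarrow> 'e \<Rightarrow> 'f" where
  "nabla_df M N f c d p X Y =
     dirder M c (\<lambda>q. differential M f c d q Y) p X
       + christoffel N d (f p) (differential M f c d p X) (differential M f c d p Y)
       - differential M f c d p (covder M c (\<lambda>q. Y) p X)"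

text \<open>The trace may be computed in any orthonormal basis of the tangent space, and likewise for the
  sums over \<open>j\<close> below.\<close>

definition tension :: "'m spin_surface \<Rightarrow> ('q, 'f::euclidean_space, 'y) riem_scheme \<Rightarrow>
    ('m \<Rightarrow> 'q) \<Rightarrow> ('m, real^2) chart \<Rightarrow> ('q, 'f) chart \<Rightarrow> 'm \<Rightarrow> 'f" where
  "tension M N f c d p = (\<Sum>j\<in>UNIV. nabla_df M N f c d p (frame M c p j) (frame M c p j))"

definition harmonic_map :: "'m::topological_space spin_surface \<Rightarrow>
    ('q::topological_space, 'f::euclidean_space, 'y) riem_scheme \<Rightarrow> ('m \<Rightarrow> 'q) \<Rightarrow> bool" where
  "harmonic_map M N f \<longleftrightarrow> smooth_map M N f \<and>
     (\<forall>p. \<forall>c\<in>charts_at M p. \<forall>d\<in>charts_at N (f p). tension M N f c d p = 0)"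

definition neumann_condition :: "'m spin_surface \<Rightarrow>
    ('q, 'f::euclidean_space, 'y) riem_scheme \<Rightarrow> ('m \<Rightarrow> 'q) \<Rightarrow> bool" where
  "neumann_condition M N f \<longleftrightarrow>
     (\<forall>p\<in>boundary M. \<forall>c\<in>charts_at M p. \<forall>d\<in>charts_at N (f p).
        differential M f c d p (inner_normal M c p) = 0)"

section \<open>Spinors twisted by the pull-back of the tangent bundle\<close>

text \<open>In a chart of the \<open>n\<close>-dimensional manifold \<open>N\<close>, the (real) tensor product of the spinor space
  with the tangent space of \<open>N\<close> becomes \<open>\<complex>\<^sup>2 \<otimes> \<real>\<^sup>n\<close>: the tensor \<open>\<Sum>\<^sub>k \<phi>\<^sup>k \<otimes> \<partial>\<^sub>k\<close> is represented by
  the vector of its components \<open>\<phi>\<^sup>k\<close>. The operator \<open>tensor_op T L\<close> is \<open>T \<otimes> L\<close>.\<close>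

definition tensor :: "complex^2 \<Rightarrow> real^'n \<Rightarrow> complex^2^'n" where
  "tensor \<sigma> v = (\<chi> k. v $ k *\<^sub>R \<sigma>)"

definition tensor_op :: "complex^2^2 \<Rightarrow> (real^'n \<Rightarrow> real^'n) \<Rightarrow> complex^2^'n \<Rightarrow> complex^2^'n" where
  "tensor_op T L \<phi> = (\<Sum>k\<in>UNIV. tensor (T *v (\<phi> $ k)) (L (axis k 1)))"

text \<open>The inner product with \<open>\<langle>\<sigma> \<otimes> v, \<tau> \<otimes> w\<rangle> = \<langle>\<sigma>, \<tau>\<rangle> h(v, w)\<close>.\<close>

definition tensor_herm :: "(real^'n \<Rightarrow> real^'n \<Rightarrow> real) \<Rightarrow> complex^2^'n \<Rightarrow> complex^2^'n \<Rightarrow> complex" where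
  "tensor_herm h \<phi> \<chi>' =
     (\<Sum>k\<in>UNIV. \<Sum>l\<in>UNIV. h (axis k 1) (axis l 1) *\<^sub>R herm (\<phi> $ k) (\<chi>' $ l))"

type_synonym ('m, 'q, 'n) twisted =
  "('m, real^2) chart \<Rightarrow> ('q, real^'n) chart \<Rightarrow> 'm \<Rightarrow> complex^2^'n"

definition twisted_spinor_field :: "'m spin_surface \<Rightarrow> ('q, real^'n) riem \<Rightarrow> ('m \<Rightarrow> 'q) \<Rightarrow>
    ('m, 'q, 'n) twisted \<Rightarrow> bool" where
  "twisted_spinor_field M N f \<phi> \<longleftrightarrow>
     (\<forall>c\<in>charts M. \<forall>d\<in>charts N. smooth_in c (cdom c \<inter> f -` cdom d) (\<phi> c d)) \<and>
     (\<forall>p. \<forall>c\<in>charts_at M p. \<forall>c'\<in>charts_at M p.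
        \<forall>d\<in>charts_at N (f p). \<forall>d'\<in>charts_at N (f p).
        \<phi> c d p =
          tensor_op (spin_rep (spin_lift M c c' p)) (dirder N d' (coord d) (f p)) (\<phi> c' d' p))"

definition twisted_deriv :: "'m spin_surface \<Rightarrow> ('q, real^'n) riem \<Rightarrow> ('m \<Rightarrow> 'q) \<Rightarrow>
    ('m, real^2) chart \<Rightarrow> ('q, real^'n) chart \<Rightarrow> ('m, 'q, 'n) twisted \<Rightarrow> 'm \<Rightarrow> real^2 \<Rightarrow>
    complex^2^'n" where
  "twisted_deriv M N f c d \<phi> p X =
     dirder M c (\<phi> c d) p X
       + tensor_op (spin_conn_form M c p X) id (\<phi> c d p)
       + tensor_op (mat 1) (christoffel N d (f p) (differential M f c d p X)) (\<phi> c d p)"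

definition twisted_dirac :: "'m spin_surface \<Rightarrow> ('q, real^'n) riem \<Rightarrow> ('m \<Rightarrow> 'q) \<Rightarrow>
    ('m, 'q, 'n) twisted \<Rightarrow> ('m, 'q, 'n) twisted" where
  "twisted_dirac M N f \<phi> c d p =
     (\<Sum>j\<in>UNIV. tensor_op (clifford M c p (frame M c p j)) id
        (twisted_deriv M N f c d \<phi> p (frame M c p j)))"

definition V_field :: "'m spin_surface \<Rightarrow> ('q, real^'n) riem \<Rightarrow> ('m \<Rightarrow> 'q) \<Rightarrow>
    ('m, 'q, 'n) twisted \<Rightarrow> ('m, real^2) chart \<Rightarrow> ('q, real^'n) chart \<Rightarrow> 'm \<Rightarrow> real^'n" where
  "V_field M N f \<phi> c d p = (THE V. \<forall>Y.
     complex_of_real (metric N d (f p) V Y) =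
       (\<Sum>j\<in>UNIV. tensor_herm (metric N d (f p))
          (tensor_op (clifford M c p (frame M c p j))
             (curvature N d (f p) (differential M f c d p (frame M c p j)) Y) (\<phi> c d p))
          (\<phi> c d p)))"

definition dirac_harmonic :: "'m::topological_space spin_surface \<Rightarrow>
    ('q::topological_space, real^'n) riem \<Rightarrow> ('m \<Rightarrow> 'q) \<Rightarrow> ('m, 'q, 'n) twisted \<Rightarrow> bool" where
  "dirac_harmonic M N f \<phi> \<longleftrightarrow>
     smooth_map M N f \<and> twisted_spinor_field M N f \<phi> \<and>
     (\<forall>p. \<forall>c\<in>charts_at M p. \<forall>d\<in>charts_at N (f p).
        twisted_dirac M N f \<phi> c d p = 0 \<and>
        tension M N f c d p = (1/2) *\<^sub>R V_field M N f \<phi> c d p)"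

definition chirality_condition :: "'m spin_surface \<Rightarrow> ('q, real^'n) riem \<Rightarrow> ('m \<Rightarrow> 'q) \<Rightarrow>
    (('m, real^2) chart \<Rightarrow> 'm \<Rightarrow> complex^2^2) \<Rightarrow> ('m, 'q, 'n) twisted \<Rightarrow> bool" where
  "chirality_condition M N f G \<phi> \<longleftrightarrow>
     (\<forall>p\<in>boundary M. \<forall>c\<in>charts_at M p. \<forall>d\<in>charts_at N (f p).
        tensor_op (clifford M c p (inner_normal M c p)) id (tensor_op (G c p) id (\<phi> c d p))
          = \<phi> c d p)"

end

theory Submission
  imports Defs
begin

text \<open>Everything is computed in the orthonormal frame \<open>E\<^sub>1, E\<^sub>2\<close> that comes with the spin structure.
  The sum \<open>\<Sum>\<^sub>j e\<^sub>j \<cdot> \<psi> \<otimes> f\<^sub>*(e\<^sub>j)\<close> is the trace of a bilinear form, so the chosen basis may be replaced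
  by this frame; this makes \<open>\<phi>\<close> smooth and gives its transformation law.

  Dirac equation. With \<open>\<nabla>\<psi> = \<alpha> X \<cdot> \<psi>\<close> one has
  \<open>\<nabla>\<^sub>X \<phi> = \<Sum>\<^sub>j \<alpha> E\<^sub>j \<cdot> X \<cdot> \<psi> \<otimes> f\<^sub>*(E\<^sub>j) + E\<^sub>j \<cdot> \<psi> \<otimes> (\<nabla>df)(X, E\<^sub>j)\<close>
  (\<open>twisted_deriv_frame_spinor\<close>). In \<open>D\<^sup>f \<phi>\<close> the first part contributes
  \<open>\<alpha> \<Sum>\<^sub>i\<^sub>j E\<^sub>i \<cdot> E\<^sub>j \<cdot> E\<^sub>i \<cdot> \<psi> \<otimes> f\<^sub>*(E\<^sub>j)\<close>, which vanishes since \<open>\<Sum>\<^sub>i E\<^sub>i \<cdot> X \<cdot> E\<^sub>i = 0\<close> in dimension two. As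
  \<open>\<nabla>df\<close> is symmetric, only the diagonal of the second part survives; it is \<open>- \<psi> \<otimes> tr(\<nabla>df)\<close>, and \<open>f\<close>
  is harmonic (\<open>twisted_dirac_frame_spinor\<close>).

  Map equation. The curvature of \<open>N\<close> takes values in skew endomorphisms, so \<open>h(V\<^sub>\<phi>, Y)\<close> only sees the
  part of \<open>\<langle>E\<^sub>j \<cdot> E\<^sub>k \<cdot> \<psi>, E\<^sub>l \<cdot> \<psi>\<rangle>\<close> that is skew in \<open>k\<close> and \<open>l\<close>. In dimension two this part is zero
  because Clifford multiplication by a vector is skew-Hermitian. Hence \<open>V\<^sub>\<phi> = 0 = 2 tr(\<nabla>df)\<close>
  (\<open>V_field_frame_spinor\<close>).

  Boundary condition. Let \<open>T\<close> be the unit tangent of the boundary and \<open>\<chi> = \<nu> \<cdot> \<G>\<psi> - \<psi>\<close>. The boundary is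
  totally geodesic, thus \<open>\<nu>\<close> is parallel along it, and with the chirality operator parallel and
  anti-commuting with \<open>T \<cdot>\<close> one finds \<open>\<nabla>\<^sub>T \<chi> = \<alpha> T \<cdot> \<chi>\<close> (\<open>has_dirder_chirality_defect\<close>). By uniqueness
  for this linear equation the zero set of \<open>\<chi>\<close> is open and closed in the boundary, and as the boundary
  is connected, one zero suffices for \<open>\<chi> = 0\<close> everywhere on it (\<open>chirality_defect_zero_on_boundary\<close>).
  By the Neumann condition \<open>\<phi> = T \<cdot> \<psi> \<otimes> f\<^sub>*(T)\<close> on the boundary, and \<open>\<nu> \<cdot> \<G>(T \<cdot> \<psi>) = T \<cdot> (\<nu> \<cdot> \<G>\<psi>) = T \<cdot> \<psi>\<close>,
  since \<open>T \<cdot>\<close> anti-commutes both with \<open>\<nu> \<cdot>\<close> and with the chirality operator.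

  The charts of \<open>M\<close> take values in a half-plane, so all derivatives are one-sided at the boundary. They
  are handled through local smooth extensions; in this way second derivatives commute up to the
  boundary, which gives the symmetry of \<open>\<nabla>df\<close>.\<close>

section \<open>Calculus of smooth maps\<close>

lemma Ck_on_subset: "Ck_on k U f \<Longrightarrow> V \<subseteq> U \<Longrightarrow> Ck_on k V f"
proof (induction k arbitrary: f)
  case 0
  then show ?case by (auto intro: continuous_on_subset)
next
  case (Suc k)
  then show ?case by auto
qed

lemma Ck_on_cong:
  assumes "open U"
  shows "(\<And>x. x \<in> U \<Longrightarrow> f x = g x) \<Longrightarrow> Ck_on k U f \<Longrightarrow> Ck_on k U g"
proof (induction k arbitrary: f g)
  case 0
  then show ?case using continuous_on_cong[of U U f g] by simp
next
  case (Suc k)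
  have d: "(g has_derivative frechet_derivative f (at x)) (at x)" if "x \<in> U" for x
    using Suc.prems that assms
    by (auto intro: has_derivative_transform_within_open[of f _ x UNIV U g] simp: frechet_derivative_works)
  have eq: "frechet_derivative g (at x) = frechet_derivative f (at x)" if "x \<in> U" for x
    using frechet_derivative_at[OF d[OF that]] by simp
  have "Ck_on k U (\<lambda>x. frechet_derivative g (at x) v)" for v
    by (rule Suc.IH[of "\<lambda>x. frechet_derivative f (at x) v"]) (use Suc.prems eq in auto)
  then show ?case using d by (auto simp: differentiable_def)
qed

text \<open>The definition of the class requires derivatives, not continuity, at positive order; that the classes
  decrease therefore rests on continuity of differentiable maps.\<close>

lemma Ck_on_pred: "Ck_on (Suc k) U f \<Longrightarrow> Ck_on k U f"
proof (induction k arbitrary: f)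
  case 0
  then show ?case
    by (auto simp: continuous_on_eq_continuous_within
        intro!: continuous_at_imp_continuous_within differentiable_imp_continuous_within
          intro: differentiable_at_withinI)
next
  case (Suc k)
  then have "Ck_on (Suc k) U (\<lambda>x. frechet_derivative f (at x) v)" for v
    by (metis Ck_on.simps(2))
  then have "Ck_on k U (\<lambda>x. frechet_derivative f (at x) v)" for v
    using Suc.IH by blast
  then show ?case using Suc.prems by simp
qed

lemma Ck_on_const: "Ck_on k U (\<lambda>x. c)"
proof (induction k arbitrary: c)
  case (Suc k)
  then show ?case by (simp add: frechet_derivative_const)
qed simp

lemma Ck_on_add:
  assumes "open U"
  shows "Ck_on k U f \<Longrightarrow> Ck_on k U g \<Longrightarrow> Ck_on k U (\<lambda>x. f x + g x)"
proof (induction k arbitrary: f g)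
  case 0
  then show ?case by (auto intro: continuous_intros)
next
  case (Suc k)
  have eq: "frechet_derivative (\<lambda>x. f x + g x) (at x) v =
      frechet_derivative f (at x) v + frechet_derivative g (at x) v" if "x \<in> U" for x v
  proof -
    have "((\<lambda>x. f x + g x) has_derivative
        (\<lambda>v. frechet_derivative f (at x) v + frechet_derivative g (at x) v)) (at x)"
      using that Suc.prems by (auto intro!: has_derivative_add simp: frechet_derivative_works)
    from frechet_derivative_at[OF this] show ?thesis by metis
  qed
  have "Ck_on k U (\<lambda>x. frechet_derivative (\<lambda>x. f x + g x) (at x) v)" for v
    by (rule Ck_on_cong[OF assms eq[symmetric]]) (use Suc in auto)
  then show ?case using Suc.prems by auto
qed

lemma Ck_on_bilinear:
  assumes "open U" and b: "bounded_bilinear b"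
  shows "Ck_on k U f \<Longrightarrow> Ck_on k U g \<Longrightarrow> Ck_on k U (\<lambda>x. b (f x) (g x))"
proof (induction k arbitrary: f g)
  case 0
  then show ?case by (auto intro: bounded_bilinear.continuous_on[OF b])
next
  case (Suc k)
  have d: "((\<lambda>x. b (f x) (g x)) has_derivative
      (\<lambda>v. b (f x) (frechet_derivative g (at x) v) + b (frechet_derivative f (at x) v) (g x))) (at x)"
    if "x \<in> U" for x
    using that Suc.prems
    by (auto intro!: bounded_bilinear.FDERIV[OF b] simp: frechet_derivative_works)
  have eq: "frechet_derivative (\<lambda>x. b (f x) (g x)) (at x) v =
      b (f x) (frechet_derivative g (at x) v) + b (frechet_derivative f (at x) v) (g x)"
    if "x \<in> U" for x v
    using frechet_derivative_at[OF d[OF that]] by metis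
  have low: "Ck_on k U f" "Ck_on k U g" using Suc.prems Ck_on_pred by blast+
  have "Ck_on k U (\<lambda>x. b (f x) (frechet_derivative g (at x) v))"
    "Ck_on k U (\<lambda>x. b (frechet_derivative f (at x) v) (g x))" for v
    using Suc.prems low by (auto intro: Suc.IH)
  then have "Ck_on k U (\<lambda>x. frechet_derivative (\<lambda>x. b (f x) (g x)) (at x) v)" for v
    by (intro Ck_on_cong[OF assms(1) eq[symmetric]] Ck_on_add[OF assms(1)])
  then show ?case using d by (auto simp: differentiable_def)
qed

lemma smooth_onE:
  assumes "smooth_on S f" "x \<in> S"
  obtains U g where "open U" "x \<in> U" "\<And>k. Ck_on k U g" "\<And>y. y \<in> S \<Longrightarrow> y \<in> U \<Longrightarrow> g y = f y"
proof -
  from assms(1)[unfolded smooth_on_def, rule_format, OF assms(2)] obtain U g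
    where "open U \<and> x \<in> U \<and> (\<forall>k. Ck_on k U g) \<and> (\<forall>y\<in>S \<inter> U. g y = f y)"
    by (elim exE)
  then show ?thesis by (intro that[of U g]) simp_all
qed

lemma smooth_onI:
  assumes "\<And>x. x \<in> S \<Longrightarrow> \<exists>U g. open U \<and> x \<in> U \<and> (\<forall>k. Ck_on k U g) \<and> (\<forall>y\<in>S \<inter> U. g y = f y)"
  shows "smooth_on S f"
  unfolding smooth_on_def by (rule ballI) (rule assms)

lemma smooth_on_subset:
  assumes "smooth_on S f" "T \<subseteq> S"
  shows "smooth_on T f"
proof (rule smooth_onI)
  fix x assume "x \<in> T"
  then have "x \<in> S" using assms(2) by (rule rev_subsetD)
  then obtain U g where g: "open U" "x \<in> U" "\<And>k. Ck_on k U g" "\<And>y. y \<in> S \<Longrightarrow> y \<in> U \<Longrightarrow> g y = f y"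
    by (rule smooth_onE[OF assms(1)]) (rule that)
  have "g y = f y" if "y \<in> T \<inter> U" for y
    using g(4)[of y] that assms(2) by fast
  with g(1-3) show "\<exists>U g. open U \<and> x \<in> U \<and> (\<forall>k. Ck_on k U g) \<and> (\<forall>y\<in>T \<inter> U. g y = f y)"
    by (intro exI[of _ U] exI[of _ g]) simp
qed

lemma smooth_on_cong:
  assumes "smooth_on S f" "\<And>x. x \<in> S \<Longrightarrow> f x = g x"
  shows "smooth_on S g"
proof (rule smooth_onI)
  fix x assume "x \<in> S"
  then obtain U f' where f': "open U" "x \<in> U" "\<And>k. Ck_on k U f'" "\<And>y. y \<in> S \<Longrightarrow> y \<in> U \<Longrightarrow> f' y = f y"
    by (rule smooth_onE[OF assms(1)]) (rule that)
  then show "\<exists>U h. open U \<and> x \<in> U \<and> (\<forall>k. Ck_on k U h) \<and> (\<forall>y\<in>S \<inter> U. h y = g y)"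
    using assms(2) by (intro exI[of _ U] exI[of _ f']) simp
qed

lemma smooth_on_const: "smooth_on S (\<lambda>x. c)"
  unfolding smooth_on_def by (intro ballI exI[of _ UNIV] exI[of _ "\<lambda>x. c"]) (simp add: Ck_on_const)

text \<open>Both arguments extend smoothly near a point, in general to different neighbourhoods. On their
  intersection the operation is applied to the extensions.\<close>

lemma smooth_on_binary:
  fixes f :: "'a::euclidean_space \<Rightarrow> 'b::real_normed_vector" and g :: "'a \<Rightarrow> 'c::real_normed_vector"
    and F :: "'b \<Rightarrow> 'c \<Rightarrow> 'd::real_normed_vector"
  assumes F: "\<And>k (U :: 'a set) f g. open U \<Longrightarrow> Ck_on k U f \<Longrightarrow> Ck_on k U g \<Longrightarrow> Ck_on k U (\<lambda>x. F (f x) (g x))"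
    and f: "smooth_on S f" and g: "smooth_on S g"
  shows "smooth_on S (\<lambda>x. F (f x) (g x))"
proof (rule smooth_onI)
  fix x assume x: "x \<in> S"
  obtain U f' where U: "open U" "x \<in> U" "\<And>k. Ck_on k U f'" "\<And>y. y \<in> S \<Longrightarrow> y \<in> U \<Longrightarrow> f' y = f y"
    by (rule smooth_onE[OF f x]) (rule that)
  obtain V g' where V: "open V" "x \<in> V" "\<And>k. Ck_on k V g'" "\<And>y. y \<in> S \<Longrightarrow> y \<in> V \<Longrightarrow> g' y = g y"
    by (rule smooth_onE[OF g x]) (rule that)
  have "Ck_on k (U \<inter> V) (\<lambda>x. F (f' x) (g' x))" for k
    using U(1) V(1) by (intro F[of "U \<inter> V" k f' g'] open_Int Ck_on_subset[OF U(3)] Ck_on_subset[OF V(3)]) simp_all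
  with U V show "\<exists>U h. open U \<and> x \<in> U \<and> (\<forall>k. Ck_on k U h) \<and> (\<forall>y\<in>S \<inter> U. h y = F (f y) (g y))"
    by (intro exI[of _ "U \<inter> V"] exI[of _ "\<lambda>x. F (f' x) (g' x)"]) (simp add: open_Int)
qed

lemma smooth_on_add: "smooth_on S f \<Longrightarrow> smooth_on S g \<Longrightarrow> smooth_on S (\<lambda>x. f x + g x)"
  by (rule smooth_on_binary) (auto intro: Ck_on_add)

lemma smooth_on_sum: "(\<And>i. i \<in> I \<Longrightarrow> smooth_on S (f i)) \<Longrightarrow> smooth_on S (\<lambda>x. \<Sum>i\<in>I. f i x)"
proof (induction I rule: infinite_finite_induct)
  case (insert i I)
  then show ?case by (simp add: smooth_on_add)
qed (auto simp: smooth_on_const)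

lemma smooth_on_bilinear:
  "bounded_bilinear b \<Longrightarrow> smooth_on S f \<Longrightarrow> smooth_on S g \<Longrightarrow> smooth_on S (\<lambda>x. b (f x) (g x))"
  by (rule smooth_on_binary) (auto intro: Ck_on_bilinear)

lemma smooth_on_linear:
  assumes "bounded_linear L" "smooth_on S f"
  shows "smooth_on S (\<lambda>x. L (f x))"
proof -
  have "smooth_on S (\<lambda>x. blinfun_apply (Blinfun L) (f x))"
    by (rule smooth_on_bilinear[OF bounded_bilinear_blinfun_apply smooth_on_const assms(2)])
  then show ?thesis by (simp add: bounded_linear_Blinfun_apply[OF assms(1)])
qed

text \<open>Schwarz's theorem. The second difference over the parallelogram spanned by \<open>h u\<close> and \<open>h v\<close> is
  \<open>h\<^sup>2\<close> times a value of either mixed derivative in the parallelogram, by the mean value theorem applied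
  first in one direction and then in the other. If the mixed derivatives differed at \<open>x\<close>, then by
  continuity their values would be disjoint on a small parallelogram.\<close>

lemma mixed_partials_real:
  fixes g :: "'a::euclidean_space \<Rightarrow> real"
  assumes "open U" "Ck_on 2 U g" "x \<in> U"
  shows "frechet_derivative (\<lambda>y. frechet_derivative g (at y) u) (at x) v =
         frechet_derivative (\<lambda>y. frechet_derivative g (at y) v) (at x) u"
proof (rule ccontr)
  define D where "D u y = frechet_derivative g (at y) u" for u y
  define DD where "DD u v y = frechet_derivative (D u) (at y) v" for u v y
  assume "\<not> ?thesis"
  then have ne: "DD u v x \<noteq> DD v u x" by (simp add: DD_def D_def[abs_def])
  define \<epsilon> where "\<epsilon> = \<bar>DD u v x - DD v u x\<bar> / 2"
  have \<epsilon>: "\<epsilon> > 0" using ne by (simp add: \<epsilon>_def)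
  have C: "Ck_on (Suc (Suc 0)) U g" using assms(2) by (simp add: numeral_2_eq_2 del: Ck_on.simps)
  have cont: "continuous_on U (DD u v)" for u v
    using C by (auto simp: DD_def[abs_def] D_def[abs_def])
  have dg: "(g has_derivative (\<lambda>w. D w y)) (at y)" if "y \<in> U" for y
    using C that by (auto simp: D_def frechet_derivative_works)
  have dD: "(D u has_derivative (\<lambda>w. DD u w y)) (at y)" if "y \<in> U" for y u
    using C that by (auto simp: D_def[abs_def] DD_def frechet_derivative_works)
  have "\<forall>\<^sub>F y in at x. DD u v y \<in> ball (DD u v x) \<epsilon>" for u v
    using cont[of u v] assms \<epsilon>
  proof -
    have "(DD u v \<longlongrightarrow> DD u v x) (at x)"
      using cont[of u v] assms by (simp add: continuous_on_eq_continuous_at continuous_within)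
    then show ?thesis using \<epsilon> by (auto dest!: topological_tendstoD[where S = "ball (DD u v x) \<epsilon>"])
  qed
  then have "\<forall>\<^sub>F y in nhds x. DD u v y \<in> ball (DD u v x) \<epsilon>" for u v
    using \<epsilon> by (simp add: eventually_nhds_conv_at)
  moreover have "\<forall>\<^sub>F y in nhds x. y \<in> U" using assms eventually_nhds by blast
  ultimately have "\<forall>\<^sub>F y in nhds x. y \<in> U \<and> DD u v y \<in> ball (DD u v x) \<epsilon> \<and> DD v u y \<in> ball (DD v u x) \<epsilon>"
    by (simp add: eventually_conj_iff)
  then obtain \<delta> where \<delta>: "\<delta> > 0"
    and near: "\<And>y. dist y x < \<delta> \<Longrightarrow> y \<in> U \<and> DD u v y \<in> ball (DD u v x) \<epsilon> \<and> DD v u y \<in> ball (DD v u x) \<epsilon>"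
    unfolding eventually_nhds_metric by metis
  \<comment> \<open>With this size the parallelogram lies in the ball of radius \<open>\<delta>\<close> around \<open>x\<close>.\<close>
  define h where "h = \<delta> / (2 * (norm u + norm v + 1))"
  have h: "h > 0" using \<delta> by (simp add: h_def add_nonneg_pos)
  have inU: "dist (x + s *\<^sub>R u + t *\<^sub>R v) x < \<delta>" if "0 \<le> s" "s \<le> h" "0 \<le> t" "t \<le> h" for s t
  proof -
    have "norm (s *\<^sub>R u + t *\<^sub>R v) \<le> s * norm u + t * norm v"
      using that norm_triangle_ineq[of "s *\<^sub>R u" "t *\<^sub>R v"] by simp
    also have "\<dots> \<le> h * norm u + h * norm v"
      using that by (intro add_mono mult_right_mono) auto
    also have "\<dots> \<le> h * (norm u + norm v + 1)" using h by (simp add: algebra_simps)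
    also have "\<dots> = \<delta> / 2"
    proof -
      have "norm u + norm v + 1 \<noteq> 0" by (smt (verit) norm_ge_zero)
      then show ?thesis unfolding h_def by (simp add: field_simps)
    qed
    finally show ?thesis using \<delta> by (simp add: dist_norm add.assoc)
  qed
  have key: "\<exists>y. dist y x < \<delta> \<and>
      g (x + h *\<^sub>R u + h *\<^sub>R v) - g (x + h *\<^sub>R u) - g (x + h *\<^sub>R v) + g x = h * h * DD u v y"
    if inU: "\<And>s t. 0 \<le> s \<Longrightarrow> s \<le> h \<Longrightarrow> 0 \<le> t \<Longrightarrow> t \<le> h \<Longrightarrow> dist (x + s *\<^sub>R u + t *\<^sub>R v) x < \<delta>"
      and near: "\<And>y. dist y x < \<delta> \<Longrightarrow> y \<in> U" for u v
  proof -
    have 1: "((\<lambda>s. g (x + s *\<^sub>R u + h *\<^sub>R v) - g (x + s *\<^sub>R u)) has_real_derivative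
        (D u (x + s *\<^sub>R u + h *\<^sub>R v) - D u (x + s *\<^sub>R u))) (at s)" if "0 \<le> s" "s \<le> h" for s
    proof -
      have a: "x + s *\<^sub>R u + h *\<^sub>R v \<in> U" using near inU[of s h] that h by auto
      have b: "x + s *\<^sub>R u \<in> U" using near inU[of s 0] that h by auto
      have lin: "D (k *\<^sub>R u) y = k * D u y" if "y \<in> U" for y k
        using linear_cmul[OF has_derivative_linear[OF dg[OF that]]] by simp
      have "((\<lambda>s. g (x + s *\<^sub>R u + h *\<^sub>R v) - g (x + s *\<^sub>R u)) has_derivative
        (\<lambda>k. D (k *\<^sub>R u) (x + s *\<^sub>R u + h *\<^sub>R v) - D (k *\<^sub>R u) (x + s *\<^sub>R u))) (at s)"
        by (intro has_derivative_diff
            has_derivative_compose[of "\<lambda>s. x + s *\<^sub>R u + h *\<^sub>R v" "\<lambda>k. k *\<^sub>R u" s UNIV g, OF _ dg[OF a]]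
            has_derivative_compose[of "\<lambda>s. x + s *\<^sub>R u" "\<lambda>k. k *\<^sub>R u" s UNIV g, OF _ dg[OF b]])
          (auto intro!: derivative_eq_intros)
      then show ?thesis
        unfolding has_field_derivative_def
        by (rule has_derivative_eq_rhs) (simp add: fun_eq_iff lin a b right_diff_distrib left_diff_distrib mult.commute)
    qed
    obtain s where s: "0 < s" "s < h" and
      s_eq: "(g (x + h *\<^sub>R u + h *\<^sub>R v) - g (x + h *\<^sub>R u)) - (g (x + 0 *\<^sub>R u + h *\<^sub>R v) - g (x + 0 *\<^sub>R u))
        = (h - 0) * (D u (x + s *\<^sub>R u + h *\<^sub>R v) - D u (x + s *\<^sub>R u))"
      using MVT2[OF h, of "\<lambda>s. g (x + s *\<^sub>R u + h *\<^sub>R v) - g (x + s *\<^sub>R u)", OF 1] by blast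
    have 2: "((\<lambda>t. D u (x + s *\<^sub>R u + t *\<^sub>R v)) has_real_derivative DD u v (x + s *\<^sub>R u + t *\<^sub>R v)) (at t)"
      if "0 \<le> t" "t \<le> h" for t
    proof -
      have a: "x + s *\<^sub>R u + t *\<^sub>R v \<in> U" using near inU[of s t] that s by auto
      have lin: "DD u (k *\<^sub>R v) y = k * DD u v y" if "y \<in> U" for y k
        using linear_cmul[OF has_derivative_linear[OF dD[OF that]]] by simp
      have "((\<lambda>t. D u (x + s *\<^sub>R u + t *\<^sub>R v)) has_derivative
        (\<lambda>k. DD u (k *\<^sub>R v) (x + s *\<^sub>R u + t *\<^sub>R v))) (at t)"
        by (rule has_derivative_compose[of "\<lambda>t. x + s *\<^sub>R u + t *\<^sub>R v" "\<lambda>k. k *\<^sub>R v" t UNIV "D u", OF _ dD[OF a]])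
          (auto intro!: derivative_eq_intros)
      then show ?thesis
        unfolding has_field_derivative_def
        by (rule has_derivative_eq_rhs) (simp add: fun_eq_iff lin a mult.commute)
    qed
    obtain t where t: "0 < t" "t < h" and
      t_eq: "D u (x + s *\<^sub>R u + h *\<^sub>R v) - D u (x + s *\<^sub>R u + 0 *\<^sub>R v) = (h - 0) * DD u v (x + s *\<^sub>R u + t *\<^sub>R v)"
      using MVT2[OF h, of "\<lambda>t. D u (x + s *\<^sub>R u + t *\<^sub>R v)", OF 2] by blast
    show ?thesis
      using s_eq t_eq s t inU[of s t]
      by (intro exI[of _ "x + s *\<^sub>R u + t *\<^sub>R v"]) (simp add: algebra_simps)
  qed
  have inU': "dist (x + s *\<^sub>R v + t *\<^sub>R u) x < \<delta>" if "0 \<le> s" "s \<le> h" "0 \<le> t" "t \<le> h" for s t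
  proof -
    have "x + s *\<^sub>R v + t *\<^sub>R u = x + t *\<^sub>R u + s *\<^sub>R v" by simp
    with inU[of t s] that show ?thesis by metis
  qed
  obtain y where y: "dist y x < \<delta>"
    "g (x + h *\<^sub>R u + h *\<^sub>R v) - g (x + h *\<^sub>R u) - g (x + h *\<^sub>R v) + g x = h * h * DD u v y"
    using key[OF inU conjunct1[OF near]] by blast
  obtain z where z: "dist z x < \<delta>"
    "g (x + h *\<^sub>R v + h *\<^sub>R u) - g (x + h *\<^sub>R v) - g (x + h *\<^sub>R u) + g x = h * h * DD v u z"
    using key[OF inU' conjunct1[OF near]] by blast
  have "h * h * DD u v y = h * h * DD v u z"
  proof -
    have "x + h *\<^sub>R u + h *\<^sub>R v = x + h *\<^sub>R v + h *\<^sub>R u" by simp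
    from y(2)[unfolded this] z(2) show ?thesis by linarith
  qed
  then have "DD u v y = DD v u z" using h by simp
  moreover have "\<bar>DD u v x - DD u v y\<bar> < \<epsilon>" "\<bar>DD v u x - DD v u z\<bar> < \<epsilon>"
    using near[OF y(1)] near[OF z(1)] by (auto simp: dist_real_def)
  ultimately have "\<bar>DD u v x - DD v u x\<bar> < 2 * \<epsilon>" by linarith
  then show False by (simp add: \<epsilon>_def)
qed

lemma mixed_partials:
  fixes g :: "'a::euclidean_space \<Rightarrow> 'b::euclidean_space"
  assumes "open U" "Ck_on 2 U g" "x \<in> U"
  shows "frechet_derivative (\<lambda>y. frechet_derivative g (at y) u) (at x) v =
         frechet_derivative (\<lambda>y. frechet_derivative g (at y) v) (at x) u"
proof (rule euclidean_eqI)
  fix b :: 'b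
  have C: "Ck_on (Suc (Suc 0)) U g" using assms(2) by (simp add: numeral_2_eq_2 del: Ck_on.simps)
  have inner: "frechet_derivative (\<lambda>y. f y \<bullet> b) (at y) w = frechet_derivative f (at y) w \<bullet> b"
    if "f differentiable at y" for f :: "'a \<Rightarrow> 'b" and y w
  proof -
    have "((\<lambda>y. f y \<bullet> b) has_derivative (\<lambda>w. frechet_derivative f (at y) w \<bullet> b)) (at y)"
      using that by (auto intro!: derivative_eq_intros simp: frechet_derivative_works)
    from frechet_derivative_at[OF this] show ?thesis by metis
  qed
  have second: "frechet_derivative (\<lambda>y. frechet_derivative (\<lambda>y. g y \<bullet> b) (at y) u) (at x) v
      = frechet_derivative (\<lambda>y. frechet_derivative g (at y) u) (at x) v \<bullet> b" for u v
  proof -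
    have d: "(\<lambda>y. frechet_derivative g (at y) u) differentiable (at x)"
      using C assms(3) by simp
    have "((\<lambda>y. frechet_derivative g (at y) u \<bullet> b) has_derivative
        (\<lambda>v. frechet_derivative (\<lambda>y. frechet_derivative g (at y) u) (at x) v \<bullet> b)) (at x)"
      using d by (auto intro!: derivative_eq_intros simp: frechet_derivative_works)
    then have "((\<lambda>y. frechet_derivative (\<lambda>y. g y \<bullet> b) (at y) u) has_derivative
        (\<lambda>v. frechet_derivative (\<lambda>y. frechet_derivative g (at y) u) (at x) v \<bullet> b)) (at x)"
      by (rule has_derivative_transform_within_open[OF _ assms(1,3)]) (use C in \<open>simp add: inner\<close>)
    from frechet_derivative_at[OF this] show ?thesis by metis
  qed
  have "Ck_on 2 U (\<lambda>y. g y \<bullet> b)"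
    by (rule Ck_on_bilinear[OF assms(1) bounded_bilinear_inner assms(2) Ck_on_const])
  from mixed_partials_real[OF assms(1) this assms(3)]
  show "frechet_derivative (\<lambda>y. frechet_derivative g (at y) u) (at x) v \<bullet> b =
        frechet_derivative (\<lambda>y. frechet_derivative g (at y) v) (at x) u \<bullet> b"
    by (simp add: second)
qed

section \<open>One-sided derivatives\<close>

text \<open>Derivatives within such a set are unique. The step \<open>d\<close> may have either sign, as boundary points of a
  half-plane can be approached from one side only.\<close>

definition thick :: "'a::euclidean_space set \<Rightarrow> bool" where
  "thick H \<longleftrightarrow> (\<forall>x\<in>H. \<forall>i\<in>Basis. \<forall>e>0. \<exists>d. 0 < \<bar>d\<bar> \<and> \<bar>d\<bar> < e \<and> x + d *\<^sub>R i \<in> H)"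

lemma thick_UNIV: "thick UNIV"
  unfolding thick_def
proof (intro ballI allI impI)
  fix x i :: 'a and e :: real
  assume "0 < e"
  then show "\<exists>d. 0 < \<bar>d\<bar> \<and> \<bar>d\<bar> < e \<and> x + d *\<^sub>R i \<in> UNIV"
    by (intro exI[of _ "e / 2"]) auto
qed

lemma thick_half_plane: "thick half_plane"
  unfolding thick_def half_plane_def
proof (intro ballI allI impI)
  fix x i :: "real^2" and e :: real
  assume "x \<in> {x. 0 \<le> x $ 2}" "i \<in> Basis" "0 < e"
  moreover have "0 \<le> i $ 2" using \<open>i \<in> Basis\<close> by (auto simp: Basis_vec_def axis_def)
  ultimately show "\<exists>d. 0 < \<bar>d\<bar> \<and> \<bar>d\<bar> < e \<and> x + d *\<^sub>R i \<in> {x. 0 \<le> x $ 2}"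
    by (intro exI[of _ "e / 2"]) auto
qed

lemma frechet_derivative_within_thick:
  assumes "thick H" "x \<in> H" "(f has_derivative f') (at x within H)"
  shows "frechet_derivative f (at x within H) = f'"
proof (rule frechet_derivative_unique_within[symmetric])
  show "(f has_derivative frechet_derivative f (at x within H)) (at x within H)"
    using assms(3) differentiableI frechet_derivative_works by blast
qed (use assms in \<open>auto simp: thick_def\<close>)

lemma at_within_openin:
  assumes "openin (top_of_set H) T" "x \<in> T"
  shows "at x within T = at x within H"
proof -
  obtain W where "open W" "T = H \<inter> W" using assms(1) by (auto simp: openin_open)
  then show ?thesis using assms(2) by (intro at_within_nhd[of x W]) auto
qed

text \<open>Near a point of a relatively open subset \<open>T\<close> of \<open>H\<close>, the extension agrees with \<open>u\<close> on all of \<open>H\<close>, so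
  that it determines the derivatives of \<open>u\<close> within \<open>H\<close>.\<close>

lemma smooth_on_openinE:
  assumes "openin (top_of_set H) T" "smooth_on T u" "x \<in> T"
  obtains U g where "open U" "x \<in> U" "H \<inter> U \<subseteq> T" "\<And>k. Ck_on k U g" "\<And>y. y \<in> H \<Longrightarrow> y \<in> U \<Longrightarrow> g y = u y"
proof -
  obtain W where W: "open W" "T = H \<inter> W" using assms(1) by (auto simp: openin_open)
  obtain U g where U: "open U" "x \<in> U" "\<And>k. Ck_on k U g" "\<And>y. y \<in> T \<Longrightarrow> y \<in> U \<Longrightarrow> g y = u y"
    by (rule smooth_onE[OF assms(2,3)]) (rule that)
  show ?thesis
    using W U assms(3) by (intro that[of "U \<inter> W" g] open_Int Ck_on_subset[OF U(3)]) auto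
qed

lemma derivative_within_of_extension:
  assumes "thick H" "open U" "\<And>k. Ck_on k U g" "\<And>y. y \<in> H \<Longrightarrow> y \<in> U \<Longrightarrow> g y = u y"
    and "x \<in> U" "x \<in> H"
  shows "(u has_derivative frechet_derivative g (at x)) (at x within H)"
    and "frechet_derivative u (at x within H) = frechet_derivative g (at x)"
proof -
  have "Ck_on (Suc 0) U g" by (rule assms(3))
  then have "(g has_derivative frechet_derivative g (at x)) (at x)"
    using assms(5) by (simp add: frechet_derivative_works)
  then have "(g has_derivative frechet_derivative g (at x)) (at x within H)"
    by (rule has_derivative_at_withinI)
  then show d: "(u has_derivative frechet_derivative g (at x)) (at x within H)"
  proof -
    obtain r where "r > 0" "ball x r \<subseteq> U" using assms(2,5) openE by blast
    then show ?thesis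
      using assms(4,6) \<open>(g has_derivative _) (at x within H)\<close>
      by (intro has_derivative_transform_within[of g _ x H r u]) (auto simp: dist_commute subset_iff)
  qed
  then show "frechet_derivative u (at x within H) = frechet_derivative g (at x)"
    by (rule frechet_derivative_within_thick[OF assms(1,6)])
qed

lemma smooth_on_has_derivative:
  assumes "thick H" "openin (top_of_set H) T" "smooth_on T u" "x \<in> T"
  shows "(u has_derivative frechet_derivative u (at x within H)) (at x within H)"
proof -
  obtain U g where U: "open U" "x \<in> U" "H \<inter> U \<subseteq> T" "\<And>k. Ck_on k U g" "\<And>y. y \<in> H \<Longrightarrow> y \<in> U \<Longrightarrow> g y = u y"
    by (rule smooth_on_openinE[OF assms(2-4)]) (rule that)
  have "x \<in> H" using assms(2,4) openin_imp_subset by blast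
  from derivative_within_of_extension[OF assms(1) U(1,4,5,2) this] show ?thesis by simp
qed

lemma smooth_on_frechet_derivative:
  assumes "thick H" "openin (top_of_set H) T" "smooth_on T u"
  shows "smooth_on T (\<lambda>x. frechet_derivative u (at x within H) v)"
proof (rule smooth_onI)
  fix x assume "x \<in> T"
  obtain U g where U: "open U" "x \<in> U" "H \<inter> U \<subseteq> T" "\<And>k. Ck_on k U g" "\<And>y. y \<in> H \<Longrightarrow> y \<in> U \<Longrightarrow> g y = u y"
    by (rule smooth_on_openinE[OF assms(2,3) \<open>x \<in> T\<close>]) (rule that)
  have "Ck_on (Suc k) U g" for k by (rule U(4))
  then have "Ck_on k U (\<lambda>x. frechet_derivative g (at x) v)" for k by simp
  moreover have "T \<subseteq> H" using assms(2) openin_imp_subset by blast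
  then have "frechet_derivative g (at y) v = frechet_derivative u (at y within H) v" if "y \<in> T \<inter> U" for y
    using derivative_within_of_extension(2)[OF assms(1) U(1,4,5), of y] that by auto
  ultimately show "\<exists>U h. open U \<and> x \<in> U \<and> (\<forall>k. Ck_on k U h) \<and>
      (\<forall>y\<in>T \<inter> U. h y = frechet_derivative u (at y within H) v)"
    using U(1,2) by (intro exI[of _ U] exI[of _ "\<lambda>x. frechet_derivative g (at x) v"]) simp
qed

text \<open>Near \<open>x\<close> the derivatives within \<open>H\<close>, of first and of second order, are those of a smooth extension, to
  which Schwarz's theorem applies.\<close>

lemma mixed_partials_within:
  fixes u :: "'a::euclidean_space \<Rightarrow> 'b::euclidean_space"
  assumes "thick H" "openin (top_of_set H) T" "smooth_on T u" "x \<in> T"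
  shows "frechet_derivative (\<lambda>y. frechet_derivative u (at y within H) v) (at x within H) w =
         frechet_derivative (\<lambda>y. frechet_derivative u (at y within H) w) (at x within H) v"
proof -
  obtain U g where U: "open U" "x \<in> U" "H \<inter> U \<subseteq> T" "\<And>k. Ck_on k U g" "\<And>y. y \<in> H \<Longrightarrow> y \<in> U \<Longrightarrow> g y = u y"
    by (rule smooth_on_openinE[OF assms(2-4)]) (rule that)
  have xH: "x \<in> H" using assms(2,4) openin_imp_subset by blast
  have "Ck_on (Suc k) U g" for k by (rule U(4))
  then have C: "Ck_on k U (\<lambda>x. frechet_derivative g (at x) v)" for k v by simp
  have first: "frechet_derivative g (at y) v = frechet_derivative u (at y within H) v"
    if "y \<in> H" "y \<in> U" for y v
    using derivative_within_of_extension(2)[OF assms(1) U(1,4,5), of y] that by auto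
  have "frechet_derivative (\<lambda>y. frechet_derivative u (at y within H) v) (at x within H) w =
      frechet_derivative (\<lambda>y. frechet_derivative g (at y) v) (at x) w" for v w
    using derivative_within_of_extension(2)[OF assms(1) U(1) C first U(2) xH] by metis
  then show ?thesis using mixed_partials[OF U(1) U(4) U(2)] by simp
qed

section \<open>Directional derivatives on manifolds\<close>

text \<open>The relational form of \<open>dirder\<close>: it allows the usual differentiation rules to be chained.\<close>

definition has_dirder :: "('m, 'e::euclidean_space, 'z) riem_scheme \<Rightarrow> ('m, 'e) chart \<Rightarrow>
    ('m \<Rightarrow> 'b::real_normed_vector) \<Rightarrow> 'm \<Rightarrow> ('e \<Rightarrow> 'b) \<Rightarrow> bool" where
  "has_dirder M c u p u' \<longleftrightarrow>
     ((\<lambda>x. u (param c x)) has_derivative u') (at (coord c p) within model M)"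

lemma has_dirder_const: "has_dirder M c (\<lambda>q. k) p (\<lambda>X. 0)"
  by (simp add: has_dirder_def)

lemma has_dirder_add:
  "has_dirder M c u p u' \<Longrightarrow> has_dirder M c v p v' \<Longrightarrow> has_dirder M c (\<lambda>q. u q + v q) p (\<lambda>X. u' X + v' X)"
  by (simp add: has_dirder_def has_derivative_add)

lemma has_dirder_diff:
  "has_dirder M c u p u' \<Longrightarrow> has_dirder M c v p v' \<Longrightarrow> has_dirder M c (\<lambda>q. u q - v q) p (\<lambda>X. u' X - v' X)"
  by (simp add: has_dirder_def has_derivative_diff)

lemma has_dirder_sum:
  "(\<And>i. i \<in> I \<Longrightarrow> has_dirder M c (u i) p (u' i)) \<Longrightarrow>
   has_dirder M c (\<lambda>q. \<Sum>i\<in>I. u i q) p (\<lambda>X. \<Sum>i\<in>I. u' i X)"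
  by (simp add: has_dirder_def has_derivative_sum)

lemma has_dirder_linear:
  "bounded_linear L \<Longrightarrow> has_dirder M c u p u' \<Longrightarrow> has_dirder M c (\<lambda>q. L (u q)) p (\<lambda>X. L (u' X))"
  unfolding has_dirder_def by (rule bounded_linear.has_derivative)

lemma has_dirder_linearD: "has_dirder M c u p u' \<Longrightarrow> linear u'"
  by (auto simp: has_dirder_def has_derivative_linear)

locale riemannian =
  fixes M :: "('m::{t2_space,second_countable_topology}, 'e::euclidean_space, 'z) riem_scheme"
  assumes riemannian: "riemannian_manifold M" and thick: "thick (model M)"
begin

lemma smooth_manifold: "smooth_manifold M"
  using riemannian by (simp add: riemannian_manifold_def)

lemma open_cdom: "c \<in> charts M \<Longrightarrow> open (cdom c)"
  using smooth_manifold by (simp add: smooth_manifold_def)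

lemma chart_homeomorphism:
  "c \<in> charts M \<Longrightarrow> homeomorphism (cdom c) (coord c ` cdom c) (coord c) (param c)"
  using smooth_manifold by (simp add: smooth_manifold_def)

lemma param_coord: "c \<in> charts M \<Longrightarrow> p \<in> cdom c \<Longrightarrow> param c (coord c p) = p"
  using chart_homeomorphism by (metis homeomorphism_apply1)

lemma openin_chart_image:
  assumes "c \<in> charts M" "open W"
  shows "openin (top_of_set (model M)) (coord c ` (cdom c \<inter> W))"
proof -
  have "openin (top_of_set (coord c ` cdom c)) (coord c ` (cdom c \<inter> W))"
    using homeomorphism_imp_open_map[OF chart_homeomorphism[OF assms(1)]] assms(2) openin_open_Int by blast
  then show ?thesis
    using smooth_manifold assms(1) openin_trans unfolding smooth_manifold_def by blast
qed

lemma coord_in_model: "c \<in> charts M \<Longrightarrow> p \<in> cdom c \<Longrightarrow> coord c p \<in> model M"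
  using openin_chart_image[of c UNIV] openin_imp_subset by fastforce

lemma dirder_eq:
  assumes "c \<in> charts M" "p \<in> cdom c" "has_dirder M c u p u'"
  shows "dirder M c u p = u'"
  using frechet_derivative_within_thick[OF thick coord_in_model[OF assms(1,2)]] assms(3)
  by (simp add: dirder_def[abs_def] has_dirder_def o_def)

lemma smooth_in_has_dirder:
  assumes "c \<in> charts M" "open W" "p \<in> cdom c" "p \<in> W" "smooth_in c (cdom c \<inter> W) u"
  shows "has_dirder M c u p (dirder M c u p)"
  using smooth_on_has_derivative[OF thick openin_chart_image[OF assms(1,2)], of "u \<circ> param c" "coord c p"] assms
  by (simp add: has_dirder_def dirder_def[abs_def] smooth_in_def o_def)

lemma smooth_in_dirder:
  assumes "c \<in> charts M" "open W" "smooth_in c (cdom c \<inter> W) u"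
  shows "smooth_in c (cdom c \<inter> W) (\<lambda>q. dirder M c u q X)"
  unfolding smooth_in_def
  by (rule smooth_on_cong[OF smooth_on_frechet_derivative[OF thick openin_chart_image[OF assms(1,2)] assms(3)[unfolded smooth_in_def], of X]])
    (auto simp: dirder_def param_coord[OF assms(1)])

lemma has_dirder_cong:
  assumes "c \<in> charts M" "open W" "p \<in> cdom c" "p \<in> W" "\<And>q. q \<in> cdom c \<Longrightarrow> q \<in> W \<Longrightarrow> u q = v q"
    and "has_dirder M c u p u'"
  shows "has_dirder M c v p u'"
proof -
  let ?T = "coord c ` (cdom c \<inter> W)"
  have T: "at (coord c p) within ?T = at (coord c p) within model M"
    using assms by (intro at_within_openin openin_chart_image) auto
  have "((\<lambda>x. u (param c x)) has_derivative u') (at (coord c p) within ?T)"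
    using assms(6) T by (simp add: has_dirder_def)
  then have "((\<lambda>x. v (param c x)) has_derivative u') (at (coord c p) within ?T)"
    by (rule has_derivative_transform[rotated 2]) (use assms param_coord[OF assms(1)] in auto)
  then show ?thesis using T by (simp add: has_dirder_def)
qed

lemma mixed_dirder:
  fixes u :: "'m \<Rightarrow> 'b::euclidean_space"
  assumes "c \<in> charts M" "open W" "p \<in> cdom c" "p \<in> W" "smooth_in c (cdom c \<inter> W) u"
  shows "dirder M c (\<lambda>q. dirder M c u q X) p Y = dirder M c (\<lambda>q. dirder M c u q Y) p X"
proof -
  let ?D = "\<lambda>X x. frechet_derivative (u \<circ> param c) (at x within model M) X"
  have eq: "dirder M c (\<lambda>q. dirder M c u q X) p Y = frechet_derivative (?D X) (at (coord c p) within model M) Y"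
    for X Y
  proof -
    have "smooth_on (coord c ` (cdom c \<inter> W)) (?D X)"
      using assms(5) by (intro smooth_on_frechet_derivative[OF thick openin_chart_image[OF assms(1,2)]])
        (simp add: smooth_in_def)
    then have d: "(?D X has_derivative frechet_derivative (?D X) (at (coord c p) within model M)) (at (coord c p) within model M)"
      by (rule smooth_on_has_derivative[OF thick openin_chart_image[OF assms(1,2)]]) (use assms in auto)
    let ?T = "coord c ` (cdom c \<inter> W)"
    have T: "at (coord c p) within ?T = at (coord c p) within model M"
      using assms by (intro at_within_openin openin_chart_image) auto
    have "(?D X has_derivative frechet_derivative (?D X) (at (coord c p) within model M)) (at (coord c p) within ?T)"
      using d by (simp add: T)
    then have "((\<lambda>x. dirder M c u (param c x) X) has_derivative frechet_derivative (?D X) (at (coord c p) within model M)) (at (coord c p) within ?T)"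
      by (rule has_derivative_transform[rotated 2])
        (use assms param_coord[OF assms(1)] in \<open>auto simp: dirder_def\<close>)
    then have "has_dirder M c (\<lambda>q. dirder M c u q X) p (frechet_derivative (?D X) (at (coord c p) within model M))"
      by (simp add: has_dirder_def T)
    from dirder_eq[OF assms(1,3) this] show ?thesis by (simp only:)
  qed
  show ?thesis
    unfolding eq
    by (rule mixed_partials_within[OF thick openin_chart_image[OF assms(1,2)]])
      (use assms in \<open>auto simp: smooth_in_def\<close>)
qed

end

text \<open>The chain rule, for a continuous map \<open>f\<close> between manifolds. For the identity map it describes a change
  of charts.\<close>

lemma has_dirder_compose:
  fixes M :: "('m::{t2_space,second_countable_topology}, 'e::euclidean_space, 'z) riem_scheme"
    and N :: "('q::{t2_space,second_countable_topology}, 'f::euclidean_space, 'y) riem_scheme"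
  assumes "riemannian M" "riemannian N" "c \<in> charts M" "d \<in> charts N" "p \<in> cdom c" "f p \<in> cdom d"
    and "continuous_on UNIV f"
    and h: "has_dirder M c (coord d \<circ> f) p h'" and u: "has_dirder N d u (f p) u'"
  shows "has_dirder M c (u \<circ> f) p (u' \<circ> h')"
proof -
  interpret M: riemannian M by fact
  interpret N: riemannian N by fact
  let ?T = "coord c ` (cdom c \<inter> f -` cdom d)"
  \<comment> \<open>Outside of the chart domains the parametrizations have arbitrary values, so the composition is
    formed on a relatively open subset of the model space.\<close>
  have "open (f -` cdom d)" using assms N.open_cdom open_vimage by blast
  then have T: "at (coord c p) within ?T = at (coord c p) within model M"
    using assms by (intro at_within_openin M.openin_chart_image) auto
  let ?h = "\<lambda>x. (coord d \<circ> f) (param c x)"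
  have 1: "(?h has_derivative h') (at (coord c p) within ?T)"
    using h T by (simp add: has_dirder_def)
  have "((\<lambda>y. u (param d y)) has_derivative u') (at (coord d (f p)) within model N)"
    using u by (simp add: has_dirder_def)
  moreover have "?h ` ?T \<subseteq> model N"
    using assms M.param_coord[OF assms(3)] N.coord_in_model[OF assms(4)] by auto
  moreover have "?h (coord c p) = coord d (f p)" by (simp add: M.param_coord assms)
  ultimately have "((\<lambda>y. u (param d y)) has_derivative u') (at (?h (coord c p)) within ?h ` ?T)"
    using has_derivative_subset by metis
  from has_derivative_in_compose[OF 1 this]
  have "((\<lambda>x. u (param d (?h x))) has_derivative (\<lambda>x. u' (h' x))) (at (coord c p) within ?T)" .
  then have "((\<lambda>x. (u \<circ> f) (param c x)) has_derivative (u' \<circ> h')) (at (coord c p) within ?T)"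
    unfolding o_def[of u' h']
    by (rule has_derivative_transform[rotated 2])
      (use assms M.param_coord[OF assms(3)] N.param_coord[OF assms(4)] in auto)
  then show ?thesis using T by (simp add: has_dirder_def)
qed

section \<open>The Levi-Civita connection\<close>

lemma bilinear_expand:
  fixes h :: "'e::euclidean_space \<Rightarrow> 'e \<Rightarrow> real"
  assumes "bilinear h"
  shows "h a b = (\<Sum>i\<in>Basis. \<Sum>j\<in>Basis. (a \<bullet> i) * ((b \<bullet> j) * h i j))"
proof -
  have "h a b = h (\<Sum>i\<in>Basis. (a \<bullet> i) *\<^sub>R i) (\<Sum>j\<in>Basis. (b \<bullet> j) *\<^sub>R j)"
    by (simp add: euclidean_representation)
  also have "\<dots> = (\<Sum>i\<in>Basis. \<Sum>j\<in>Basis. (a \<bullet> i) * ((b \<bullet> j) * h i j))"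
    by (simp add: bilinear_sum[OF assms] sum.cartesian_product bilinear_lmul[OF assms] bilinear_rmul[OF assms] mult.left_commute)
  finally show ?thesis .
qed

context riemannian
begin

lemma has_dirder_product:
  assumes "c \<in> charts M" "p \<in> cdom c" "bounded_bilinear b" "has_dirder M c u p u'" "has_dirder M c v p v'"
  shows "has_dirder M c (\<lambda>q. b (u q) (v q)) p (\<lambda>X. b (u p) (v' X) + b (u' X) (v p))"
  using bounded_bilinear.FDERIV[OF assms(3) assms(4,5)[unfolded has_dirder_def]]
  by (simp add: has_dirder_def param_coord[OF assms(1,2)])

lemma metric_bilinear: "c \<in> charts M \<Longrightarrow> p \<in> cdom c \<Longrightarrow> bilinear (metric M c p)"
  and metric_sym: "c \<in> charts M \<Longrightarrow> p \<in> cdom c \<Longrightarrow> metric M c p v w = metric M c p w v"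
  and metric_pos: "c \<in> charts M \<Longrightarrow> p \<in> cdom c \<Longrightarrow> v \<noteq> 0 \<Longrightarrow> 0 < metric M c p v v"
  and metric_smooth: "c \<in> charts M \<Longrightarrow> smooth_in c (cdom c) (\<lambda>p. metric M c p v w)"
  using riemannian by (auto simp: riemannian_manifold_def)

lemma metric_chart_change:
  assumes c: "c \<in> charts M" "p \<in> cdom c" and c': "c' \<in> charts M" "p \<in> cdom c'"
  shows "metric M c p (dirder M c' (coord c) p v) (dirder M c' (coord c) p w) = metric M c' p v w"
  by (rule conjunct2[OF conjunct2[OF riemannian[unfolded riemannian_manifold_def]], rule_format])
    (simp_all add: charts_at_def c c')

lemma metric_nondegenerate:
  assumes "c \<in> charts M" "p \<in> cdom c" "\<And>z. metric M c p v z = metric M c p w z"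
  shows "v = w"
proof (rule ccontr)
  assume "v \<noteq> w"
  then have "0 < metric M c p (v - w) (v - w)" using metric_pos[OF assms(1,2)] by simp
  then show False
    using assms(3) by (simp add: bilinear_lsub[OF metric_bilinear[OF assms(1,2)]])
qed

lemma has_dirder_metric_const:
  assumes "c \<in> charts M" "p \<in> cdom c"
  shows "has_dirder M c (\<lambda>q. metric M c q v w) p (dirder M c (\<lambda>q. metric M c q v w) p)"
  by (rule smooth_in_has_dirder[OF assms(1) open_UNIV assms(2) UNIV_I]) (simp add: metric_smooth[OF assms(1)])

text \<open>The metric is a bilinear form with variable coefficients; expanded in the standard basis, its value on
  two fields becomes a sum of products of scalar functions.\<close>

lemma has_dirder_metric:
  assumes c: "c \<in> charts M" and p: "p \<in> cdom c" and A: "has_dirder M c A p A'" and B: "has_dirder M c B p B'"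
  shows "has_dirder M c (\<lambda>q. metric M c q (A q) (B q)) p
    (\<lambda>X. dirder M c (\<lambda>q. metric M c q (A p) (B p)) p X + metric M c p (A' X) (B p) + metric M c p (A p) (B' X))"
proof -
  let ?D = "\<lambda>i j. dirder M c (\<lambda>q. metric M c q i j) p"
  let ?E = "\<lambda>X. \<Sum>i\<in>Basis. \<Sum>j\<in>Basis.
       (A p \<bullet> i) * ((B p \<bullet> j) * ?D i j X + (B' X \<bullet> j) * metric M c p i j) + (A' X \<bullet> i) * ((B p \<bullet> j) * metric M c p i j)"
  have comp: "has_dirder M c (\<lambda>q. u q \<bullet> i) p (\<lambda>X. u' X \<bullet> i)" if "has_dirder M c u p u'" for u u' and i :: 'e
    using that by (rule has_dirder_linear[OF bounded_linear_inner_left])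
  have gen: "has_dirder M c (\<lambda>q. metric M c q (A q) (B q)) p (\<lambda>X. \<Sum>i\<in>Basis. \<Sum>j\<in>Basis.
       (A p \<bullet> i) * ((B p \<bullet> j) * ?D i j X + (B' X \<bullet> j) * metric M c p i j) + (A' X \<bullet> i) * ((B p \<bullet> j) * metric M c p i j))"
    if A: "has_dirder M c A p A'" and B: "has_dirder M c B p B'" for A A' B B'
  proof (rule has_dirder_cong[OF c open_UNIV p UNIV_I])
    show "(\<Sum>i\<in>Basis. \<Sum>j\<in>Basis. (A q \<bullet> i) * ((B q \<bullet> j) * metric M c q i j)) = metric M c q (A q) (B q)"
      if "q \<in> cdom c" for q
      using bilinear_expand[OF metric_bilinear[OF c that], of "A q" "B q"] by simp
    show "has_dirder M c (\<lambda>q. \<Sum>i\<in>Basis. \<Sum>j\<in>Basis. (A q \<bullet> i) * ((B q \<bullet> j) * metric M c q i j)) p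
      (\<lambda>X. \<Sum>i\<in>Basis. \<Sum>j\<in>Basis. (A p \<bullet> i) * ((B p \<bullet> j) * ?D i j X + (B' X \<bullet> j) * metric M c p i j)
        + (A' X \<bullet> i) * ((B p \<bullet> j) * metric M c p i j))"
      by (intro has_dirder_sum has_dirder_product[OF c p bounded_bilinear_mult] comp[OF A] comp[OF B]
          has_dirder_metric_const[OF c p])
  qed
  \<comment> \<open>The term for the coefficients is the instance with constant fields.\<close>
  have const: "dirder M c (\<lambda>q. metric M c q (A p) (B p)) p X =
      (\<Sum>i\<in>Basis. \<Sum>j\<in>Basis. (A p \<bullet> i) * ((B p \<bullet> j) * ?D i j X))" for X
    using dirder_eq[OF c p gen[OF has_dirder_const[where k = "A p"] has_dirder_const[where k = "B p"]]] by simp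
  have "(\<lambda>X. dirder M c (\<lambda>q. metric M c q (A p) (B p)) p X + metric M c p (A' X) (B p) + metric M c p (A p) (B' X))
     = (\<lambda>X. \<Sum>i\<in>Basis. \<Sum>j\<in>Basis.
       (A p \<bullet> i) * ((B p \<bullet> j) * ?D i j X + (B' X \<bullet> j) * metric M c p i j) + (A' X \<bullet> i) * ((B p \<bullet> j) * metric M c p i j))"
    unfolding const bilinear_expand[OF metric_bilinear[OF c p], of "A' _" "B p"]
      bilinear_expand[OF metric_bilinear[OF c p], of "A p" "B' _"]
    by (simp add: sum.distrib algebra_simps)
  with gen[OF A B] show ?thesis by simp
qed

lemma dirder_metric_sym:
  assumes "c \<in> charts M" "p \<in> cdom c"
  shows "dirder M c (\<lambda>q. metric M c q v w) p X = dirder M c (\<lambda>q. metric M c q w v) p X"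
proof -
  have "has_dirder M c (\<lambda>q. metric M c q v w) p (dirder M c (\<lambda>q. metric M c q w v) p)"
    by (rule has_dirder_cong[OF assms(1) open_UNIV assms(2) UNIV_I _ has_dirder_metric_const[OF assms]])
      (simp add: metric_sym[OF assms(1)])
  from dirder_eq[OF assms this] show ?thesis by simp
qed

lemma dirder_metric_linear:
  assumes c: "c \<in> charts M" and p: "p \<in> cdom c"
  shows "linear (\<lambda>v. dirder M c (\<lambda>q. metric M c q v w) p X)"
    and "linear (\<lambda>w. dirder M c (\<lambda>q. metric M c q v w) p X)"
    and "linear (\<lambda>X. dirder M c (\<lambda>q. metric M c q v w) p X)"
proof -
  let ?d = "\<lambda>v w. dirder M c (\<lambda>q. metric M c q v w) p X"
  note lin = metric_bilinear[OF c]
  have l: "linear (\<lambda>v. ?d v w)" for w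
  proof (rule linearI)
    fix a b
    have "has_dirder M c (\<lambda>q. metric M c q (a + b) w) p
        (\<lambda>X. dirder M c (\<lambda>q. metric M c q a w) p X + dirder M c (\<lambda>q. metric M c q b w) p X)"
      by (rule has_dirder_cong[OF c open_UNIV p UNIV_I _ has_dirder_add[OF has_dirder_metric_const[OF c p]
              has_dirder_metric_const[OF c p]]])
        (simp add: bilinear_ladd[OF lin])
    from dirder_eq[OF c p this] show "?d (a + b) w = ?d a w + ?d b w" by simp
  next
    fix r :: real and a
    have "has_dirder M c (\<lambda>q. metric M c q (r *\<^sub>R a) w) p
        (\<lambda>X. r *\<^sub>R dirder M c (\<lambda>q. metric M c q a w) p X)"
      by (rule has_dirder_cong[OF c open_UNIV p UNIV_I _ has_dirder_linear[OF bounded_linear_scaleR_right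
              has_dirder_metric_const[OF c p]]])
        (simp add: bilinear_lmul[OF lin])
    from dirder_eq[OF c p this] show "?d (r *\<^sub>R a) w = r *\<^sub>R ?d a w" by simp
  qed
  show "linear (\<lambda>v. ?d v w)" by (rule l)
  show "linear (\<lambda>w. ?d v w)" using l[of v] dirder_metric_sym[OF c p] by simp
  show "linear (\<lambda>X. dirder M c (\<lambda>q. metric M c q v w) p X)"
    using has_dirder_linearD[OF has_dirder_metric_const[OF c p]] by simp
qed

text \<open>Gives the existence part of the definite description that defines the Christoffel symbols.\<close>

lemma metric_riesz:
  assumes c: "c \<in> charts M" and p: "p \<in> cdom c" and "linear K"
  shows "\<exists>w. \<forall>z. metric M c p w z = K z"
proof -
  note bil = metric_bilinear[OF c p]
  let ?L = "\<lambda>w. \<Sum>i\<in>Basis. metric M c p w i *\<^sub>R i"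
  have lin: "linear ?L"
    by (rule linearI) (simp_all add: bilinear_ladd[OF bil] bilinear_lmul[OF bil] scaleR_left_distrib
        sum.distrib scaleR_sum_right)
  have inner: "?L w \<bullet> i = metric M c p w i" if "i \<in> Basis" for w i
    using that by simp
  have "inj ?L"
  proof (rule injI)
    fix v w assume "?L v = ?L w"
    then have "metric M c p v i = metric M c p w i" if "i \<in> Basis" for i
      using inner[OF that] by metis
    then have "metric M c p v z = metric M c p w z" for z
      by (intro linear_eq_on_span[of "metric M c p v" "metric M c p w" Basis z])
        (use bil in \<open>auto simp: bilinear_def span_Basis\<close>)
    then show "v = w" by (rule metric_nondegenerate[OF c p])
  qed
  then have "surj ?L" using lin linear_injective_imp_surjective by blast
  from surjD[OF this, of "\<Sum>i\<in>Basis. K i *\<^sub>R i"]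
  obtain w where w: "(\<Sum>i\<in>Basis. K i *\<^sub>R i) = ?L w" by (rule exE)
  have "metric M c p w i = K i" if "i \<in> Basis" for i
    using inner[OF that, of w] that by (simp flip: w)
  then have "metric M c p w z = K z" for z
    by (intro linear_eq_on_span[of "metric M c p w" K Basis z])
      (use bil assms in \<open>auto simp: bilinear_def span_Basis\<close>)
  then show ?thesis by blast
qed

lemma christoffel_koszul:
  assumes c: "c \<in> charts M" and p: "p \<in> cdom c"
  shows "2 * metric M c p (christoffel M c p u v) z =
     dirder M c (\<lambda>q. metric M c q v z) p u + dirder M c (\<lambda>q. metric M c q u z) p v
       - dirder M c (\<lambda>q. metric M c q u v) p z"
proof -
  let ?K = "\<lambda>z. dirder M c (\<lambda>q. metric M c q v z) p u + dirder M c (\<lambda>q. metric M c q u z) p v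
       - dirder M c (\<lambda>q. metric M c q u v) p z"
  have "linear ?K"
    by (intro linear_compose_add linear_compose_sub dirder_metric_linear[OF c p])
  then have "linear (\<lambda>z. (1/2) *\<^sub>R ?K z)" by (rule linear_compose_scale_right)
  from metric_riesz[OF c p this] obtain w where w': "\<And>z. metric M c p w z = (1/2) *\<^sub>R ?K z" by blast
  have w: "2 * metric M c p w z = ?K z" for z by (simp add: w')
  have "christoffel M c p u v = w"
    unfolding christoffel_def
  proof (rule the_equality)
    show "w' = w" if "\<forall>z. 2 * metric M c p w' z = ?K z" for w'
    proof (rule metric_nondegenerate[OF c p])
      fix z
      show "metric M c p w' z = metric M c p w z"
        using that[rule_format, of z] w[of z] by linarith
    qed
  qed (use w in blast)
  then show ?thesis using w by simp
qed

lemma christoffel_sym: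
  assumes "c \<in> charts M" "p \<in> cdom c"
  shows "christoffel M c p u v = christoffel M c p v u"
proof (rule metric_nondegenerate[OF assms])
  fix z
  show "metric M c p (christoffel M c p u v) z = metric M c p (christoffel M c p v u) z"
    using christoffel_koszul[OF assms, of u v z] christoffel_koszul[OF assms, of v u z]
      dirder_metric_sym[OF assms, of u v z] by linarith
qed

lemma christoffel_linear:
  assumes c: "c \<in> charts M" and p: "p \<in> cdom c"
  shows "linear (christoffel M c p u)"
proof (rule linearI; rule metric_nondegenerate[OF c p])
  note k = christoffel_koszul[OF c p] and lin = dirder_metric_linear[OF c p]
  fix v w :: 'e and r :: real and z
  show "metric M c p (christoffel M c p u (v + w)) z = metric M c p (christoffel M c p u v + christoffel M c p u w) z"
    using k[of u "v + w" z] k[of u v z] k[of u w z] linear_add[OF lin(1), of v w z u]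
      linear_add[OF lin(3), of u z v w] linear_add[OF lin(2), of u v w z]
      bilinear_ladd[OF metric_bilinear[OF c p], of "christoffel M c p u v" "christoffel M c p u w" z]
    by linarith
  have "2 * metric M c p (christoffel M c p u (r *\<^sub>R v)) z = r * (2 * metric M c p (christoffel M c p u v) z)"
    unfolding k linear_scale[OF lin(1)] linear_scale[OF lin(2)] linear_scale[OF lin(3)]
    by (simp add: algebra_simps)
  then show "metric M c p (christoffel M c p u (r *\<^sub>R v)) z = metric M c p (r *\<^sub>R christoffel M c p u v) z"
    by (simp add: bilinear_lmul[OF metric_bilinear[OF c p]])
qed

lemma christoffel_metric:
  assumes "c \<in> charts M" "p \<in> cdom c"
  shows "dirder M c (\<lambda>q. metric M c q v w) p X =
     metric M c p (christoffel M c p X v) w + metric M c p v (christoffel M c p X w)"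
proof -
  note k = christoffel_koszul[OF assms] and s = dirder_metric_sym[OF assms]
  show ?thesis
    using k[of X v w] k[of X w v] s[of v w X] s[of X v w] s[of X w v]
      metric_sym[OF assms, of v "christoffel M c p X w"] by linarith
qed

text \<open>For constant \<open>v\<close> and \<open>w\<close> the Koszul formula yields \<open>X h(v, w) = h(\<Gamma>(X, v), w) + h(v, \<Gamma>(X, w))\<close>; the product
  rule for the metric extends this to arbitrary fields.\<close>

lemma metric_compatible:
  assumes c: "c \<in> charts M" and p: "p \<in> cdom c" and A: "has_dirder M c A p A'" and B: "has_dirder M c B p B'"
  shows "has_dirder M c (\<lambda>q. metric M c q (A q) (B q)) p
    (\<lambda>X. metric M c p (covder M c A p X) (B p) + metric M c p (A p) (covder M c B p X))"
  using has_dirder_metric[OF assms]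
  by (simp add: covder_def dirder_eq[OF c p A] dirder_eq[OF c p B] christoffel_metric[OF c p]
      bilinear_ladd[OF metric_bilinear[OF c p]] bilinear_radd[OF metric_bilinear[OF c p]] algebra_simps)

lemma covder_const:
  assumes "c \<in> charts M" "p \<in> cdom c"
  shows "covder M c (\<lambda>q. Y) p X = christoffel M c p X Y"
  using dirder_eq[OF assms has_dirder_const[where k = Y]] by (simp add: covder_def)

end

text \<open>By Cramer's rule the solution of a linear system is a quotient of determinants, hence differentiable if
  the coefficients are. The Christoffel symbols are given implicitly by the Koszul formula, and this
  yields their derivatives.\<close>

lemma has_dirder_linear_system:
  fixes M :: "('m::{t2_space,second_countable_topology}, 'e::euclidean_space, 'z) riem_scheme"
    and A :: "'m \<Rightarrow> real^'n^'n"
  assumes "riemannian M" "c \<in> charts M" "p \<in> cdom c"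
    and A: "\<And>i j. \<exists>a. has_dirder M c (\<lambda>q. A q $ i $ j) p a"
    and b: "\<And>i. \<exists>a. has_dirder M c (\<lambda>q. b q $ i) p a"
    and sys: "\<And>q. q \<in> cdom c \<Longrightarrow> A q *v w q = b q"
    and inv: "\<And>q. q \<in> cdom c \<Longrightarrow> det (A q) \<noteq> 0"
  shows "\<exists>w'. has_dirder M c w p w'"
proof -
  interpret riemannian M by fact
  define F where "F = at (coord c p) within model M"
  have dA: "(\<lambda>x. A (param c x) $ i $ j) differentiable F" for i j
    using A[of i j] by (auto simp: has_dirder_def differentiable_def F_def)
  have db: "(\<lambda>x. b (param c x) $ i) differentiable F" for i
    using b[of i] by (auto simp: has_dirder_def differentiable_def F_def)
  have det: "(\<lambda>x. det (B x)) differentiable F"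
    if "\<And>i j. (\<lambda>x. B x $ i $ j) differentiable F" for B :: "'e \<Rightarrow> real^'n^'n"
  proof -
    have "(\<lambda>x. \<Prod>i\<in>UNIV. B x $ i $ s i) differentiable F" for s
    proof -
      define B' where "B' i = frechet_derivative (\<lambda>x. B x $ i $ s i) F" for i
      have "((\<lambda>x. B x $ i $ s i) has_derivative B' i) F" for i
        using that[of i "s i"] by (simp add: B'_def F_def frechet_derivative_works)
      then have "((\<lambda>x. \<Prod>i\<in>UNIV. B x $ i $ s i) has_derivative
         (\<lambda>y. \<Sum>i\<in>UNIV. B' i y * (\<Prod>j\<in>UNIV - {i}. B (coord c p) $ j $ s j))) F"
        unfolding F_def by (intro has_derivative_prod) auto
      then show ?thesis by (auto simp: differentiable_def)
    qed
    then show ?thesis unfolding det_def F_def by (auto intro!: differentiable_sum differentiable_mult)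
  qed
  have "(\<lambda>x. det (\<chi> i j. if j = k then b (param c x) $ i else A (param c x) $ i $ j) / det (A (param c x)))
      differentiable F" for k
  proof -
    have nz: "det (A (param c (coord c p))) \<noteq> 0" using inv assms(2,3) by (simp add: param_coord)
    have "(\<lambda>x. det (A (param c x))) differentiable F" by (rule det[OF dA])
    moreover have "(\<lambda>x. det (\<chi> i j. if j = k then b (param c x) $ i else A (param c x) $ i $ j)) differentiable F"
    proof (rule det)
      fix i j
      show "(\<lambda>x. (\<chi> i j. if j = k then b (param c x) $ i else A (param c x) $ i $ j) $ i $ j) differentiable F"
        by (cases "j = k") (simp_all add: dA db)
    qed
    ultimately show ?thesis
      using differentiable_divide[of _ "coord c p" "model M"] nz unfolding F_def by blast
  qed
  moreover define w' where "w' k = frechet_derivative (\<lambda>x. det (\<chi> i j. if j = k then b (param c x) $ i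
      else A (param c x) $ i $ j) / det (A (param c x))) F" for k
  ultimately have w': "((\<lambda>x. det (\<chi> i j. if j = k then b (param c x) $ i else A (param c x) $ i $ j)
       / det (A (param c x))) has_derivative w' k) F" for k
    by (simp add: w'_def F_def frechet_derivative_works)
  have "has_dirder M c (\<lambda>q. \<chi> k. det (\<chi> i j. if j = k then b q $ i else A q $ i $ j) / det (A q)) p
      (\<lambda>X. \<chi> k. w' k X)"
    using w' unfolding has_dirder_def F_def
    by (subst has_derivative_componentwise_within) (auto simp: Basis_vec_def inner_axis)
  then have "has_dirder M c w p (\<lambda>X. \<chi> k. w' k X)"
  proof (rule has_dirder_cong[OF assms(2) open_UNIV assms(3) UNIV_I, rotated])
    show "(\<chi> k. det (\<chi> i j. if j = k then b q $ i else A q $ i $ j) / det (A q)) = w q" if "q \<in> cdom c" for q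
      using sys[OF that] cramer[OF inv[OF that], of "w q" "b q"] by simp
  qed
  then show ?thesis by blast
qed

section \<open>Curvature\<close>

text \<open>The Koszul formula, tested on the standard basis, is a linear system for the components of
  \<open>\<Gamma>(u, v)\<close> whose matrix is twice the Gram matrix.\<close>

lemma christoffel_differentiable:
  fixes M :: "('m::{t2_space,second_countable_topology}, real^'n, 'z) riem_scheme"
  assumes "riemannian M" and c: "c \<in> charts M" and p: "p \<in> cdom c"
  shows "\<exists>w'. has_dirder M c (\<lambda>q. christoffel M c q u v) p w'"
proof -
  interpret riemannian M by fact
  let ?K = "\<lambda>q z. dirder M c (\<lambda>q. metric M c q v z) q u + dirder M c (\<lambda>q. metric M c q u z) q v
       - dirder M c (\<lambda>q. metric M c q u v) q z"
  let ?A = "\<lambda>q. \<chi> i j. 2 * metric M c q (axis j 1) (axis i 1)"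
  have Av: "(?A q *v w) $ i = 2 * metric M c q w (axis i 1)" if q: "q \<in> cdom c" for q w i
  proof -
    note bil = metric_bilinear[OF c q]
    have "metric M c q w (axis i 1) = metric M c q (\<Sum>j\<in>UNIV. (w $ j) *\<^sub>R axis j 1) (axis i 1)"
      using basis_expansion[of w] by (simp add: scalar_mult_eq_scaleR)
    also have "\<dots> = (\<Sum>j\<in>UNIV. w $ j * metric M c q (axis j 1) (axis i 1))"
      using bil linear_sum[of "\<lambda>x. metric M c q x (axis i 1)" "\<lambda>j. (w $ j) *\<^sub>R axis j 1" UNIV]
      by (simp add: bilinear_def bilinear_lmul[OF bil])
    finally show ?thesis by (simp add: matrix_vector_mult_def sum_distrib_left mult_ac)
  qed
  have dd: "has_dirder M c (\<lambda>q. dirder M c (\<lambda>q. metric M c q a b) q X) p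
      (dirder M c (\<lambda>q. dirder M c (\<lambda>q. metric M c q a b) q X) p)" for a b X
    using metric_smooth[OF c]
    by (intro smooth_in_has_dirder[OF c open_UNIV p UNIV_I] smooth_in_dirder[OF c open_UNIV]) simp
  show ?thesis
  proof (rule has_dirder_linear_system[OF assms, where A = ?A and b = "\<lambda>q. \<chi> i. ?K q (axis i 1)"])
    show "\<exists>a. has_dirder M c (\<lambda>q. ?A q $ i $ j) p a" for i j
      using has_dirder_linear[OF bounded_linear_mult_right[of 2] has_dirder_metric_const[OF c p, of "axis j 1" "axis i 1"]]
      by auto
    show "\<exists>a. has_dirder M c (\<lambda>q. (\<chi> i. ?K q (axis i 1)) $ i) p a" for i
      unfolding vec_lambda_beta by (rule exI, rule has_dirder_diff[OF has_dirder_add[OF dd dd] dd])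
    show "?A q *v christoffel M c q u v = (\<chi> i. ?K q (axis i 1))" if q: "q \<in> cdom c" for q
      unfolding vec_eq_iff Av[OF q] christoffel_koszul[OF c q] by simp
    show "det (?A q) \<noteq> 0" if q: "q \<in> cdom c" for q
    proof -
      have "x = 0" if "?A q *v x = 0" for x
      proof (rule metric_nondegenerate[OF c q])
        note bil = metric_bilinear[OF c q]
        have "metric M c q x (axis i 1) = 0" for i using Av[OF q, of x i] that by simp
        then have "metric M c q x b = 0" if "b \<in> Basis" for b
          using that by (auto simp: Basis_vec_def)
        then show "metric M c q x z = metric M c q 0 z" for z
          by (intro linear_eq_on_span[of "metric M c q x" "metric M c q 0" Basis z])
            (use bil in \<open>auto simp: bilinear_def span_Basis bilinear_lzero[OF bil]\<close>)
      qed
      then have "\<exists>B. B ** ?A q = mat 1" by (simp only: matrix_left_invertible_ker) blast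
      then show ?thesis
        by (simp only: invertible_left_inverse[symmetric] invertible_det_nz simp_thms)
    qed
  qed
qed

text \<open>For constant \<open>w\<close> one has \<open>h(\<nabla>\<^sub>v w, w) = v h(w, w) / 2\<close>. Differentiating along \<open>u\<close> gives
  \<open>h(\<nabla>\<^sub>u \<nabla>\<^sub>v w, w) = u v h(w, w) / 2 - h(\<nabla>\<^sub>v w, \<nabla>\<^sub>u w)\<close>, which is symmetric in \<open>u\<close> and \<open>v\<close>.\<close>

lemma curvature_skew_diag:
  fixes M :: "('m::{t2_space,second_countable_topology}, real^'n, 'z) riem_scheme"
  assumes "riemannian M" and c: "c \<in> charts M" and p: "p \<in> cdom c"
  shows "metric M c p (curvature M c p u v w) w = 0"
proof -
  interpret riemannian M by fact
  let ?g = "\<lambda>q. metric M c q w w"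
  have *: "metric M c p (covder M c (\<lambda>q. christoffel M c q v w) p u) w =
      dirder M c (\<lambda>q. dirder M c ?g q v) p u / 2 - metric M c p (christoffel M c p v w) (christoffel M c p u w)"
    for u v
  proof -
    obtain w' where "has_dirder M c (\<lambda>q. christoffel M c q v w) p w'"
      using christoffel_differentiable[OF assms] by blast
    from metric_compatible[OF c p this has_dirder_const[where k = w]]
    have 1: "has_dirder M c (\<lambda>q. metric M c q (christoffel M c q v w) w) p
      (\<lambda>X. metric M c p (covder M c (\<lambda>q. christoffel M c q v w) p X) w
        + metric M c p (christoffel M c p v w) (christoffel M c p X w))"
      by (simp add: covder_const[OF c p])
    have half: "metric M c q (christoffel M c q v w) w = (1/2) *\<^sub>R dirder M c ?g q v" if q: "q \<in> cdom c" for q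
      using christoffel_metric[OF c q, of w w v] metric_sym[OF c q, of "christoffel M c q v w" w] by simp
    have "has_dirder M c (\<lambda>q. dirder M c ?g q v) p (dirder M c (\<lambda>q. dirder M c ?g q v) p)"
      using metric_smooth[OF c]
      by (intro smooth_in_has_dirder[OF c open_UNIV p UNIV_I] smooth_in_dirder[OF c open_UNIV]) simp
    from has_dirder_linear[OF bounded_linear_scaleR_right this, of "1/2"]
    have "has_dirder M c (\<lambda>q. metric M c q (christoffel M c q v w) w) p
      (\<lambda>X. (1/2) *\<^sub>R dirder M c (\<lambda>q. dirder M c ?g q v) p X)"
      by (rule has_dirder_cong[OF c open_UNIV p UNIV_I, rotated]) (simp add: half)
    from fun_cong[OF trans[OF dirder_eq[OF c p 1, symmetric] dirder_eq[OF c p this]], of u]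
    show ?thesis by simp
  qed
  have "dirder M c (\<lambda>q. dirder M c ?g q v) p u = dirder M c (\<lambda>q. dirder M c ?g q u) p v"
    using metric_smooth[OF c] by (intro mixed_dirder[OF c open_UNIV p UNIV_I]) simp
  then show ?thesis
    unfolding curvature_def bilinear_lsub[OF metric_bilinear[OF c p]] *
    using metric_sym[OF c p, of "christoffel M c p v w" "christoffel M c p u w"] by simp
qed

lemma curvature_linear:
  fixes M :: "('m::{t2_space,second_countable_topology}, real^'n, 'z) riem_scheme"
  assumes "riemannian M" and c: "c \<in> charts M" and p: "p \<in> cdom c"
  shows "linear (curvature M c p u v)"
proof -
  interpret riemannian M by fact
  have lin: "linear (\<lambda>w. covder M c (\<lambda>q. christoffel M c q v w) p u)" for u v
  proof (rule linearI)
    fix a b :: "real^'n" and r :: real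
    obtain a' b' where a': "has_dirder M c (\<lambda>q. christoffel M c q v a) p a'"
      and b': "has_dirder M c (\<lambda>q. christoffel M c q v b) p b'"
      using christoffel_differentiable[OF assms] by meson
    have "has_dirder M c (\<lambda>q. christoffel M c q v (a + b)) p (\<lambda>X. a' X + b' X)"
      by (rule has_dirder_cong[OF c open_UNIV p UNIV_I _ has_dirder_add[OF a' b']])
        (simp add: linear_add[OF christoffel_linear[OF c]])
    then show "covder M c (\<lambda>q. christoffel M c q v (a + b)) p u =
        covder M c (\<lambda>q. christoffel M c q v a) p u + covder M c (\<lambda>q. christoffel M c q v b) p u"
      by (simp add: covder_def dirder_eq[OF c p] dirder_eq[OF c p a'] dirder_eq[OF c p b']
          linear_add[OF christoffel_linear[OF c p]])
    have "has_dirder M c (\<lambda>q. christoffel M c q v (r *\<^sub>R a)) p (\<lambda>X. r *\<^sub>R a' X)"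
      by (rule has_dirder_cong[OF c open_UNIV p UNIV_I _ has_dirder_linear[OF bounded_linear_scaleR_right a']])
        (simp add: linear_scale[OF christoffel_linear[OF c]])
    then show "covder M c (\<lambda>q. christoffel M c q v (r *\<^sub>R a)) p u =
        r *\<^sub>R covder M c (\<lambda>q. christoffel M c q v a) p u"
      by (simp add: covder_def dirder_eq[OF c p] dirder_eq[OF c p a']
          linear_scale[OF christoffel_linear[OF c p]] scaleR_right_distrib)
  qed
  show ?thesis unfolding curvature_def[abs_def] by (intro linear_compose_sub lin)
qed

lemma curvature_skew:
  fixes M :: "('m::{t2_space,second_countable_topology}, real^'n, 'z) riem_scheme"
  assumes "riemannian M" and c: "c \<in> charts M" and p: "p \<in> cdom c"
  shows "metric M c p (curvature M c p u v w) z = - metric M c p (curvature M c p u v z) w"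
proof -
  interpret riemannian M by fact
  have "metric M c p (curvature M c p u v (w + z)) (w + z) = 0"
    by (rule curvature_skew_diag[OF assms])
  then show ?thesis
    using curvature_skew_diag[OF assms, of u v w] curvature_skew_diag[OF assms, of u v z]
    by (simp add: linear_add[OF curvature_linear[OF assms]]
        bilinear_ladd[OF metric_bilinear[OF c p]] bilinear_radd[OF metric_bilinear[OF c p]])
qed

section \<open>Tensor products\<close>

lemma matrix_vector_mult_scaleR: "A *v (r *\<^sub>R x) = r *\<^sub>R (A *v x)" for A :: "complex^'n^'m"
  by (simp add: vec_eq_iff matrix_vector_mult_def scaleR_sum_right)

lemma scaleR_matrix_vector_mult: "(r *\<^sub>R A) *v x = r *\<^sub>R (A *v x)" for A :: "complex^'n^'m"
  by (simp add: vec_eq_iff matrix_vector_mult_def scaleR_sum_right)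

lemma scaleR_matrix_mult: "(r *\<^sub>R A) ** B = r *\<^sub>R (A ** B)" for A :: "complex^'n^'m" and B :: "complex^'k^'n"
  by (simp add: vec_eq_iff matrix_matrix_mult_def scaleR_sum_right)

lemma matrix_mult_scaleR: "A ** (r *\<^sub>R B) = r *\<^sub>R (A ** B)" for A :: "complex^'n^'m" and B :: "complex^'k^'n"
  by (simp add: vec_eq_iff matrix_matrix_mult_def scaleR_sum_right)

lemma matrix_mult_add_rdistrib: "(A + B) ** C = A ** C + B ** C" for A B :: "complex^'n^'m" and C :: "complex^'k^'n"
  by (simp add: vec_eq_iff matrix_matrix_mult_def sum.distrib algebra_simps)

lemma matrix_vector_mult_uminus: "(- A) *v x = - (A *v x)" "A *v (- x) = - (A *v x)" for A :: "complex^'n^'m"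
  by (simp_all add: vec_eq_iff matrix_vector_mult_def sum_negf)

lemma bounded_linear_matrix_vector: "bounded_linear ((*v) A)" for A :: "complex^'n^'m"
  unfolding linear_conv_bounded_linear[symmetric]
  by (rule linearI) (simp_all add: matrix_vector_right_distrib matrix_vector_mult_scaleR)

lemma bounded_bilinear_matrix_vector: "bounded_bilinear (\<lambda>(A :: complex^'n^'m) x. A *v x)"
  unfolding bilinear_conv_bounded_bilinear[symmetric] bilinear_def
  by (auto intro!: linearI simp: matrix_vector_right_distrib matrix_vector_mult_scaleR
      matrix_vector_mult_add_rdistrib scaleR_matrix_vector_mult)

lemma bounded_bilinear_tensor: "bounded_bilinear (tensor :: complex^2 \<Rightarrow> real^'n \<Rightarrow> complex^2^'n)"
  unfolding bilinear_conv_bounded_bilinear[symmetric] bilinear_def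
  by (auto intro!: linearI simp: vec_eq_iff tensor_def algebra_simps)

lemmas tensor_add_left = bounded_bilinear.add_left[OF bounded_bilinear_tensor]
  and tensor_add_right = bounded_bilinear.add_right[OF bounded_bilinear_tensor]
  and tensor_scaleR_left = bounded_bilinear.scaleR_left[OF bounded_bilinear_tensor]
  and tensor_scaleR_right = bounded_bilinear.scaleR_right[OF bounded_bilinear_tensor]

lemma tensor_op_tensor:
  assumes "linear L"
  shows "tensor_op T L (tensor \<sigma> v) = tensor (T *v \<sigma>) (L v)"
proof -
  have "tensor_op T L (tensor \<sigma> v) = tensor (T *v \<sigma>) (\<Sum>k\<in>UNIV. v $ k *\<^sub>R L (axis k 1))"
    by (simp add: tensor_op_def tensor_def[of \<sigma>] matrix_vector_mult_scaleR tensor_scaleR_left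
        bounded_bilinear.sum_right[OF bounded_bilinear_tensor] tensor_scaleR_right)
  also have "(\<Sum>k\<in>UNIV. v $ k *\<^sub>R L (axis k 1)) = L v"
    using basis_expansion[of v] linear_sum[OF assms, of "\<lambda>k. v $ k *\<^sub>R axis k 1" UNIV]
    by (simp add: linear_scale[OF assms] scalar_mult_eq_scaleR)
  finally show ?thesis .
qed

lemma tensor_op_add: "tensor_op T L (\<phi> + \<rho>) = tensor_op T L \<phi> + tensor_op T L \<rho>"
  by (simp add: tensor_op_def matrix_vector_right_distrib tensor_add_left sum.distrib)

lemma herm_add_left: "herm (\<sigma> + \<sigma>') \<tau> = herm \<sigma> \<tau> + herm \<sigma>' \<tau>"
  and herm_add_right: "herm \<sigma> (\<tau> + \<tau>') = herm \<sigma> \<tau> + herm \<sigma> \<tau>'"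
  by (simp_all add: herm_def sum_2 algebra_simps)

lemma tensor_herm_add_left: "tensor_herm h (\<phi> + \<phi>') \<rho> = tensor_herm h \<phi> \<rho> + tensor_herm h \<phi>' \<rho>"
  and tensor_herm_add_right: "tensor_herm h \<phi> (\<rho> + \<rho>') = tensor_herm h \<phi> \<rho> + tensor_herm h \<phi> \<rho>'"
  by (simp_all add: tensor_herm_def herm_add_left herm_add_right scaleR_right_distrib sum.distrib)

lemma tensor_herm_tensor:
  fixes h :: "real^'n \<Rightarrow> real^'n \<Rightarrow> real"
  assumes "bilinear h"
  shows "tensor_herm h (tensor \<sigma> v) (tensor \<tau> w) = h v w *\<^sub>R herm \<sigma> \<tau>"
proof -
  have "h v w = h (\<Sum>k\<in>UNIV. (v $ k) *\<^sub>R axis k 1) (\<Sum>l\<in>UNIV. (w $ l) *\<^sub>R axis l 1)"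
    using basis_expansion[of v] basis_expansion[of w] by (simp add: scalar_mult_eq_scaleR)
  also have "\<dots> = (\<Sum>k\<in>UNIV. \<Sum>l\<in>UNIV. v $ k * w $ l * h (axis k 1) (axis l 1))"
    by (simp add: bilinear_sum[OF assms] sum.cartesian_product bilinear_lmul[OF assms] bilinear_rmul[OF assms] mult_ac)
  finally have h: "h v w = (\<Sum>k\<in>UNIV. \<Sum>l\<in>UNIV. v $ k * w $ l * h (axis k 1) (axis l 1))" .
  have "herm (r *\<^sub>R \<sigma>) (s *\<^sub>R \<tau>) = (r * s) *\<^sub>R herm \<sigma> \<tau>" for r s
    by (simp add: herm_def sum_2 scaleR_right_distrib mult.commute)
  then show ?thesis
    by (simp add: tensor_herm_def tensor_def h scaleR_sum_left mult_ac)
qed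

section \<open>Spin surfaces\<close>

locale spin_surface_manifold =
  fixes M :: "'m::{t2_space,second_countable_topology} spin_surface"
  assumes surface: "oriented_riemannian_surface_with_boundary M" and spin: "spin_structure M"

sublocale spin_surface_manifold \<subseteq> riemannian M
  using surface thick_half_plane
  by unfold_locales (auto simp: oriented_riemannian_surface_with_boundary_def)

context spin_surface_manifold
begin

lemma orthonormal_expand:
  assumes c: "c \<in> charts M" and p: "p \<in> cdom c" and b: "orthonormal_basis M c p b"
  shows "X = (\<Sum>j\<in>UNIV. metric M c p X (b j) *\<^sub>R b j)"
proof -
  note bil = metric_bilinear[OF c p]
  let ?L = "\<lambda>x::real^2. x $ 1 *\<^sub>R b 1 + x $ 2 *\<^sub>R b 2"
  have coord: "metric M c p (?L x) (b j) = x $ j" for x j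
    using b exhaust_2[of j]
    by (auto simp: orthonormal_basis_def bilinear_ladd[OF bil] bilinear_lmul[OF bil])
  have "linear ?L" by (rule linearI) (simp_all add: algebra_simps)
  moreover have "inj ?L"
    by (rule injI) (metis coord vec_eq_iff)
  ultimately have "surj ?L" using linear_injective_imp_surjective by blast
  from surjD[OF this, of X] obtain x where "X = ?L x" by (rule exE)
  then show ?thesis using coord[of x 1] coord[of x 2] by (simp add: sum_2)
qed

text \<open>The change between two orthonormal bases is an orthogonal matrix: its Gram matrix (\<open>gram\<close> below) is the
  identity.\<close>

lemma orthonormal_trace:
  fixes B :: "real^2 \<Rightarrow> real^2 \<Rightarrow> 'v::real_vector"
  assumes c: "c \<in> charts M" and p: "p \<in> cdom c"
    and b: "orthonormal_basis M c p b" and b': "orthonormal_basis M c p b'" and B: "bilinear B"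
  shows "(\<Sum>j\<in>UNIV. B (b j) (b j)) = (\<Sum>j\<in>UNIV. B (b' j) (b' j))"
proof -
  note bil = metric_bilinear[OF c p]
  let ?m = "metric M c p"
  have bb: "?m (b i) (b j) = (if i = j then 1 else 0)" "?m (b' i) (b' j) = (if i = j then 1 else 0)" for i j
    using b b' by (simp_all add: orthonormal_basis_def)
  have gram: "(\<Sum>j\<in>UNIV. ?m (b j) (b' k) * ?m (b j) (b' l)) = (if k = l then 1 else 0)" for k l
  proof -
    have "?m (b' k) (b' l) = ?m (\<Sum>j\<in>UNIV. ?m (b' k) (b j) *\<^sub>R b j) (b' l)"
      using orthonormal_expand[OF c p b, of "b' k"] by simp
    also have "\<dots> = (\<Sum>j\<in>UNIV. ?m (b' k) (b j) * ?m (b j) (b' l))"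
      by (simp add: sum_2 bilinear_ladd[OF bil] bilinear_lmul[OF bil])
    finally show ?thesis
      using bb(2)[of k l] metric_sym[OF c p, of "b' k"] by (simp add: sum_2)
  qed
  have "B (b j) (b j) = (\<Sum>k\<in>UNIV. \<Sum>l\<in>UNIV. (?m (b j) (b' k) * ?m (b j) (b' l)) *\<^sub>R B (b' k) (b' l))" for j
  proof -
    have "B (b j) (b j) = B (\<Sum>k\<in>UNIV. ?m (b j) (b' k) *\<^sub>R b' k) (\<Sum>k\<in>UNIV. ?m (b j) (b' k) *\<^sub>R b' k)"
      using orthonormal_expand[OF c p b', of "b j"] by simp
    then show ?thesis
      by (simp add: sum_2 bilinear_ladd[OF B] bilinear_radd[OF B] bilinear_lmul[OF B] bilinear_rmul[OF B]
          scaleR_right_distrib mult.commute)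
  qed
  then have "(\<Sum>j\<in>UNIV. B (b j) (b j)) =
      (\<Sum>k\<in>UNIV. \<Sum>l\<in>UNIV. (\<Sum>j\<in>UNIV. ?m (b j) (b' k) * ?m (b j) (b' l)) *\<^sub>R B (b' k) (b' l))"
    by (simp add: sum_2 scaleR_left_distrib)
  then show ?thesis unfolding gram by (simp add: sum_2)
qed

lemma frame_orthonormal: "c \<in> charts M \<Longrightarrow> p \<in> cdom c \<Longrightarrow> orthonormal_basis M c p (frame M c p)"
  and frame_det: "c \<in> charts M \<Longrightarrow> p \<in> cdom c \<Longrightarrow> 0 < det (\<chi> i. frame M c p i)"
  and frame_smooth: "c \<in> charts M \<Longrightarrow> smooth_in c (cdom c) (\<lambda>p. frame M c p j)"
  using spin by (auto simp: spin_structure_def)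

lemma metric_frame:
  "c \<in> charts M \<Longrightarrow> p \<in> cdom c \<Longrightarrow> metric M c p (frame M c p i) (frame M c p j) = (if i = j then 1 else 0)"
  using frame_orthonormal by (simp add: orthonormal_basis_def)

lemma frame_expand:
  assumes "c \<in> charts M" "p \<in> cdom c"
  shows "X = metric M c p X (frame M c p 1) *\<^sub>R frame M c p 1 + metric M c p X (frame M c p 2) *\<^sub>R frame M c p 2"
  using orthonormal_expand[OF assms frame_orthonormal[OF assms], of X] by (simp add: sum_2)

lemma has_dirder_frame:
  assumes "c \<in> charts M" "p \<in> cdom c"
  shows "has_dirder M c (\<lambda>q. frame M c q j) p (dirder M c (\<lambda>q. frame M c q j) p)"
  by (rule smooth_in_has_dirder[OF assms(1) open_UNIV assms(2) UNIV_I]) (simp add: frame_smooth[OF assms(1)])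

text \<open>The connection form \<open>\<omega>\<close> of the frame: \<open>\<nabla>E\<^sub>1 = \<omega> E\<^sub>2\<close> and \<open>\<nabla>E\<^sub>2 = - \<omega> E\<^sub>1\<close>.\<close>

definition connection_form :: "('m, real^2) chart \<Rightarrow> 'm \<Rightarrow> real^2 \<Rightarrow> real" where
  "connection_form c p X = metric M c p (covder M c (\<lambda>q. frame M c q 1) p X) (frame M c p 2)"

lemma spin_conn_form_eq: "spin_conn_form M c p X = (connection_form c p X / 2) *\<^sub>R gamma12"
  by (simp add: spin_conn_form_def connection_form_def)

text \<open>Differentiating the constants \<open>\<langle>E\<^sub>i, E\<^sub>j\<rangle>\<close> shows that the matrix of \<open>\<nabla>\<^sub>X\<close> in the frame is skew.\<close>

lemma covder_frame:
  assumes c: "c \<in> charts M" and p: "p \<in> cdom c"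
  shows "covder M c (\<lambda>q. frame M c q 1) p X = connection_form c p X *\<^sub>R frame M c p 2"
    and "covder M c (\<lambda>q. frame M c q 2) p X = - connection_form c p X *\<^sub>R frame M c p 1"
proof -
  note bil = metric_bilinear[OF c p]
  let ?n = "\<lambda>i. covder M c (\<lambda>q. frame M c q i) p X" and ?m = "metric M c p"
  have skew: "?m (?n i) (frame M c p j) + ?m (frame M c p i) (?n j) = 0" for i j
  proof -
    have "has_dirder M c (\<lambda>q. metric M c q (frame M c q i) (frame M c q j)) p (\<lambda>X. 0)"
      by (rule has_dirder_cong[OF c open_UNIV p UNIV_I _ has_dirder_const[where k = "if i = j then 1 else 0"]])
        (simp add: metric_frame[OF c])
    from fun_cong[OF trans[OF dirder_eq[OF c p this, symmetric]
          dirder_eq[OF c p metric_compatible[OF c p has_dirder_frame[OF c p] has_dirder_frame[OF c p]]]], of X]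
    show ?thesis by simp
  qed
  have d: "?m (?n i) (frame M c p i) = 0" for i
    using skew[of i i] metric_sym[OF c p, of "?n i" "frame M c p i"] by simp
  show "?n 1 = connection_form c p X *\<^sub>R frame M c p 2"
    using frame_expand[OF c p, of "?n 1"] d[of 1] by (simp add: connection_form_def)
  have "?m (?n 2) (frame M c p 1) = - connection_form c p X"
    using skew[of 1 2] metric_sym[OF c p, of "?n 2" "frame M c p 1"] by (simp add: connection_form_def)
  then show "?n 2 = - connection_form c p X *\<^sub>R frame M c p 1"
    using frame_expand[OF c p, of "?n 2"] d[of 2] by simp
qed

lemma clifford_linear:
  assumes "c \<in> charts M" "p \<in> cdom c"
  shows "linear (clifford M c p)"
  unfolding clifford_def
  by (rule linearI) (simp_all add: sum_2 bilinear_ladd[OF metric_bilinear[OF assms]]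
      bilinear_lmul[OF metric_bilinear[OF assms]] algebra_simps)

lemma clifford_frame:
  assumes "c \<in> charts M" "p \<in> cdom c"
  shows "clifford M c p (frame M c p j) = gamma j"
  using exhaust_2[of j] by (auto simp: clifford_def metric_frame[OF assms] sum_2)

end

lemmas mat2_simps = vec_eq_iff forall_2 matrix_matrix_mult_def matrix_vector_mult_def sum_2 mat_def vector_def
  gamma_def gamma12_def

lemma spin_rep_cnj:
  assumes "norm z = 1"
  shows "spin_rep (cnj z) ** spin_rep z = mat 1"
proof -
  have "(Re z)\<^sup>2 + (Im z)\<^sup>2 = 1" using assms by (simp add: cmod_def)
  then show ?thesis
    by (auto simp: mat2_simps spin_rep_def complex_eq_iff power2_eq_square algebra_simps)
qed

context spin_surface_manifold
begin

lemma has_dirder_transition: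
  assumes c: "c \<in> charts M" "p \<in> cdom c" and c': "c' \<in> charts M" "p \<in> cdom c'"
  shows "has_dirder M c' (coord c) p (dirder M c' (coord c) p)"
  by (rule smooth_in_has_dirder[OF c'(1) open_cdom[OF c(1)] c'(2) c(2)])
    (use smooth_manifold c c' in \<open>simp add: smooth_manifold_def\<close>)

lemma
  assumes c: "c \<in> charts M" "p \<in> cdom c" and c': "c' \<in> charts M" "p \<in> cdom c'"
  defines "z \<equiv> spin_lift M c c' p" and "D \<equiv> dirder M c' (coord c) p"
  shows spin_lift_norm: "norm z = 1"
    and spin_lift_frame1: "D (frame M c' p 1) = Re (z\<^sup>2) *\<^sub>R frame M c p 1 + Im (z\<^sup>2) *\<^sub>R frame M c p 2"
    and spin_lift_frame2: "D (frame M c' p 2) = - Im (z\<^sup>2) *\<^sub>R frame M c p 1 + Re (z\<^sup>2) *\<^sub>R frame M c p 2"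
proof -
  have "let z = spin_lift M c c' p in
        norm z = 1 \<and>
        dirder M c' (coord c) p (frame M c' p 1) =
          Re (z\<^sup>2) *\<^sub>R frame M c p 1 + Im (z\<^sup>2) *\<^sub>R frame M c p 2 \<and>
        dirder M c' (coord c) p (frame M c' p 2) =
          - Im (z\<^sup>2) *\<^sub>R frame M c p 1 + Re (z\<^sup>2) *\<^sub>R frame M c p 2"
    using spin c c' unfolding spin_structure_def charts_at_def by blast
  then show "norm z = 1"
    and "D (frame M c' p 1) = Re (z\<^sup>2) *\<^sub>R frame M c p 1 + Im (z\<^sup>2) *\<^sub>R frame M c p 2"
    and "D (frame M c' p 2) = - Im (z\<^sup>2) *\<^sub>R frame M c p 1 + Re (z\<^sup>2) *\<^sub>R frame M c p 2"
    by (simp_all only: Let_def z_def D_def)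
qed

text \<open>It suffices to consider frame vectors, for which this is the covering relation \<open>spin_rep_covering\<close>
  between \<open>Spin(2)\<close> and \<open>SO(2)\<close>.\<close>

lemma clifford_chart_change:
  assumes c: "c \<in> charts M" "p \<in> cdom c" and c': "c' \<in> charts M" "p \<in> cdom c'"
  shows "clifford M c p (dirder M c' (coord c) p X) ** spin_rep (spin_lift M c c' p) =
     spin_rep (spin_lift M c c' p) ** clifford M c' p X"
proof -
  let ?z = "spin_lift M c c' p" and ?D = "dirder M c' (coord c) p"
  note z = spin_lift_norm[OF c c'] and D = spin_lift_frame1[OF c c'] spin_lift_frame2[OF c c']
  have lin: "linear ?D" by (rule has_dirder_linearD[OF has_dirder_transition[OF c c']])
  let ?x = "metric M c' p X (frame M c' p 1)" and ?y = "metric M c' p X (frame M c' p 2)"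
  have "X = ?x *\<^sub>R frame M c' p 1 + ?y *\<^sub>R frame M c' p 2" by (rule frame_expand[OF c'])
  then have "?D X = ?x *\<^sub>R ?D (frame M c' p 1) + ?y *\<^sub>R ?D (frame M c' p 2)"
    using linear_add[OF lin] linear_scale[OF lin] by metis
  then have 1: "clifford M c p (?D X) =
     ?x *\<^sub>R (Re (?z\<^sup>2) *\<^sub>R gamma 1 + Im (?z\<^sup>2) *\<^sub>R gamma 2) + ?y *\<^sub>R (- Im (?z\<^sup>2) *\<^sub>R gamma 1 + Re (?z\<^sup>2) *\<^sub>R gamma 2)"
    by (simp only: D linear_add[OF clifford_linear[OF c]] linear_scale[OF clifford_linear[OF c]] clifford_frame[OF c])
  have 2: "clifford M c' p X = ?x *\<^sub>R gamma 1 + ?y *\<^sub>R gamma 2"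
    by (simp add: clifford_def sum_2)
  have 3: "clifford M c p (?D X) = spin_rep ?z ** (?x *\<^sub>R gamma 1 + ?y *\<^sub>R gamma 2) ** spin_rep (cnj ?z)"
    unfolding 1 spin_rep_covering[OF z, symmetric]
    by (simp add: matrix_add_ldistrib matrix_mult_add_rdistrib scaleR_matrix_mult matrix_mult_scaleR)
  show ?thesis unfolding 2 3
    by (simp only: spin_rep_cnj[OF z] matrix_mul_rid flip: matrix_mul_assoc)
qed

end

section \<open>Maps from the surface and the twisted spinor\<close>

locale surface_map = spin_surface_manifold M
  for M :: "'m::{t2_space,second_countable_topology} spin_surface" +
  fixes N :: "('q::{t2_space,second_countable_topology}, real^'n) riem" and f :: "'m \<Rightarrow> 'q"
  assumes target: "riemannian N" and smooth_map: "smooth_map M N f"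

sublocale surface_map \<subseteq> target: riemannian N
  by (rule target)

context surface_map
begin

lemma continuous: "continuous_on UNIV f"
  using smooth_map by (simp add: smooth_map_def)

lemma open_preimage: "d \<in> charts N \<Longrightarrow> open (f -` cdom d)"
  using continuous target.open_cdom open_vimage by blast

lemma smooth_coord_map: "c \<in> charts M \<Longrightarrow> d \<in> charts N \<Longrightarrow> smooth_in c (cdom c \<inter> f -` cdom d) (coord d \<circ> f)"
  using smooth_map by (simp add: smooth_map_def)

context
  fixes c d p
  assumes c: "c \<in> charts M" and d: "d \<in> charts N" and p: "p \<in> cdom c" and fp: "f p \<in> cdom d"
begin

lemma has_dirder_map: "has_dirder M c (coord d \<circ> f) p (differential M f c d p)"
  using smooth_in_has_dirder[OF c open_preimage[OF d] p _ smooth_coord_map[OF c d]] fp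
  by (simp add: differential_def[abs_def])

lemma differential_linear: "linear (differential M f c d p)"
  by (rule has_dirder_linearD[OF has_dirder_map])

lemma has_dirder_differential_const:
  "has_dirder M c (\<lambda>q. differential M f c d q Y) p (dirder M c (\<lambda>q. differential M f c d q Y) p)"
  unfolding differential_def
  by (rule smooth_in_has_dirder[OF c open_preimage[OF d] p _ smooth_in_dirder[OF c open_preimage[OF d] smooth_coord_map[OF c d]]])
    (simp add: fp)

text \<open>Second derivatives commute, and both Levi-Civita connections are torsion-free.\<close>

lemma nabla_df_sym: "nabla_df M N f c d p X Y = nabla_df M N f c d p Y X"
proof -
  have "dirder M c (\<lambda>q. dirder M c (coord d \<circ> f) q Y) p X = dirder M c (\<lambda>q. dirder M c (coord d \<circ> f) q X) p Y"
    by (rule mixed_dirder[OF c open_preimage[OF d] p _ smooth_coord_map[OF c d]]) (simp add: fp)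
  then show ?thesis
    using christoffel_sym[OF c p, of X Y]
      target.christoffel_sym[OF d fp, of "differential M f c d p X" "differential M f c d p Y"]
    by (simp add: nabla_df_def covder_const[OF c p] flip: differential_def)
qed

end

lemma differential_expand:
  assumes "c \<in> charts M" "d \<in> charts N" "p \<in> cdom c" "f p \<in> cdom d"
  shows "differential M f c d p X = (\<Sum>i\<in>Basis. (X \<bullet> i) *\<^sub>R differential M f c d p i)"
proof -
  note lin = differential_linear[OF assms]
  have "differential M f c d p X = differential M f c d p (\<Sum>i\<in>Basis. (X \<bullet> i) *\<^sub>R i)"
    by (simp add: euclidean_representation)
  then show ?thesis by (simp add: linear_sum[OF lin] linear_scale[OF lin])
qed

lemma has_dirder_differential:
  assumes c: "c \<in> charts M" and d: "d \<in> charts N" and p: "p \<in> cdom c" and fp: "f p \<in> cdom d"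
    and E: "has_dirder M c E p E'"
  shows "has_dirder M c (\<lambda>q. differential M f c d q (E q)) p
    (\<lambda>X. dirder M c (\<lambda>q. differential M f c d q (E p)) p X + differential M f c d p (E' X))"
proof -
  let ?D = "\<lambda>i. dirder M c (\<lambda>q. differential M f c d q i) p"
  have gen: "has_dirder M c (\<lambda>q. differential M f c d q (E q)) p
      (\<lambda>X. \<Sum>i\<in>Basis. (E p \<bullet> i) *\<^sub>R ?D i X + (E' X \<bullet> i) *\<^sub>R differential M f c d p i)"
    if E: "has_dirder M c E p E'" for E E'
  proof (rule has_dirder_cong[OF c open_preimage[OF d] p])
    show "p \<in> f -` cdom d" using fp by simp
    show "(\<Sum>i\<in>Basis. (E q \<bullet> i) *\<^sub>R differential M f c d q i) = differential M f c d q (E q)"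
      if "q \<in> cdom c" "q \<in> f -` cdom d" for q
      using differential_expand[OF c d that(1), of "E q"] that(2) by simp
    show "has_dirder M c (\<lambda>q. \<Sum>i\<in>Basis. (E q \<bullet> i) *\<^sub>R differential M f c d q i) p
      (\<lambda>X. \<Sum>i\<in>Basis. (E p \<bullet> i) *\<^sub>R ?D i X + (E' X \<bullet> i) *\<^sub>R differential M f c d p i)"
      by (intro has_dirder_sum has_dirder_product[OF c p bounded_bilinear_scaleR]
          has_dirder_linear[OF bounded_linear_inner_left E] has_dirder_differential_const[OF c d p fp])
  qed
  have "dirder M c (\<lambda>q. differential M f c d q (E p)) p X = (\<Sum>i\<in>Basis. (E p \<bullet> i) *\<^sub>R ?D i X)" for X
    using dirder_eq[OF c p gen[OF has_dirder_const[where k = "E p"]]] by simp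
  then show ?thesis
    using gen[OF E] by (simp add: sum.distrib flip: differential_expand[OF c d p fp])
qed

text \<open>The product rule \<open>\<nabla>\<^sub>X(f\<^sub>*E) = (\<nabla>df)(X, E) + f\<^sub>*(\<nabla>\<^sub>X E)\<close>. As the definition of \<open>\<nabla>df\<close> extends tangent
  vectors by constant components, it is not immediate for other fields \<open>E\<close>, such as the frame.\<close>

lemma pullback_derivative:
  assumes c: "c \<in> charts M" and d: "d \<in> charts N" and p: "p \<in> cdom c" and fp: "f p \<in> cdom d"
    and E: "has_dirder M c E p E'"
  shows "dirder M c (\<lambda>q. differential M f c d q (E q)) p X
      + christoffel N d (f p) (differential M f c d p X) (differential M f c d p (E p)) =
    nabla_df M N f c d p X (E p) + differential M f c d p (covder M c E p X)"
  using differential_linear[OF c d p fp]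
  by (simp add: dirder_eq[OF c p has_dirder_differential[OF assms]] nabla_df_def covder_const[OF c p]
      covder_def[of M c E] dirder_eq[OF c p E] linear_add)

text \<open>The spinor \<open>\<phi>\<close> of the theorem for the frame of the spin structure. Its basis consists of smooth
  fields, and Clifford multiplication by them is constant.\<close>

definition frame_spinor :: "(('m, real^2) chart \<Rightarrow> 'm \<Rightarrow> complex^2) \<Rightarrow> ('m, 'q, 'n) twisted" where
  "frame_spinor \<psi> c d p = (\<Sum>j\<in>UNIV. tensor (gamma j *v \<psi> c p) (differential M f c d p (frame M c p j)))"

lemma bilinear_tensor_clifford:
  assumes c: "c \<in> charts M" and d: "d \<in> charts N" and p: "p \<in> cdom c" and fp: "f p \<in> cdom d"
  shows "bilinear (\<lambda>X Y. tensor (clifford M c p X *v \<sigma>) (differential M f c d p Y))"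
  using clifford_linear[OF c p] differential_linear[OF assms]
  by (auto intro!: linearI simp: bilinear_def linear_add linear_scale tensor_add_right tensor_add_left
      matrix_vector_mult_add_rdistrib scaleR_matrix_vector_mult tensor_scaleR_left tensor_scaleR_right)

lemma basis_spinor_eq_frame_spinor:
  assumes c: "c \<in> charts M" and d: "d \<in> charts N" and p: "p \<in> cdom c" and fp: "f p \<in> cdom d"
    and b: "orthonormal_basis M c p b"
  shows "(\<Sum>j\<in>UNIV. tensor (clifford M c p (b j) *v \<psi> c p) (differential M f c d p (b j)))
    = frame_spinor \<psi> c d p"
  using orthonormal_trace[OF c p b frame_orthonormal[OF c p] bilinear_tensor_clifford[OF c d p fp]]
  by (simp add: frame_spinor_def clifford_frame[OF c p])

lemma frame_spinor_smooth:
  assumes c: "c \<in> charts M" and d: "d \<in> charts N" and psi: "spinor_field M \<psi>"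
  shows "smooth_in c (cdom c \<inter> f -` cdom d) (frame_spinor \<psi> c d)"
proof -
  let ?T = "coord c ` (cdom c \<inter> f -` cdom d)"
  have sub: "smooth_on ?T (u \<circ> param c)" if "smooth_in c (cdom c) u" for u :: "'m \<Rightarrow> 'x::real_normed_vector"
    using that by (auto simp: smooth_in_def intro: smooth_on_subset)
  have psi: "smooth_on ?T (\<psi> c \<circ> param c)"
    using psi c by (intro sub) (simp add: spinor_field_def)
  have df: "smooth_on ?T ((\<lambda>q. differential M f c d q Y) \<circ> param c)" for Y
    using smooth_in_dirder[OF c open_preimage[OF d] smooth_coord_map[OF c d]]
    by (simp add: smooth_in_def differential_def)
  have "smooth_on ?T (\<lambda>x. \<Sum>j\<in>UNIV. tensor (gamma j *v \<psi> c (param c x))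
     (\<Sum>i\<in>Basis. (frame M c (param c x) j \<bullet> i) *\<^sub>R differential M f c d (param c x) i))"
    using sub[OF frame_smooth[OF c]] psi df unfolding o_def
    by (intro smooth_on_sum smooth_on_bilinear[OF bounded_bilinear_tensor] smooth_on_bilinear[OF bounded_bilinear_scaleR]
        smooth_on_linear[OF bounded_linear_matrix_vector] smooth_on_linear[OF bounded_linear_inner_left]) auto
  then show ?thesis
    unfolding smooth_in_def
    by (rule smooth_on_cong)
      (auto simp: param_coord[OF c] frame_spinor_def simp flip: differential_expand[OF c d])
qed

lemma differential_chart_change:
  assumes c: "c \<in> charts M" "p \<in> cdom c" and c': "c' \<in> charts M" "p \<in> cdom c'"
    and d: "d \<in> charts N" "f p \<in> cdom d" and d': "d' \<in> charts N" "f p \<in> cdom d'"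
  shows "dirder N d' (coord d) (f p) (differential M f c' d' p X) =
    differential M f c d p (dirder M c' (coord c) p X)"
proof -
  have M: "riemannian M" by unfold_locales
  have "has_dirder N d' (coord d) (f p) (dirder N d' (coord d) (f p))"
    by (rule target.smooth_in_has_dirder[OF d'(1) target.open_cdom[OF d(1)] d'(2) d(2)])
      (use target.smooth_manifold d d' in \<open>simp add: smooth_manifold_def\<close>)
  from has_dirder_compose[OF M target c'(1) d'(1) c'(2) d'(2) continuous has_dirder_map[OF c'(1) d'(1) c'(2) d'(2)] this]
  have 1: "dirder M c' (coord d \<circ> f) p = dirder N d' (coord d) (f p) \<circ> differential M f c' d' p"
    by (rule dirder_eq[OF c'])
  have "has_dirder M c' (coord c \<circ> id) p (dirder M c' (coord c) p)"
    unfolding comp_id by (rule has_dirder_transition[OF c c'])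
  from has_dirder_compose[OF M M c'(1) c(1) c'(2) _ continuous_on_id' this, of "coord d \<circ> f"]
  have "has_dirder M c' (coord d \<circ> f) p (differential M f c d p \<circ> dirder M c' (coord c) p)"
    using has_dirder_map[OF c(1) d(1) c(2) d(2)] c(2) by (simp add: id_def o_def)
  then have 2: "dirder M c' (coord d \<circ> f) p = differential M f c d p \<circ> dirder M c' (coord c) p"
    by (rule dirder_eq[OF c'])
  show ?thesis using fun_cong[OF trans[OF 1[symmetric] 2], of X] by simp
qed

text \<open>The differential of the coordinate change takes the frame of one chart to an orthonormal basis in the
  other chart, and the sum may be formed in that basis.\<close>

lemma frame_spinor_chart_change:
  assumes psi: "spinor_field M \<psi>"
    and c: "c \<in> charts M" "p \<in> cdom c" and c': "c' \<in> charts M" "p \<in> cdom c'"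
    and d: "d \<in> charts N" "f p \<in> cdom d" and d': "d' \<in> charts N" "f p \<in> cdom d'"
  shows "frame_spinor \<psi> c d p = tensor_op (spin_rep (spin_lift M c c' p)) (dirder N d' (coord d) (f p))
     (frame_spinor \<psi> c' d' p)"
proof -
  let ?S = "spin_rep (spin_lift M c c' p)" and ?L = "dirder N d' (coord d) (f p)" and ?D = "dirder M c' (coord c) p"
  let ?b = "\<lambda>j. ?D (frame M c' p j)"
  have psi: "\<psi> c p = ?S *v \<psi> c' p"
    by (rule conjunct2[OF psi[unfolded spinor_field_def], rule_format]) (simp_all add: charts_at_def c c')
  have L: "linear ?L"
    by (rule has_dirder_linearD[OF target.smooth_in_has_dirder[OF d'(1) target.open_cdom[OF d(1)] d'(2) d(2)]])
      (use target.smooth_manifold d d' in \<open>simp add: smooth_manifold_def\<close>)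
  have "metric M c p (?D v) (?D w) = metric M c' p v w" for v w
    by (rule metric_chart_change[OF c c'])
  then have "orthonormal_basis M c p ?b"
    using frame_orthonormal[OF c'] by (simp add: orthonormal_basis_def)
  from basis_spinor_eq_frame_spinor[OF c(1) d(1) c(2) d(2) this, symmetric]
  have "frame_spinor \<psi> c d p = (\<Sum>j\<in>UNIV. tensor (clifford M c p (?b j) *v (?S *v \<psi> c' p)) (differential M f c d p (?b j)))"
    by (simp add: psi)
  also have "\<dots> = (\<Sum>j\<in>UNIV. tensor (?S *v (gamma j *v \<psi> c' p)) (?L (differential M f c' d' p (frame M c' p j))))"
    by (simp add: matrix_vector_mul_assoc clifford_chart_change[OF c c'] clifford_frame[OF c']
        differential_chart_change[OF c c' d d'])
  also have "\<dots> = tensor_op ?S ?L (frame_spinor \<psi> c' d' p)"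
    by (simp add: frame_spinor_def sum_2 tensor_op_add tensor_op_tensor[OF L])
  finally show ?thesis .
qed

end

section \<open>The Dirac equation and the curvature term\<close>

text \<open>The pairing \<open>\<langle>e\<^sub>j \<cdot> e\<^sub>k \<cdot> \<sigma>, e\<^sub>l \<cdot> \<sigma>\<rangle>\<close> is symmetric in \<open>k\<close> and \<open>l\<close>. In higher dimensions it may change
  sign, if \<open>j\<close>, \<open>k\<close>, \<open>l\<close> are distinct.\<close>

lemma clifford_pairing:
  "herm (gamma j *v (gamma 1 *v \<sigma>)) (gamma 2 *v \<sigma>) = herm (gamma j *v (gamma 2 *v \<sigma>)) (gamma 1 *v \<sigma>)"
  using exhaust_2[of j] by (auto simp: mat2_simps herm_def complex_eq_iff algebra_simps)

text \<open>The spin connection \<open>w/2 \<gamma>\<^sub>1\<gamma>\<^sub>2\<close> rotates \<open>\<gamma>\<^sub>1, \<gamma>\<^sub>2\<close> as the Levi-Civita connection rotates the frame, so the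
  terms with \<open>w\<close> cancel: Clifford multiplication is parallel. Here \<open>a\<close>, \<open>b\<close> stand for \<open>f\<^sub>*(E\<^sub>1)\<close>, \<open>f\<^sub>*(E\<^sub>2)\<close>,
  further \<open>m\<close>, \<open>n\<close> for \<open>(\<nabla>df)(X, E\<^sub>1)\<close>, \<open>(\<nabla>df)(X, E\<^sub>2)\<close>, and \<open>K\<close> for \<open>\<nabla>\<^sub>X \<psi>\<close>.\<close>

lemma twisted_deriv_algebra:
  fixes a b m n :: "real^'n"
  shows "tensor (gamma 1 *v \<sigma>) (m + w *\<^sub>R b) + tensor (gamma 1 *v (K - (w / 2) *\<^sub>R (gamma12 *v \<sigma>))) a
     + (tensor (gamma 2 *v \<sigma>) (n + - w *\<^sub>R a) + tensor (gamma 2 *v (K - (w / 2) *\<^sub>R (gamma12 *v \<sigma>))) b)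
     + (tensor (((w / 2) *\<^sub>R gamma12) *v (gamma 1 *v \<sigma>)) a + tensor (((w / 2) *\<^sub>R gamma12) *v (gamma 2 *v \<sigma>)) b)
   = tensor (gamma 1 *v K) a + tensor (gamma 1 *v \<sigma>) m + (tensor (gamma 2 *v K) b + tensor (gamma 2 *v \<sigma>) n)"
  by (auto simp: mat2_simps tensor_def complex_eq_iff field_simps)

text \<open>The cancellation behind the Dirac equation. Here \<open>a\<close>, \<open>b\<close> stand for \<open>f\<^sub>*(E\<^sub>1)\<close>, \<open>f\<^sub>*(E\<^sub>2)\<close>, and the matrix of
  \<open>\<nabla>df\<close> in the frame, symmetric and trace-free, has the rows \<open>(m, n)\<close> and \<open>(n, - m)\<close>.\<close>

lemma dirac_algebra:
  fixes a b m n :: "real^'n"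
  shows "tensor (gamma 1 *v (gamma 1 *v (\<alpha> *s (gamma 1 *v \<sigma>)))) a + tensor (gamma 1 *v (gamma 1 *v \<sigma>)) m
     + (tensor (gamma 1 *v (gamma 2 *v (\<alpha> *s (gamma 1 *v \<sigma>)))) b + tensor (gamma 1 *v (gamma 2 *v \<sigma>)) n)
     + (tensor (gamma 2 *v (gamma 1 *v (\<alpha> *s (gamma 2 *v \<sigma>)))) a + tensor (gamma 2 *v (gamma 1 *v \<sigma>)) n
     + (tensor (gamma 2 *v (gamma 2 *v (\<alpha> *s (gamma 2 *v \<sigma>)))) b + tensor (gamma 2 *v (gamma 2 *v \<sigma>)) (- m))) = 0"
  by (auto simp: mat2_simps tensor_def complex_eq_iff algebra_simps)

context surface_map
begin

lemma V_field_frame_spinor: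
  assumes c: "c \<in> charts M" and d: "d \<in> charts N" and p: "p \<in> cdom c" and fp: "f p \<in> cdom d"
    and phi: "\<phi> c d p = frame_spinor \<psi> c d p"
  shows "V_field M N f \<phi> c d p = 0"
proof -
  let ?h = "metric N d (f p)" and ?E = "frame M c p"
  note bil = target.metric_bilinear[OF d fp]
  let ?R = "\<lambda>j Y. curvature N d (f p) (differential M f c d p (?E j)) Y"
  have "tensor_herm ?h (tensor_op (clifford M c p (?E j)) (?R j Y) (\<phi> c d p)) (\<phi> c d p) = 0" for j Y
  proof -
    let ?f = "\<lambda>k. differential M f c d p (?E k)" and ?s = "\<lambda>k. gamma k *v \<psi> c p"
    note skew = curvature_skew_diag[OF target d fp] 
    have "tensor_herm ?h (tensor_op (clifford M c p (?E j)) (?R j Y) (\<phi> c d p)) (\<phi> c d p) =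
       ?h (?R j Y (?f 1)) (?f 2) *\<^sub>R herm (gamma j *v ?s 1) (?s 2) + ?h (?R j Y (?f 2)) (?f 1) *\<^sub>R herm (gamma j *v ?s 2) (?s 1)"
      by (simp add: phi frame_spinor_def sum_2 tensor_op_add tensor_op_tensor curvature_linear[OF target d fp]
          tensor_herm_add_left tensor_herm_add_right tensor_herm_tensor[OF bil] clifford_frame[OF c p] skew)
    then show ?thesis
      using curvature_skew[OF target d fp, of "?f j" Y "?f 1" "?f 2"] clifford_pairing by simp
  qed
  then have V: "V_field M N f \<phi> c d p = (THE V. \<forall>Y. complex_of_real (?h V Y) = 0)"
    by (simp add: V_field_def)
  show ?thesis unfolding V
  proof (rule the_equality)
    show "\<forall>Y. complex_of_real (?h 0 Y) = 0" by (simp add: bilinear_lzero[OF bil])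
    show "V = 0" if "\<forall>Y. complex_of_real (?h V Y) = 0" for V
      by (rule target.metric_nondegenerate[OF d fp]) (use that in \<open>simp add: bilinear_lzero[OF bil]\<close>)
  qed
qed

lemma twisted_deriv_frame_spinor:
  assumes c: "c \<in> charts M" and d: "d \<in> charts N" and p: "p \<in> cdom c" and fp: "f p \<in> cdom d"
    and phi: "\<And>q. q \<in> cdom c \<Longrightarrow> f q \<in> cdom d \<Longrightarrow> \<phi> c d q = frame_spinor \<psi> c d q"
    and psi: "killing_spinor M \<alpha> \<psi>"
  shows "twisted_deriv M N f c d \<phi> p X = (\<Sum>j\<in>UNIV.
     tensor (gamma j *v (\<alpha> *s (clifford M c p X *v \<psi> c p))) (differential M f c d p (frame M c p j))
     + tensor (gamma j *v \<psi> c p) (nabla_df M N f c d p X (frame M c p j)))"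
proof -
  let ?E = "frame M c p" and ?\<sigma> = "\<psi> c p" and ?w = "connection_form c p X"
  let ?a = "\<lambda>j. differential M f c d p (?E j)" and ?n = "\<lambda>j. nabla_df M N f c d p X (?E j)"
  let ?g = "christoffel N d (f p) (differential M f c d p X)"
  let ?dd = "\<lambda>j. dirder M c (\<lambda>q. differential M f c d q (frame M c q j)) p"
  let ?K = "\<alpha> *s (clifford M c p X *v ?\<sigma>)"
  have "smooth_in c (cdom c) (\<psi> c)" using psi c by (simp add: killing_spinor_def spinor_field_def)
  then have psi': "has_dirder M c (\<psi> c) p (dirder M c (\<psi> c) p)"
    by (intro smooth_in_has_dirder[OF c open_UNIV p UNIV_I]) simp
  have "spin_deriv M c \<psi> p X = ?K" using psi c p by (simp add: killing_spinor_def charts_at_def)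
  then have dpsi: "dirder M c (\<psi> c) p X = ?K - (?w / 2) *\<^sub>R (gamma12 *v ?\<sigma>)"
    by (simp add: spin_deriv_def spin_conn_form_eq scaleR_matrix_vector_mult eq_diff_eq)
  have df: "has_dirder M c (\<lambda>q. differential M f c d q (frame M c q j)) p (?dd j)" for j
  proof -
    note * = has_dirder_differential[OF c d p fp has_dirder_frame[OF c p, of j]]
    show ?thesis using * by (simp only: dirder_eq[OF c p *])
  qed
  have "has_dirder M c (frame_spinor \<psi> c d) p
     (\<lambda>X. \<Sum>j\<in>UNIV. tensor (gamma j *v ?\<sigma>) (?dd j X) + tensor (gamma j *v dirder M c (\<psi> c) p X) (?a j))"
    unfolding frame_spinor_def
    by (intro has_dirder_sum has_dirder_product[OF c p bounded_bilinear_tensor] df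
        has_dirder_linear[OF bounded_linear_matrix_vector psi'])
  then have "has_dirder M c (\<phi> c d) p
     (\<lambda>X. \<Sum>j\<in>UNIV. tensor (gamma j *v ?\<sigma>) (?dd j X) + tensor (gamma j *v dirder M c (\<psi> c) p X) (?a j))"
    by (rule has_dirder_cong[OF c open_preimage[OF d] p, rotated 2]) (use phi fp in auto)
  from fun_cong[OF dirder_eq[OF c p this], of X]
  have D: "dirder M c (\<phi> c d) p X = (\<Sum>j\<in>UNIV. tensor (gamma j *v ?\<sigma>) (?dd j X)
      + tensor (gamma j *v (?K - (?w / 2) *\<^sub>R (gamma12 *v ?\<sigma>))) (?a j))"
    unfolding dpsi .
  have dd: "?dd j X + ?g (?a j) = ?n j + differential M f c d p (covder M c (\<lambda>q. frame M c q j) p X)" for j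
    by (rule pullback_derivative[OF c d p fp has_dirder_frame[OF c p]])
  have dd1: "?dd 1 X = ?n 1 + ?w *\<^sub>R ?a 2 - ?g (?a 1)" and dd2: "?dd 2 X = ?n 2 + - ?w *\<^sub>R ?a 1 - ?g (?a 2)"
    using dd[of 1] dd[of 2] covder_frame[OF c p, of X]
    by (simp_all only: eq_diff_eq linear_scale[OF differential_linear[OF c d p fp]])
  have tdiff: "tensor \<sigma> (u - v) = tensor \<sigma> u - tensor \<sigma> v" for \<sigma> and u v :: "real^'n"
    by (rule bounded_bilinear.diff_right[OF bounded_bilinear_tensor])
  have G: "tensor_op (mat 1) ?g (\<phi> c d p) = tensor (gamma 1 *v ?\<sigma>) (?g (?a 1)) + tensor (gamma 2 *v ?\<sigma>) (?g (?a 2))"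
    by (simp add: phi p fp frame_spinor_def sum_2 tensor_op_add tensor_op_tensor target.christoffel_linear[OF d fp])
  have S: "tensor_op (spin_conn_form M c p X) id (\<phi> c d p) =
      tensor (((?w / 2) *\<^sub>R gamma12) *v (gamma 1 *v ?\<sigma>)) (?a 1) + tensor (((?w / 2) *\<^sub>R gamma12) *v (gamma 2 *v ?\<sigma>)) (?a 2)"
    by (simp add: phi p fp frame_spinor_def sum_2 tensor_op_add tensor_op_tensor linear_id spin_conn_form_eq)
  have "twisted_deriv M N f c d \<phi> p X =
     tensor (gamma 1 *v ?\<sigma>) (?n 1 + ?w *\<^sub>R ?a 2) + tensor (gamma 1 *v (?K - (?w / 2) *\<^sub>R (gamma12 *v ?\<sigma>))) (?a 1)
     + (tensor (gamma 2 *v ?\<sigma>) (?n 2 + - ?w *\<^sub>R ?a 1) + tensor (gamma 2 *v (?K - (?w / 2) *\<^sub>R (gamma12 *v ?\<sigma>))) (?a 2))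
     + (tensor (((?w / 2) *\<^sub>R gamma12) *v (gamma 1 *v ?\<sigma>)) (?a 1) + tensor (((?w / 2) *\<^sub>R gamma12) *v (gamma 2 *v ?\<sigma>)) (?a 2))"
    unfolding twisted_deriv_def D G S sum_2 dd1 dd2 tdiff by (simp only: algebra_simps) 
  then show ?thesis unfolding twisted_deriv_algebra by (simp only: sum_2)
qed

lemma twisted_dirac_frame_spinor:
  assumes c: "c \<in> charts M" and d: "d \<in> charts N" and p: "p \<in> cdom c" and fp: "f p \<in> cdom d"
    and phi: "\<And>q. q \<in> cdom c \<Longrightarrow> f q \<in> cdom d \<Longrightarrow> \<phi> c d q = frame_spinor \<psi> c d q"
    and psi: "killing_spinor M \<alpha> \<psi>" and harmonic: "tension M N f c d p = 0"
  shows "twisted_dirac M N f \<phi> c d p = 0"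
proof -
  let ?E = "frame M c p"
  have n22: "nabla_df M N f c d p (?E 2) (?E 2) = - nabla_df M N f c d p (?E 1) (?E 1)"
    using harmonic by (simp add: tension_def sum_2 eq_neg_iff_add_eq_0 add.commute)
  have td: "twisted_deriv M N f c d \<phi> p X = (\<Sum>j\<in>UNIV.
     tensor (gamma j *v (\<alpha> *s (clifford M c p X *v \<psi> c p))) (differential M f c d p (?E j))
     + tensor (gamma j *v \<psi> c p) (nabla_df M N f c d p X (?E j)))" for X
    by (rule twisted_deriv_frame_spinor[OF c d p fp _ psi]) (rule phi)
  have op: "tensor_op T id (tensor \<sigma> v) = tensor (T *v \<sigma>) v" for T \<sigma> and v :: "real^'n"
    by (simp add: tensor_op_tensor linear_id)
  show ?thesis
    unfolding twisted_dirac_def td sum_2 tensor_op_add op clifford_frame[OF c p] n22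
      nabla_df_sym[OF c d p fp, of "?E 2" "?E 1"]
    by (rule dirac_algebra)
qed

end

section \<open>Geometry of the boundary\<close>

text \<open>Applied to the second coordinate, which is nonnegative and attains its minimum on the boundary, this
  describes how the differential of a transition map acts at boundary points.\<close>

lemma derivative_nonneg_at_min:
  fixes g :: "'a::euclidean_space \<Rightarrow> real"
  assumes g: "(g has_derivative g') (at x within H)" and T: "openin (top_of_set H) T" "x \<in> T"
    and min: "\<And>y. y \<in> T \<Longrightarrow> g x \<le> g y" and e: "0 < e" "\<And>t. 0 \<le> t \<Longrightarrow> t \<le> e \<Longrightarrow> x + t *\<^sub>R v \<in> H"
  shows "0 \<le> g' v"
proof (rule ccontr)
  assume "\<not> ?thesis"
  obtain W where W: "open W" "T = H \<inter> W" using T(1) by (auto simp: openin_open)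
  obtain r where r: "r > 0" "ball x r \<subseteq> W" using W T(2) openE by blast
  have "((\<lambda>t. g (x + t *\<^sub>R v)) has_derivative (\<lambda>t. g' (t *\<^sub>R v))) (at 0 within {0..e})"
  proof (rule has_derivative_in_compose[of "\<lambda>t. x + t *\<^sub>R v"])
    show "((\<lambda>t. x + t *\<^sub>R v) has_derivative (\<lambda>t. t *\<^sub>R v)) (at 0 within {0..e})"
      by (auto intro!: derivative_eq_intros)
    have "(\<lambda>t. x + t *\<^sub>R v) ` {0..e} \<subseteq> H" using e(2) by auto
    then show "(g has_derivative g') (at (x + 0 *\<^sub>R v) within (\<lambda>t. x + t *\<^sub>R v) ` {0..e})"
      using has_derivative_subset[OF g] by simp
  qed
  moreover have "g' (t *\<^sub>R v) = g' v * t" for t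
    using linear_scale[OF has_derivative_linear[OF g]] by simp
  ultimately have "((\<lambda>t. g (x + t *\<^sub>R v)) has_real_derivative g' v) (at 0 within {0..e})"
    by (simp add: has_field_derivative_def)
  from has_real_derivative_neg_dec_right[OF this] \<open>\<not> ?thesis\<close>
  obtain d where d: "d > 0" "\<And>h. h > 0 \<Longrightarrow> 0 + h \<in> {0..e} \<Longrightarrow> h < d \<Longrightarrow> g (x + (0 + h) *\<^sub>R v) < g (x + 0 *\<^sub>R v)"
    by (auto simp: not_le)
  define h where "h = min e (min (d / 2) (r / (2 * (norm v + 1))))"
  have nv: "norm v + 1 > 0" by (simp add: add_nonneg_pos)
  have h: "h > 0" "h \<le> e" "h < d" "h \<le> r / (2 * (norm v + 1))"
    using e d r nv by (auto simp: h_def)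
  have "h * norm v \<le> r / (2 * (norm v + 1)) * (norm v + 1)"
    using h nv r by (intro mult_mono) auto
  also have "r / (2 * k) * k = r / 2" if "0 < k" for k :: real using that by simp
  note this[OF nv]
  also have "r / 2 < r" using r by simp
  finally have "x + h *\<^sub>R v \<in> T" using W(2) r(2) e(2)[of h] h by (auto simp: dist_norm subset_iff)
  with min[OF this] d(2)[of h] h show False by simp
qed

text \<open>The function \<open>y(t) exp(-K t)\<close> is nonincreasing and \<open>y(t) exp(K t)\<close> is nondecreasing. This is the
  uniqueness statement for linear differential equations that is used along the boundary, with \<open>y\<close> a
  squared norm.\<close>

lemma gronwall_zero:
  fixes y :: "real \<Rightarrow> real"
  assumes der: "\<And>t. t \<in> {a<..<b} \<Longrightarrow> (y has_real_derivative y' t) (at t)"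
    and bound: "\<And>t. t \<in> {a<..<b} \<Longrightarrow> \<bar>y' t\<bar> \<le> K * y t" and nonneg: "\<And>t. 0 \<le> y t"
    and s: "s \<in> {a<..<b}" "y s = 0" and t: "t \<in> {a<..<b}"
  shows "y t = 0"
proof (cases "s \<le> t")
  case True
  have "y t * exp (- K * t) \<le> y s * exp (- K * s)"
  proof (rule DERIV_nonpos_imp_nonincreasing[OF True])
    fix x assume "s \<le> x" "x \<le> t"
    then have x: "x \<in> {a<..<b}" using s t by auto
    have "((\<lambda>t. y t * exp (- K * t)) has_real_derivative (y' x - K * y x) * exp (- K * x)) (at x)"
      using der[OF x] by (auto intro!: derivative_eq_intros simp: algebra_simps)
    moreover have "(y' x - K * y x) * exp (- K * x) \<le> 0"
      using bound[OF x] by (intro mult_nonpos_nonneg) auto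
    ultimately show "\<exists>l. ((\<lambda>t. y t * exp (- K * t)) has_real_derivative l) (at x) \<and> l \<le> 0" by blast
  qed
  then show ?thesis using s nonneg[of t] by (simp add: mult_le_0_iff)
next
  case False
  then have le: "t \<le> s" by simp
  have "y t * exp (K * t) \<le> y s * exp (K * s)"
  proof (rule DERIV_nonneg_imp_nondecreasing[OF le])
    fix x assume "t \<le> x" "x \<le> s"
    then have x: "x \<in> {a<..<b}" using s t by auto
    have "((\<lambda>t. y t * exp (K * t)) has_real_derivative (y' x + K * y x) * exp (K * x)) (at x)"
      using der[OF x] by (auto intro!: derivative_eq_intros simp: algebra_simps)
    moreover have "0 \<le> (y' x + K * y x) * exp (K * x)"
      using bound[OF x] by (intro mult_nonneg_nonneg) auto
    ultimately show "\<exists>l. ((\<lambda>t. y t * exp (K * t)) has_real_derivative l) (at x) \<and> 0 \<le> l" by blast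
  qed
  then show ?thesis using s nonneg[of t] by (simp add: mult_le_0_iff)
qed

context spin_surface_manifold
begin

lemma model_half_plane: "model M = half_plane"
  using surface by (simp add: oriented_riemannian_surface_with_boundary_def)

lemma coord_nonneg: "c \<in> charts M \<Longrightarrow> p \<in> cdom c \<Longrightarrow> 0 \<le> coord c p $ 2"
  using coord_in_model[of c p] by (simp add: model_half_plane half_plane_def)

lemma transition_det_pos:
  assumes c: "c \<in> charts M" "p \<in> cdom c" and c': "c' \<in> charts M" "p \<in> cdom c'"
  defines "D \<equiv> dirder M c' (coord c) p"
  shows "0 < D (axis 1 1) $ 1 * D (axis 2 1) $ 2 - D (axis 2 1) $ 1 * D (axis 1 1) $ 2"
proof -
  have "0 < det (matrix D)"
    using surface c c' by (simp add: oriented_riemannian_surface_with_boundary_def charts_at_def D_def)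
  then show ?thesis by (simp add: det_2 matrix_def)
qed

lemma transition_second_coordinate:
  assumes c: "c \<in> charts M" "p \<in> cdom c" and c': "c' \<in> charts M" "p \<in> cdom c'"
    and zero: "coord c p $ 2 = 0" and e: "0 < e" "\<And>t. 0 \<le> t \<Longrightarrow> t \<le> e \<Longrightarrow> 0 \<le> coord c' p $ 2 + t * X $ 2"
  shows "0 \<le> dirder M c' (coord c) p X $ 2"
proof -
  have d: "((\<lambda>x. coord c (param c' x) $ 2) has_derivative (\<lambda>X. dirder M c' (coord c) p X $ 2))
      (at (coord c' p) within model M)"
    using has_dirder_linear[OF bounded_linear_vec_nth has_dirder_transition[OF c c']]
    by (simp add: has_dirder_def)
  show ?thesis
  proof (rule derivative_nonneg_at_min[OF d openin_chart_image[OF c'(1) open_cdom[OF c(1)]] _ _ e(1)])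
    show "coord c (param c' (coord c' p)) $ 2 \<le> coord c (param c' y) $ 2"
      if "y \<in> coord c' ` (cdom c' \<inter> cdom c)" for y
      using that zero coord_nonneg[OF c(1)] by (auto simp: param_coord[OF c'(1)] c')
  qed (use c c' e(2) in \<open>auto simp: model_half_plane half_plane_def\<close>)
qed

text \<open>Whether a point lies on the boundary does not depend on the chart. In a chart where \<open>p\<close> is an interior
  point, the second coordinate of another chart would have an interior minimum at \<open>p\<close>; its differential
  would vanish, and the transition map would be singular.\<close>

lemma boundary_coord:
  assumes "p \<in> boundary M" "c' \<in> charts M" "p \<in> cdom c'"
  shows "coord c' p $ 2 = 0"
proof (rule ccontr)
  assume "coord c' p $ 2 \<noteq> 0"
  then have pos: "0 < coord c' p $ 2" using coord_nonneg[OF assms(2,3)] by simp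
  obtain c where c: "c \<in> charts M" "p \<in> cdom c" "coord c p $ 2 = 0"
    using assms(1) by (auto simp: boundary_def charts_at_def)
  let ?D = "dirder M c' (coord c) p"
  have nonneg: "0 \<le> ?D X $ 2" if "\<bar>X $ 2\<bar> \<le> 1" for X
  proof (rule transition_second_coordinate[OF c(1,2) assms(2,3) c(3) pos])
    fix t assume t: "0 \<le> t" "t \<le> coord c' p $ 2"
    have "\<bar>t * X $ 2\<bar> \<le> t" using that t(1) by (simp add: abs_mult mult_left_le)
    then show "0 \<le> coord c' p $ 2 + t * X $ 2" using t by linarith
  qed
  have neg: "?D (- X) = - ?D X" for X
    using linear_neg[OF has_dirder_linearD[OF has_dirder_transition[OF c(1,2) assms(2,3)]]] .
  have "?D X $ 2 = 0" if "\<bar>X $ 2\<bar> \<le> 1" for X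
    using nonneg[OF that] nonneg[of "- X"] that by (simp add: neg)
  then have "?D (axis 1 1) $ 2 = 0" "?D (axis 2 1) $ 2 = 0" by (simp_all add: axis_def)
  then show False using transition_det_pos[OF c(1,2) assms(2,3)] by simp
qed

text \<open>The direction \<open>\<partial>\<^sub>1\<close> spans the tangent line of the boundary in every chart. It keeps its sign, since the
  transition maps preserve the orientation and take inward vectors to inward vectors.\<close>

lemma transition_boundary_tangent:
  assumes "p \<in> boundary M" and c: "c \<in> charts M" "p \<in> cdom c" and c': "c' \<in> charts M" "p \<in> cdom c'"
  obtains a where "0 < a" "dirder M c' (coord c) p (axis 1 1) = a *\<^sub>R axis 1 1"
proof -
  let ?D = "dirder M c' (coord c) p"
  have zero: "coord c p $ 2 = 0" "coord c' p $ 2 = 0" using boundary_coord assms by auto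
  have nonneg: "0 \<le> ?D X $ 2" if "0 \<le> X $ 2" for X
    by (rule transition_second_coordinate[OF c c' zero(1) zero_less_one]) (use that zero in simp)
  have "?D (- axis 1 1) = - ?D (axis 1 1)"
    using linear_neg[OF has_dirder_linearD[OF has_dirder_transition[OF c c']]] .
  then have 1: "?D (axis 1 1) $ 2 = 0"
    using nonneg[of "axis 1 1"] nonneg[of "- axis 1 1"] by (simp add: axis_def)
  have "0 \<le> ?D (axis 2 1) $ 2" by (rule nonneg) (simp add: axis_def)
  moreover have "0 < ?D (axis 1 1) $ 1 * ?D (axis 2 1) $ 2"
    using transition_det_pos[OF c c'] 1 by simp
  ultimately have "0 < ?D (axis 1 1) $ 1" by (simp add: zero_less_mult_iff)
  moreover have "?D (axis 1 1) = ?D (axis 1 1) $ 1 *\<^sub>R axis 1 1"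
    using 1 by (simp add: vec_eq_iff forall_2 axis_def)
  ultimately show ?thesis by (rule that)
qed

text \<open>The length of \<open>\<partial>\<^sub>1\<close>; the unit tangent of the boundary is \<open>\<partial>\<^sub>1\<close> divided by it. Like the next two
  quantities it is defined on the whole chart domain, so that it can be differentiated in \<open>M\<close>.\<close>

definition boundary_speed :: "('m, real^2) chart \<Rightarrow> 'm \<Rightarrow> real" where
  "boundary_speed c p = sqrt (metric M c p (axis 1 1) (axis 1 1))"

text \<open>The components \<open>u\<^sub>1, u\<^sub>2\<close> of the unit vector \<open>T = \<partial>\<^sub>1 / |\<partial>\<^sub>1|\<close> in the frame.\<close>

definition tangent_comp :: "('m, real^2) chart \<Rightarrow> 'm \<Rightarrow> 2 \<Rightarrow> real" where
  "tangent_comp c p j = metric M c p (axis 1 1) (frame M c p j) / boundary_speed c p"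

text \<open>Clifford multiplication by \<open>- u\<^sub>2 E\<^sub>1 + u\<^sub>1 E\<^sub>2\<close>, which is \<open>T\<close> turned by a right angle.\<close>

definition normal_clifford :: "('m, real^2) chart \<Rightarrow> 'm \<Rightarrow> complex^2^2" where
  "normal_clifford c p = tangent_comp c p 1 *\<^sub>R gamma 2 - tangent_comp c p 2 *\<^sub>R gamma 1"

lemma boundary_speed_pos:
  assumes "c \<in> charts M" "p \<in> cdom c"
  shows "0 < boundary_speed c p"
  using metric_pos[OF assms, of "axis 1 1"] by (simp add: boundary_speed_def axis_eq_0_iff)

lemma boundary_speed_sq:
  assumes "c \<in> charts M" "p \<in> cdom c"
  shows "(boundary_speed c p)\<^sup>2 = metric M c p (axis 1 1) (axis 1 1)"
  using boundary_speed_pos[OF assms] unfolding boundary_speed_def by simp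

lemma tangent_expand:
  assumes "c \<in> charts M" "p \<in> cdom c"
  shows "axis 1 1 = boundary_speed c p *\<^sub>R (tangent_comp c p 1 *\<^sub>R frame M c p 1 + tangent_comp c p 2 *\<^sub>R frame M c p 2)"
  using frame_expand[OF assms, of "axis 1 1"] boundary_speed_pos[OF assms]
  by (simp add: tangent_comp_def scaleR_right_distrib)

lemma tangent_comp_unit:
  assumes "c \<in> charts M" "p \<in> cdom c"
  shows "(tangent_comp c p 1)\<^sup>2 + (tangent_comp c p 2)\<^sup>2 = 1"
proof -
  note bil = metric_bilinear[OF assms]
  have m: "metric M c p (axis 1 1) (frame M c p j) = boundary_speed c p * tangent_comp c p j" for j
    using boundary_speed_pos[OF assms] by (simp add: tangent_comp_def)
  have "metric M c p (axis 1 1) (axis 1 1) = metric M c p (axis 1 1)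
     (boundary_speed c p *\<^sub>R (tangent_comp c p 1 *\<^sub>R frame M c p 1 + tangent_comp c p 2 *\<^sub>R frame M c p 2))"
    using tangent_expand[OF assms] by metis
  also have "\<dots> = (boundary_speed c p)\<^sup>2 * ((tangent_comp c p 1)\<^sup>2 + (tangent_comp c p 2)\<^sup>2)"
    by (simp add: bilinear_radd[OF bil] bilinear_rmul[OF bil] m power2_eq_square algebra_simps)
  finally show ?thesis using boundary_speed_pos[OF assms] by (simp add: boundary_speed_sq[OF assms, symmetric])
qed

lemma clifford_tangent:
  assumes "c \<in> charts M" "p \<in> cdom c"
  shows "clifford M c p (axis 1 1) = boundary_speed c p *\<^sub>R (tangent_comp c p 1 *\<^sub>R gamma 1 + tangent_comp c p 2 *\<^sub>R gamma 2)"
  using boundary_speed_pos[OF assms] by (simp add: clifford_def sum_2 tangent_comp_def scaleR_right_distrib)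

text \<open>Turning \<open>T\<close> by a right angle in the positive sense gives the inner normal because the frame is
  positively oriented. Uniqueness: a vector orthogonal to \<open>T\<close> is a multiple \<open>s\<close> of this one, and the
  conditions on the length and on the second component leave only \<open>s = 1\<close>.\<close>

lemma inner_normal_eq:
  assumes c: "c \<in> charts M" and p: "p \<in> cdom c"
  shows "inner_normal M c p = tangent_comp c p 1 *\<^sub>R frame M c p 2 - tangent_comp c p 2 *\<^sub>R frame M c p 1" (is "_ = ?n")
proof -
  note bil = metric_bilinear[OF c p]
  let ?E = "frame M c p" and ?a = "tangent_comp c p 1" and ?b = "tangent_comp c p 2" and ?r = "boundary_speed c p"
  note r = boundary_speed_pos[OF c p]
  have m: "metric M c p (axis 1 1) (?E j) = ?r * tangent_comp c p j" for j
    using r by (simp add: tangent_comp_def)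
  have unit: "?a * ?a + ?b * ?b = 1" using tangent_comp_unit[OF c p] by (simp add: power2_eq_square)
  have n1: "metric M c p ?n (axis 1 1) = 0"
    by (simp add: metric_sym[OF c p, of ?n] bilinear_rsub[OF bil] bilinear_rmul[OF bil] m)
  have n2: "metric M c p ?n ?n = 1"
    using unit by (simp add: bilinear_rsub[OF bil] bilinear_lsub[OF bil] bilinear_rmul[OF bil] bilinear_lmul[OF bil]
        metric_frame[OF c p])
  have ax: "axis 1 1 = ?r *\<^sub>R (?a *\<^sub>R ?E 1 + ?b *\<^sub>R ?E 2)" by (rule tangent_expand[OF c p])
  have e1: "1 = ?r * (?a * ?E 1 $ 1 + ?b * ?E 2 $ 1)"
    using arg_cong[OF ax, of "\<lambda>x. x $ 1"] by (simp add: axis_def)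
  have e2: "?a * ?E 1 $ 2 + ?b * ?E 2 $ 2 = 0"
    using arg_cong[OF ax, of "\<lambda>x. x $ 2"] r by (simp add: axis_def)
  have det: "0 < ?E 1 $ 1 * ?E 2 $ 2 - ?E 1 $ 2 * ?E 2 $ 1"
    using frame_det[OF c p] by (simp add: det_2)
  have n3: "0 < ?n $ 2"
  proof -
    have "?E 1 $ 1 * ?E 2 $ 2 - ?E 1 $ 2 * ?E 2 $ 1
       = (?a * ?a + ?b * ?b) * (?E 1 $ 1 * ?E 2 $ 2 - ?E 1 $ 2 * ?E 2 $ 1)" by (simp add: unit)
    also have "\<dots> = (?a * ?E 1 $ 1 + ?b * ?E 2 $ 1) * (?n $ 2)
       + (?b * ?E 1 $ 1 - ?a * ?E 2 $ 1) * (?a * ?E 1 $ 2 + ?b * ?E 2 $ 2)"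
      by (simp add: algebra_simps)
    finally have "0 < (?a * ?E 1 $ 1 + ?b * ?E 2 $ 1) * (?n $ 2)" using det by (simp add: e2)
    moreover have "0 < ?a * ?E 1 $ 1 + ?b * ?E 2 $ 1"
      using e1 r by (metis zero_less_mult_pos zero_less_one)
    ultimately show ?thesis by (simp only: zero_less_mult_iff) linarith
  qed
  show ?thesis unfolding inner_normal_def
  proof (rule the_equality)
    show "metric M c p ?n (axis 1 1) = 0 \<and> metric M c p ?n ?n = 1 \<and> 0 < ?n $ 2"
      using n1 n2 n3 by blast
    fix n assume n: "metric M c p n (axis 1 1) = 0 \<and> metric M c p n n = 1 \<and> 0 < n $ 2"
    let ?x = "metric M c p n (?E 1)" and ?y = "metric M c p n (?E 2)"
    have nx: "n = ?x *\<^sub>R ?E 1 + ?y *\<^sub>R ?E 2" by (rule frame_expand[OF c p])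
    have "metric M c p n (axis 1 1) = ?r * (?a * ?x + ?b * ?y)"
      by (subst ax) (simp add: bilinear_radd[OF bil] bilinear_rmul[OF bil] algebra_simps)
    then have orth: "?a * ?x + ?b * ?y = 0" using n r by simp
    \<comment> \<open>The inner product of \<open>n\<close> with \<open>?n\<close>.\<close>
    define s where "s = ?a * ?y - ?b * ?x"
    have "?x = - s * ?b + (?a * ?x + ?b * ?y) * ?a + (1 - (?a * ?a + ?b * ?b)) * ?x"
      "?y = s * ?a + (?a * ?x + ?b * ?y) * ?b + (1 - (?a * ?a + ?b * ?b)) * ?y"
      by (simp_all add: s_def algebra_simps)
    then have xy: "?x = - s * ?b" "?y = s * ?a" unfolding orth unit by simp_all
    have ns: "n = s *\<^sub>R ?n"
      by (subst nx, subst xy, subst xy) (simp add: algebra_simps)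
    have "metric M c p n n = s * s"
    proof -
      have "metric M c p n n = metric M c p (s *\<^sub>R ?n) (s *\<^sub>R ?n)" by (rule arg_cong2[OF ns ns])
      then show ?thesis unfolding bilinear_lmul[OF bil] bilinear_rmul[OF bil] n2 by simp
    qed
    then have "s * s = 1" using n by simp
    moreover have "0 < s * (?n $ 2)" using n ns by (metis vector_scaleR_component real_scaleR_def)
    then have "0 < s" using n3 by (simp add: zero_less_mult_iff)
    ultimately have "s = 1" by (metis abs_of_pos abs_square_eq_1 power2_eq_square)
    then show "n = ?n" using ns by simp
  qed
qed

lemma clifford_inner_normal:
  assumes "c \<in> charts M" "p \<in> cdom c"
  shows "clifford M c p (inner_normal M c p) = normal_clifford c p"
  by (simp add: inner_normal_eq[OF assms] normal_clifford_def linear_diff[OF clifford_linear[OF assms]]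
      linear_scale[OF clifford_linear[OF assms]] clifford_frame[OF assms])

end

section \<open>Propagation of the chirality condition along the boundary\<close>

lemma normal_tangent_anticommute:
  "(u *\<^sub>R gamma 2 - v *\<^sub>R gamma 1) ** (u *\<^sub>R gamma 1 + v *\<^sub>R gamma 2) =
   - ((u *\<^sub>R gamma 1 + v *\<^sub>R gamma 2) ** (u *\<^sub>R gamma 2 - v *\<^sub>R gamma 1))"
  by (simp add: mat2_simps complex_eq_iff algebra_simps)

lemma normal_gamma12_commutator:
  "(u *\<^sub>R gamma 2 - v *\<^sub>R gamma 1) ** gamma12 =
   gamma12 ** (u *\<^sub>R gamma 2 - v *\<^sub>R gamma 1) + (2 * v) *\<^sub>R gamma 2 + (2 * u) *\<^sub>R gamma 1"
  by (simp add: mat2_simps complex_eq_iff algebra_simps)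

text \<open>Apart from the spin connection, the terms with \<open>w\<close> come from the derivative of the normal \<open>n\<close>. They
  combine to the commutator of \<open>n\<close> with \<open>w/2 \<gamma>\<^sub>1\<gamma>\<^sub>2\<close>, as \<open>n\<close> is parallel. The terms with \<open>\<alpha>\<close> combine because
  \<open>n\<close> anti-commutes with the tangential Clifford multiplication \<open>cl\<close>. Here \<open>\<sigma>\<close> stands for \<open>\<psi>\<close> and \<open>\<tau>\<close> for the
  chirality operator applied to it.\<close>

lemma chirality_defect_algebra:
  fixes \<tau> \<sigma> :: "complex^2" and u v w r :: real
  defines "cl \<equiv> r *\<^sub>R (u *\<^sub>R gamma 1 + v *\<^sub>R gamma 2)" and "n \<equiv> u *\<^sub>R gamma 2 - v *\<^sub>R gamma 1"
  shows "n *v (- ((w / 2) *\<^sub>R (gamma12 *v \<tau>)) - \<alpha> *s (cl *v \<tau>))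
       + ((w * v) *\<^sub>R gamma 2 - (- (w * u)) *\<^sub>R gamma 1) *v \<tau> - (\<alpha> *s (cl *v \<sigma>) - (w / 2) *\<^sub>R (gamma12 *v \<sigma>))
     = \<alpha> *s (cl *v (n *v \<tau> - \<sigma>)) - (w / 2) *\<^sub>R (gamma12 *v (n *v \<tau> - \<sigma>))"
proof -
  have "n ** cl = - (cl ** n)"
    by (simp add: cl_def n_def scaleR_matrix_mult matrix_mult_scaleR normal_tangent_anticommute)
  then have "n *v (cl *v \<tau>) = - (cl *v (n *v \<tau>))"
    by (simp add: matrix_vector_mul_assoc matrix_vector_mult_uminus)
  moreover have "n *v (gamma12 *v \<tau>) = gamma12 *v (n *v \<tau>) + (2 * v) *\<^sub>R (gamma 2 *v \<tau>) + (2 * u) *\<^sub>R (gamma 1 *v \<tau>)"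
    unfolding matrix_vector_mul_assoc n_def normal_gamma12_commutator
    by (simp add: matrix_vector_mult_add_rdistrib scaleR_matrix_vector_mult)
  ultimately show ?thesis
    by (simp add: matrix_vector_mult_diff_distrib matrix_vector_mult_add_rdistrib matrix_vector_mult_uminus
        matrix_vector_mult_scaleR scaleR_matrix_vector_mult vector_scalar_commute vector_ssub_ldistrib algebra_simps)
qed

context spin_surface_manifold
begin

lemma has_dirder_boundary_speed:
  assumes c: "c \<in> charts M" and p: "p \<in> cdom c"
  shows "has_dirder M c (boundary_speed c) p (\<lambda>X. metric M c p (christoffel M c p X (axis 1 1)) (axis 1 1) / boundary_speed c p)"
proof -
  let ?X = "axis 1 1 :: real^2"
  have "has_dirder M c (\<lambda>q. metric M c q ?X ?X) p (\<lambda>X. 2 * metric M c p (christoffel M c p X ?X) ?X)"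
    using metric_compatible[OF c p has_dirder_const[where k = ?X] has_dirder_const[where k = ?X]]
      metric_sym[OF c p, of ?X] by (simp add: covder_const[OF c p])
  then have "((\<lambda>x. metric M c (param c x) ?X ?X) has_derivative (\<lambda>X. 2 * metric M c p (christoffel M c p X ?X) ?X))
      (at (coord c p) within model M)"
    by (simp add: has_dirder_def)
  from has_derivative_real_sqrt[OF _ this] boundary_speed_pos[OF c p]
  have "((\<lambda>x. sqrt (metric M c (param c x) ?X ?X)) has_derivative
      (\<lambda>X. (2 * metric M c p (christoffel M c p X ?X) ?X) * (inverse (sqrt (metric M c p ?X ?X)) / 2)))
      (at (coord c p) within model M)"
    by (simp add: param_coord[OF c p] boundary_speed_def)
  moreover have "2 * m * (inverse s / 2) = m / s" for m s :: real by (simp add: field_simps)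
  ultimately show ?thesis by (simp only: has_dirder_def boundary_speed_def)
qed

lemma has_dirder_divide:
  fixes u v :: "'m \<Rightarrow> real"
  assumes c: "c \<in> charts M" and p: "p \<in> cdom c" and u: "has_dirder M c u p u'" and v: "has_dirder M c v p v'"
    and nz: "v p \<noteq> 0"
  shows "has_dirder M c (\<lambda>q. u q / v q) p (\<lambda>X. (u' X * v p - u p * v' X) / (v p * v p))"
  using has_derivative_divide'[OF u[unfolded has_dirder_def] v[unfolded has_dirder_def]] nz
  by (simp add: has_dirder_def param_coord[OF c p])

text \<open>Since the boundary is totally geodesic, \<open>\<nabla>\<partial>\<^sub>1\<close> is tangential along it, so the unit tangent \<open>T\<close> is parallel.
  Its components then only change by the rotation of the frame, whose speed is the connection form.\<close>

lemma has_dirder_tangent_comp: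
  assumes tg: "totally_geodesic_boundary M" and pb: "p \<in> boundary M" and c: "c \<in> charts M" and p: "p \<in> cdom c"
  shows "\<exists>u v. has_dirder M c (\<lambda>q. tangent_comp c q 1) p u \<and> has_dirder M c (\<lambda>q. tangent_comp c q 2) p v \<and>
     u (axis 1 1) = connection_form c p (axis 1 1) * tangent_comp c p 2 \<and> v (axis 1 1) = - (connection_form c p (axis 1 1) * tangent_comp c p 1)"
proof -
  note bil = metric_bilinear[OF c p]
  let ?X = "axis 1 1 :: real^2" and ?u = "tangent_comp c p 1" and ?v = "tangent_comp c p 2"
    and ?r = "boundary_speed c p" and ?w = "connection_form c p (axis 1 1)"
  let ?\<Gamma> = "christoffel M c p ?X ?X"
  let ?g = "\<lambda>j. metric M c p ?\<Gamma> (frame M c p j)"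
  note r = boundary_speed_pos[OF c p]
  have m: "metric M c p ?X (frame M c p j) = ?r * tangent_comp c p j" for j
    using r by (simp add: tangent_comp_def)
  have unit: "?u * ?u + ?v * ?v = 1" using tangent_comp_unit[OF c p] by (simp add: power2_eq_square)
  define k where "k = ?u * ?g 1 + ?v * ?g 2"
  have "metric M c p (covder M c (\<lambda>q. ?X) p ?X) (inner_normal M c p) = 0"
    using tg pb c p by (auto simp: totally_geodesic_boundary_def charts_at_def axis_def)
  then have normal: "?u * ?g 2 - ?v * ?g 1 = 0"
    by (simp add: covder_const[OF c p] inner_normal_eq[OF c p] bilinear_rsub[OF bil] bilinear_rmul[OF bil])
  have "?g 1 = (?u * ?u + ?v * ?v) * ?g 1" "?g 2 = (?u * ?u + ?v * ?v) * ?g 2" by (simp_all add: unit)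
  moreover have "(?u * ?u + ?v * ?v) * ?g 1 = ?u * k - ?v * (?u * ?g 2 - ?v * ?g 1)"
    "(?u * ?u + ?v * ?v) * ?g 2 = ?v * k + ?u * (?u * ?g 2 - ?v * ?g 1)"
    by (simp_all add: k_def algebra_simps)
  ultimately have g: "?g 1 = ?u * k" "?g 2 = ?v * k" unfolding normal by simp_all
  have "metric M c p ?\<Gamma> ?X = metric M c p ?\<Gamma> (?r *\<^sub>R (?u *\<^sub>R frame M c p 1 + ?v *\<^sub>R frame M c p 2))"
    using tangent_expand[OF c p] by metis
  also have "\<dots> = ?r * k"
    by (simp add: bilinear_radd[OF bil] bilinear_rmul[OF bil] k_def)
  finally have \<Gamma>X: "metric M c p ?\<Gamma> ?X = ?r * k" .
  have dm: "has_dirder M c (\<lambda>q. metric M c q ?X (frame M c q j)) p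
     (\<lambda>Y. metric M c p (christoffel M c p Y ?X) (frame M c p j) + metric M c p ?X (covder M c (\<lambda>q. frame M c q j) p Y))" for j
    using metric_compatible[OF c p has_dirder_const[where k = ?X] has_dirder_frame[OF c p, of j]]
    by (simp add: covder_const[OF c p])
  define U where "U j Y = ((metric M c p (christoffel M c p Y ?X) (frame M c p j) + metric M c p ?X (covder M c (\<lambda>q. frame M c q j) p Y)) * ?r
        - metric M c p ?X (frame M c p j) * (metric M c p (christoffel M c p Y ?X) ?X / ?r)) / (?r * ?r)" for j Y
  have du: "has_dirder M c (\<lambda>q. tangent_comp c q j) p (U j)" for j
    unfolding U_def[abs_def] tangent_comp_def using r by (intro has_dirder_divide[OF c p dm has_dirder_boundary_speed[OF c p]]) simp
  have "U 1 ?X = ?w * ?v" "U 2 ?X = - (?w * ?u)"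
    using r by (simp_all add: U_def covder_frame[OF c p] bilinear_rmul[OF bil] bilinear_rneg[OF bil] g m \<Gamma>X metric_frame[OF c p] field_simps)
  with du[of 1] du[of 2] show ?thesis by blast
qed

lemma
  assumes chir: "chirality_operator M G" and c: "c \<in> charts M" and p: "p \<in> cdom c"
  shows chirality_anticommutes: "G c p ** clifford M c p X = - (clifford M c p X ** G c p)"
    and chirality_parallel: "dirder M c (G c) p X + spin_conn_form M c p X ** G c p - G c p ** spin_conn_form M c p X = 0"
proof -
  have "c \<in> charts_at M p" using c p by (simp add: charts_at_def)
  note loc = conjunct2[OF conjunct2[OF chir[unfolded chirality_operator_def]], rule_format, OF this]
  show "G c p ** clifford M c p X = - (clifford M c p X ** G c p)"
    by (rule conjunct1[OF conjunct2[OF conjunct2[OF loc]], rule_format])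
  show "dirder M c (G c) p X + spin_conn_form M c p X ** G c p - G c p ** spin_conn_form M c p X = 0"
    by (rule conjunct2[OF conjunct2[OF conjunct2[OF loc]], rule_format])
qed

lemma chirality_chart_change:
  assumes chir: "chirality_operator M G"
    and c: "c \<in> charts M" "p \<in> cdom c" and c': "c' \<in> charts M" "p \<in> cdom c'"
  shows "G c p = spin_rep (spin_lift M c c' p) ** G c' p ** spin_rep (cnj (spin_lift M c c' p))"
  by (rule conjunct1[OF conjunct2[OF chir[unfolded chirality_operator_def]], rule_format])
    (simp_all add: charts_at_def c c')

text \<open>The section \<open>\<chi> = \<nu> \<cdot> \<G>\<psi> - \<psi>\<close> that measures the failure of the boundary condition.\<close>

definition chirality_defect :: "(('m, real^2) chart \<Rightarrow> 'm \<Rightarrow> complex^2^2) \<Rightarrow>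
    (('m, real^2) chart \<Rightarrow> 'm \<Rightarrow> complex^2) \<Rightarrow> ('m, real^2) chart \<Rightarrow> 'm \<Rightarrow> complex^2" where
  "chirality_defect G \<psi> c p = normal_clifford c p *v (G c p *v \<psi> c p) - \<psi> c p"

text \<open>The equation \<open>\<nabla>\<^sub>X \<chi> = \<alpha> X \<cdot> \<chi>\<close> for \<open>X = \<partial>\<^sub>1\<close>, with the spin connection on the right.\<close>

lemma has_dirder_chirality_defect:
  assumes tg: "totally_geodesic_boundary M" and chir: "chirality_operator M G" and psi: "killing_spinor M \<alpha> \<psi>"
    and pb: "p \<in> boundary M" and c: "c \<in> charts M" and p: "p \<in> cdom c"
  shows "\<exists>D. has_dirder M c (chirality_defect G \<psi> c) p D \<and>
     D (axis 1 1) = \<alpha> *s (clifford M c p (axis 1 1) *v chirality_defect G \<psi> c p)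
        - (connection_form c p (axis 1 1) / 2) *\<^sub>R (gamma12 *v chirality_defect G \<psi> c p)"
proof -
  let ?X = "axis 1 1 :: real^2" and ?w = "connection_form c p (axis 1 1)" and ?cl = "clifford M c p (axis 1 1)"
  let ?S = "spin_conn_form M c p ?X" and ?\<sigma> = "\<psi> c p"
  let ?\<tau> = "G c p *v \<psi> c p"
  have cp: "c \<in> charts_at M p" using c p by (simp add: charts_at_def)
  have "smooth_in c (cdom c) (\<psi> c)" using psi c by (simp add: killing_spinor_def spinor_field_def)
  then have dpsi: "has_dirder M c (\<psi> c) p (dirder M c (\<psi> c) p)"
    by (intro smooth_in_has_dirder[OF c open_UNIV p UNIV_I]) simp
  have "smooth_in c (cdom c) (G c)" using chir c by (simp add: chirality_operator_def)
  then have dG: "has_dirder M c (G c) p (dirder M c (G c) p)"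
    by (intro smooth_in_has_dirder[OF c open_UNIV p UNIV_I]) simp
  have "spin_deriv M c \<psi> p ?X = \<alpha> *s (?cl *v ?\<sigma>)" using psi cp by (simp add: killing_spinor_def)
  then have psi': "dirder M c (\<psi> c) p ?X = \<alpha> *s (?cl *v ?\<sigma>) - ?S *v ?\<sigma>"
    by (simp add: spin_deriv_def eq_diff_eq)
  have "dirder M c (G c) p ?X + ?S ** G c p - G c p ** ?S = 0"
    by (rule chirality_parallel[OF chir c p])
  then have G': "dirder M c (G c) p ?X = G c p ** ?S - ?S ** G c p"
    by (simp add: algebra_simps)
  have anti: "G c p ** ?cl = - (?cl ** G c p)"
    by (rule chirality_anticommutes[OF chir c p])
  have tau': "G c p *v dirder M c (\<psi> c) p ?X + dirder M c (G c) p ?X *v ?\<sigma> = - (?S *v ?\<tau>) - \<alpha> *s (?cl *v ?\<tau>)"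
  proof -
    have "G c p *v (\<alpha> *s (?cl *v ?\<sigma>)) = \<alpha> *s ((G c p ** ?cl) *v ?\<sigma>)"
      by (simp add: vector_scalar_commute matrix_vector_mul_assoc)
    also have "\<dots> = - (\<alpha> *s (?cl *v ?\<tau>))"
      unfolding anti by (simp add: vec_eq_iff matrix_vector_mult_def matrix_matrix_mult_def sum_2 algebra_simps)
    finally show ?thesis unfolding psi' G'
      by (simp add: matrix_vector_mult_diff_distrib matrix_vector_mult_diff_rdistrib matrix_vector_mul_assoc)
  qed
  obtain u v where u: "has_dirder M c (\<lambda>q. tangent_comp c q 1) p u" and v: "has_dirder M c (\<lambda>q. tangent_comp c q 2) p v"
    and uX: "u ?X = ?w * tangent_comp c p 2" and vX: "v ?X = - (?w * tangent_comp c p 1)"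
    using has_dirder_tangent_comp[OF tg pb c p] by blast
  have dn: "has_dirder M c (normal_clifford c) p (\<lambda>X. u X *\<^sub>R gamma 2 - v X *\<^sub>R gamma 1)"
    unfolding normal_clifford_def
    by (intro has_dirder_diff has_dirder_linear[OF bounded_linear_scaleR_left] u v)
  have "has_dirder M c (chirality_defect G \<psi> c) p
    (\<lambda>X. normal_clifford c p *v (G c p *v dirder M c (\<psi> c) p X + dirder M c (G c) p X *v ?\<sigma>)
       + (u X *\<^sub>R gamma 2 - v X *\<^sub>R gamma 1) *v ?\<tau> - dirder M c (\<psi> c) p X)" (is "has_dirder M c _ p ?D")
    unfolding chirality_defect_def
    by (intro has_dirder_diff has_dirder_product[OF c p bounded_bilinear_matrix_vector] dn dG dpsi)
  moreover have "?D ?X = \<alpha> *s (?cl *v chirality_defect G \<psi> c p) - (?w / 2) *\<^sub>R (gamma12 *v chirality_defect G \<psi> c p)"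
    unfolding tau' unfolding psi' uX vX spin_conn_form_eq scaleR_matrix_vector_mult[of _ gamma12] clifford_tangent[OF c p]
      chirality_defect_def normal_clifford_def
    by (rule chirality_defect_algebra)
  ultimately show ?thesis by blast
qed

end

lemma norm_clifford_bound:
  fixes \<sigma> :: "complex^2"
  assumes "u\<^sup>2 + v\<^sup>2 = 1"
  shows "norm (\<alpha> *s ((r *\<^sub>R (u *\<^sub>R gamma 1 + v *\<^sub>R gamma 2)) *v \<sigma>)) = norm \<alpha> * \<bar>r\<bar> * norm \<sigma>"
proof -
  have 1: "inner ((u *\<^sub>R gamma 1 + v *\<^sub>R gamma 2) *v \<sigma>) ((u *\<^sub>R gamma 1 + v *\<^sub>R gamma 2) *v \<sigma>) = (u\<^sup>2 + v\<^sup>2) * inner \<sigma> \<sigma>" for \<sigma>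
    by (simp add: mat2_simps inner_vec_def inner_complex_def power2_eq_square algebra_simps)
  have 2: "inner (\<alpha> *s \<sigma>) (\<alpha> *s \<sigma>) = ((Re \<alpha>)\<^sup>2 + (Im \<alpha>)\<^sup>2) * inner \<sigma> \<sigma>" for \<sigma> :: "complex^2"
    by (simp add: inner_vec_def sum_2 inner_complex_def power2_eq_square algebra_simps)
  show ?thesis
    by (simp add: scaleR_matrix_vector_mult norm_eq_sqrt_inner[of "_ :: complex^2"] 2 1 assms real_sqrt_mult cmod_def)
qed

text \<open>The spin connection is skew and does not contribute to the derivative of a squared norm.\<close>

lemma inner_gamma12: "inner (gamma12 *v \<sigma>) \<sigma> = 0"
  by (simp add: mat2_simps inner_vec_def inner_complex_def algebra_simps)

lemma gamma12_mult: "gamma12 ** (u *\<^sub>R gamma 1 + v *\<^sub>R gamma 2) = u *\<^sub>R gamma 2 - v *\<^sub>R gamma 1"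
  by (simp add: mat2_simps complex_eq_iff)

lemma spin_rep_gamma12: "spin_rep z ** gamma12 = gamma12 ** spin_rep z"
  by (simp add: mat2_simps spin_rep_def complex_eq_iff)

context spin_surface_manifold
begin

text \<open>Up to the factor \<open>|\<partial>\<^sub>1|\<close>, which scales like \<open>\<partial>\<^sub>1\<close>, this operator is the product of \<open>\<gamma>\<^sub>1\<gamma>\<^sub>2\<close> with
  Clifford multiplication by \<open>\<partial>\<^sub>1\<close>; the volume element \<open>\<gamma>\<^sub>1\<gamma>\<^sub>2\<close> commutes with the spin group.\<close>

lemma normal_clifford_chart_change:
  assumes pb: "p \<in> boundary M" and c: "c \<in> charts M" "p \<in> cdom c" and c': "c' \<in> charts M" "p \<in> cdom c'"
  shows "normal_clifford c p ** spin_rep (spin_lift M c c' p) = spin_rep (spin_lift M c c' p) ** normal_clifford c' p"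
proof -
  let ?S = "spin_rep (spin_lift M c c' p)"
  let ?T = "\<lambda>c. tangent_comp c p 1 *\<^sub>R gamma 1 + tangent_comp c p 2 *\<^sub>R gamma 2"
  obtain a where a: "0 < a" "dirder M c' (coord c) p (axis 1 1) = a *\<^sub>R axis 1 1"
    by (rule transition_boundary_tangent[OF pb c c'])
  have "metric M c p (a *\<^sub>R axis 1 1) (a *\<^sub>R axis 1 1) = metric M c' p (axis 1 1) (axis 1 1)"
    using metric_chart_change[OF c c', of "axis 1 1" "axis 1 1"] by (simp only: a)
  then have "(a * boundary_speed c p)\<^sup>2 = (boundary_speed c' p)\<^sup>2"
    unfolding power_mult_distrib boundary_speed_sq[OF c] boundary_speed_sq[OF c']
    by (simp add: bilinear_lmul[OF metric_bilinear[OF c]] bilinear_rmul[OF metric_bilinear[OF c]]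
        power2_eq_square)
  then have r: "a * boundary_speed c p = boundary_speed c' p"
    using a(1) boundary_speed_pos[OF c] boundary_speed_pos[OF c'] by (simp add: power2_eq_iff_nonneg)
  have "clifford M c p (a *\<^sub>R axis 1 1) ** ?S = ?S ** clifford M c' p (axis 1 1)"
    using clifford_chart_change[OF c c', of "axis 1 1"] by (simp only: a)
  then have "(a * boundary_speed c p) *\<^sub>R (?T c ** ?S) = boundary_speed c' p *\<^sub>R (?S ** ?T c')"
    by (simp only: linear_scale[OF clifford_linear[OF c]] clifford_tangent[OF c] clifford_tangent[OF c']
        scaleR_matrix_mult matrix_mult_scaleR scaleR_scaleR)
  then have T: "?T c ** ?S = ?S ** ?T c'"
    using boundary_speed_pos[OF c'] unfolding r by simp
  have n: "normal_clifford c p = gamma12 ** ?T c" for c by (simp only: normal_clifford_def gamma12_mult)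
  have "normal_clifford c p ** ?S = gamma12 ** (?T c ** ?S)" by (simp only: n matrix_mul_assoc)
  also have "\<dots> = (gamma12 ** ?S) ** ?T c'" by (simp only: T matrix_mul_assoc)
  also have "\<dots> = ?S ** normal_clifford c' p" by (simp only: n spin_rep_gamma12[symmetric] matrix_mul_assoc)
  finally show ?thesis .
qed

lemma chirality_defect_chart_change:
  assumes chir: "chirality_operator M G" and psi: "killing_spinor M \<alpha> \<psi>"
    and pb: "p \<in> boundary M" and c: "c \<in> charts M" "p \<in> cdom c" and c': "c' \<in> charts M" "p \<in> cdom c'"
  shows "chirality_defect G \<psi> c p = spin_rep (spin_lift M c c' p) *v chirality_defect G \<psi> c' p"
proof -
  let ?S = "spin_rep (spin_lift M c c' p)" and ?S' = "spin_rep (cnj (spin_lift M c c' p))"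
  have psi: "\<psi> c p = ?S *v \<psi> c' p"
    by (rule conjunct2[OF conjunct1[OF psi[unfolded killing_spinor_def spinor_field_def]], rule_format])
      (simp_all add: charts_at_def c c')
  have "G c p *v \<psi> c p = ?S *v (G c' p *v ((?S' ** ?S) *v \<psi> c' p))"
    by (subst psi, subst chirality_chart_change[OF chir c c']) (simp only: matrix_vector_mul_assoc matrix_mul_assoc)
  then have G: "G c p *v \<psi> c p = ?S *v (G c' p *v \<psi> c' p)"
    by (simp only: spin_rep_cnj[OF spin_lift_norm[OF c c']] matrix_vector_mul_lid)
  have "chirality_defect G \<psi> c p = (normal_clifford c p ** ?S) *v (G c' p *v \<psi> c' p) - ?S *v \<psi> c' p"
    unfolding chirality_defect_def G by (subst psi) (simp only: matrix_vector_mul_assoc matrix_mul_assoc)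
  then show ?thesis
    unfolding normal_clifford_chart_change[OF pb c c'] chirality_defect_def
    by (simp only: matrix_vector_mul_assoc[symmetric] matrix_vector_mult_diff_distrib)
qed

text \<open>In a chart the boundary is a segment of the line \<open>x\<^sub>2 = 0\<close>, along which \<open>\<chi>\<close> solves a linear equation. The
  derivative of \<open>|\<chi>|\<^sup>2\<close> is \<open>2 Re \<langle>\<alpha> \<partial>\<^sub>1 \<cdot> \<chi>, \<chi>\<rangle>\<close>, bounded by \<open>2 |\<alpha>| |\<partial>\<^sub>1| |\<chi>|\<^sup>2\<close>, and \<open>|\<partial>\<^sub>1|\<close> is bounded on a
  compact segment. Hence a single zero makes \<open>\<chi>\<close> vanish on the segment.\<close>

lemma chirality_defect_zero_locally_constant:
  assumes tg: "totally_geodesic_boundary M" and chir: "chirality_operator M G" and psi: "killing_spinor M \<alpha> \<psi>"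
    and pb: "p \<in> boundary M" and c: "c \<in> charts M" and p: "p \<in> cdom c"
  shows "\<exists>U. open U \<and> p \<in> U \<and> U \<subseteq> cdom c \<and> (\<forall>q\<in>boundary M \<inter> U. \<forall>q'\<in>boundary M \<inter> U.
     chirality_defect G \<psi> c q = 0 \<longrightarrow> chirality_defect G \<psi> c q' = 0)"
proof -
  define x where "x = coord c p"
  define \<gamma> where "\<gamma> t = x + t *\<^sub>R axis 1 1" for t :: real
  define q where "q t = param c (\<gamma> t)" for t
  have x2: "x $ 2 = 0" using boundary_coord[OF pb c p] by (simp add: x_def)
  have \<gamma>H: "\<gamma> t \<in> model M" for t
    by (simp add: \<gamma>_def model_half_plane half_plane_def x2 axis_def)
  obtain W where W: "open W" "coord c ` cdom c = model M \<inter> W"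
    using openin_chart_image[OF c open_UNIV] by (auto simp: openin_open)
  have "x \<in> W" using W(2) p by (auto simp: x_def)
  then obtain \<epsilon> where \<epsilon>: "0 < \<epsilon>" "cball x \<epsilon> \<subseteq> W" using W(1) open_contains_cball by blast
  have q: "q t \<in> cdom c" "coord c (q t) = \<gamma> t" if "\<bar>t\<bar> \<le> \<epsilon>" for t
  proof -
    have "\<gamma> t \<in> cball x \<epsilon>" using that by (simp add: \<gamma>_def dist_norm)
    then have "\<gamma> t \<in> coord c ` cdom c" using W(2) \<epsilon>(2) \<gamma>H by blast
    then show "q t \<in> cdom c" "coord c (q t) = \<gamma> t" by (auto simp: q_def param_coord[OF c])
  qed
  have qb: "q t \<in> boundary M" if "\<bar>t\<bar> \<le> \<epsilon>" for t
  proof -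
    have "coord c (q t) $ 2 = 0" unfolding q(2)[OF that] \<gamma>_def by (simp add: x2 axis_def)
    then show ?thesis using c q(1)[OF that] by (auto simp: boundary_def charts_at_def)
  qed
  have curve: "((\<lambda>s. u (q s)) has_derivative (\<lambda>s. s *\<^sub>R u' (axis 1 1))) (at t)"
    if "has_dirder M c u (q t) u'" "\<bar>t\<bar> \<le> \<epsilon>" for u :: "'m \<Rightarrow> 'x::real_normed_vector" and u' t
  proof -
    have d: "((\<lambda>y. u (param c y)) has_derivative u') (at (\<gamma> t) within model M)"
      using that(1) by (simp add: has_dirder_def q(2)[OF that(2)])
    have g: "(\<gamma> has_derivative (\<lambda>s. s *\<^sub>R axis 1 1)) (at t)"
      unfolding \<gamma>_def[abs_def] by (auto intro!: derivative_eq_intros)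
    have "range \<gamma> \<subseteq> model M" using \<gamma>H by blast
    from has_derivative_in_compose[OF g has_derivative_subset[OF d this]]
    have "((\<lambda>s. u (param c (\<gamma> s))) has_derivative (\<lambda>s. u' (s *\<^sub>R axis 1 1))) (at t)" .
    then show ?thesis unfolding q_def linear_scale[OF has_dirder_linearD[OF that(1)]] .
  qed
  have "isCont (\<lambda>t. boundary_speed c (q t)) t" if "\<bar>t\<bar> \<le> \<epsilon>" for t
    by (rule has_derivative_continuous[OF curve[OF has_dirder_boundary_speed[OF c q(1)[OF that]] that]])
  then have "continuous_on {-\<epsilon>..\<epsilon>} (\<lambda>t. boundary_speed c (q t))"
    by (intro continuous_at_imp_continuous_on) auto
  moreover have "{-\<epsilon>..\<epsilon>} \<noteq> {}" using \<epsilon>(1) by simp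
  ultimately obtain s where s: "\<And>t. t \<in> {-\<epsilon>..\<epsilon>} \<Longrightarrow> boundary_speed c (q t) \<le> boundary_speed c (q s)"
    using continuous_attains_sup[OF compact_Icc, of "-\<epsilon>" \<epsilon>] by blast
  let ?F = "\<lambda>t. chirality_defect G \<psi> c (q t)"
  let ?A = "\<lambda>t. \<alpha> *s (clifford M c (q t) (axis 1 1) *v ?F t)"
  let ?B = "\<lambda>t. ?A t - (connection_form c (q t) (axis 1 1) / 2) *\<^sub>R (gamma12 *v ?F t)"
  have der: "((\<lambda>t. ?F t \<bullet> ?F t) has_real_derivative 2 * (?A t \<bullet> ?F t)) (at t)" if "t \<in> {-\<epsilon><..<\<epsilon>}" for t
  proof -
    have t: "\<bar>t\<bar> \<le> \<epsilon>" using that by auto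
    obtain D where D: "has_dirder M c (chirality_defect G \<psi> c) (q t) D" "D (axis 1 1) = ?B t"
      using has_dirder_chirality_defect[OF tg chir psi qb[OF t] c q(1)[OF t]] by blast
    have d: "(?F has_derivative (\<lambda>s. s *\<^sub>R ?B t)) (at t)"
      using curve[OF D(1) t] by (simp only: D(2))
    have B: "?B t \<bullet> ?F t = ?A t \<bullet> ?F t"
      by (simp add: inner_diff_left inner_gamma12)
    have "(\<lambda>s. ?F t \<bullet> (s *\<^sub>R ?B t) + (s *\<^sub>R ?B t) \<bullet> ?F t) = (*) (2 * (?A t \<bullet> ?F t))"
      by (simp only: fun_eq_iff inner_scaleR_right inner_scaleR_left inner_commute[of "?F t" "?B t"] B) simp
    with has_derivative_inner[OF d d] show ?thesis
      by (simp only: has_field_derivative_def)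
  qed
  have bound: "\<bar>2 * (?A t \<bullet> ?F t)\<bar> \<le> (2 * norm \<alpha> * boundary_speed c (q s)) * (?F t \<bullet> ?F t)" if "t \<in> {-\<epsilon><..<\<epsilon>}" for t
  proof -
    have t: "\<bar>t\<bar> \<le> \<epsilon>" using that by auto
    have "norm (?A t) = norm \<alpha> * \<bar>boundary_speed c (q t)\<bar> * norm (?F t)"
      unfolding clifford_tangent[OF c q(1)[OF t]]
      by (rule norm_clifford_bound[OF tangent_comp_unit[OF c q(1)[OF t]]])
    also have "\<dots> \<le> norm \<alpha> * boundary_speed c (q s) * norm (?F t)"
      using s[of t] boundary_speed_pos[OF c q(1)[OF t]] that by (intro mult_right_mono mult_left_mono) auto
    finally have "norm (?A t) * norm (?F t) \<le> norm \<alpha> * boundary_speed c (q s) * norm (?F t) * norm (?F t)"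
      by (rule mult_right_mono) simp
    with Cauchy_Schwarz_ineq2[of "?A t" "?F t"]
    have "\<bar>?A t \<bullet> ?F t\<bar> \<le> norm \<alpha> * boundary_speed c (q s) * (norm (?F t))\<^sup>2"
      by (simp add: power2_eq_square mult.assoc)
    then show ?thesis by (simp add: abs_mult power2_norm_eq_inner)
  qed
  define U where "U = coord c -` ball x \<epsilon> \<inter> cdom c"
  have oU: "open U"
    using homeomorphism_cont1[OF chart_homeomorphism[OF c]] continuous_on_open_vimage[OF open_cdom[OF c], of "coord c"]
    by (simp add: U_def)
  have pU: "p \<in> U" using p \<epsilon>(1) by (simp add: U_def x_def)
  have const: "chirality_defect G \<psi> c q2 = 0"
    if q1: "q1 \<in> boundary M \<inter> U" and q2: "q2 \<in> boundary M \<inter> U" and zero: "chirality_defect G \<psi> c q1 = 0" for q1 q2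
  proof -
    have on_curve: "\<exists>t\<in>{-\<epsilon><..<\<epsilon>}. z = q t" if z: "z \<in> boundary M \<inter> U" for z
    proof -
      have zc: "z \<in> cdom c" using z by (simp add: U_def)
      define t where "t = coord c z $ 1 - x $ 1"
      have "coord c z $ 2 = 0" using boundary_coord[OF _ c zc] z by simp
      then have zt: "coord c z = \<gamma> t" by (simp add: \<gamma>_def vec_eq_iff forall_2 x2 axis_def t_def)
      have "dist x (\<gamma> t) < \<epsilon>" using z by (simp add: U_def zt)
      then have "t \<in> {-\<epsilon><..<\<epsilon>}" by (auto simp: \<gamma>_def dist_norm)
      moreover have "z = q t" unfolding q_def zt[symmetric] by (rule param_coord[OF c zc, symmetric])
      ultimately show ?thesis by blast
    qed
    obtain t1 t2 where t: "t1 \<in> {-\<epsilon><..<\<epsilon>}" "q1 = q t1" "t2 \<in> {-\<epsilon><..<\<epsilon>}" "q2 = q t2"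
      using on_curve[OF q1] on_curve[OF q2] by blast
    have "?F t2 \<bullet> ?F t2 = 0"
      by (rule gronwall_zero[OF der bound _ t(1) _ t(3)]) (use zero t(2) in auto)
    then show ?thesis using t(4) by simp
  qed
  show ?thesis
  proof (intro exI[of _ U] conjI ballI impI)
    show "U \<subseteq> cdom c" by (simp add: U_def)
  qed (fact oU pU | erule (2) const)+
qed

lemma chirality_defect_zero_on_boundary:
  assumes tg: "totally_geodesic_boundary M" and chir: "chirality_operator M G" and psi: "killing_spinor M \<alpha> \<psi>"
    and bd: "connected (boundary M)"
    and p0: "p0 \<in> boundary M" and c0: "c0 \<in> charts M" "p0 \<in> cdom c0" and zero: "chirality_defect G \<psi> c0 p0 = 0"
    and p: "p \<in> boundary M" and c: "c \<in> charts M" "p \<in> cdom c"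
  shows "chirality_defect G \<psi> c p = 0"
proof -
  define P where "P q \<longleftrightarrow> (\<forall>c. c \<in> charts M \<longrightarrow> q \<in> cdom c \<longrightarrow> chirality_defect G \<psi> c q = 0)" for q
  have all: "P q" if "q \<in> boundary M" "c \<in> charts M" "q \<in> cdom c" "chirality_defect G \<psi> c q = 0" for q c
    unfolding P_def
  proof (intro allI impI)
    fix c' assume c': "c' \<in> charts M" "q \<in> cdom c'"
    show "chirality_defect G \<psi> c' q = 0"
      unfolding chirality_defect_chart_change[OF chir psi that(1) c' that(2,3)] that(4) by simp
  qed
  have "P p"
  proof (rule connected_induction_simple[OF bd p0 p])
    show "P p0" by (rule all[OF p0 c0 zero])
    fix a assume a: "a \<in> boundary M"
    then obtain c where c: "c \<in> charts M" "a \<in> cdom c" by (auto simp: boundary_def charts_at_def)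
    obtain U where U: "open U" "a \<in> U" "U \<subseteq> cdom c"
      "\<forall>q\<in>boundary M \<inter> U. \<forall>q'\<in>boundary M \<inter> U. chirality_defect G \<psi> c q = 0 \<longrightarrow> chirality_defect G \<psi> c q' = 0"
      using chirality_defect_zero_locally_constant[OF tg chir psi a c] by blast
    have step: "P y" if "x \<in> boundary M \<inter> U" "y \<in> boundary M \<inter> U" "P x" for x y
    proof -
      have "chirality_defect G \<psi> c x = 0" using that U(3) c(1) by (auto simp: P_def)
      then have "chirality_defect G \<psi> c y = 0" using U(4) that by blast
      then show ?thesis using all[of y c] that U(3) c(1) by blast
    qed
    show "\<exists>T. openin (top_of_set (boundary M)) T \<and> a \<in> T \<and> (\<forall>x\<in>T. \<forall>y\<in>T. P x \<longrightarrow> P y)"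
    proof (intro exI[of _ "boundary M \<inter> U"] conjI ballI impI)
      show "openin (top_of_set (boundary M)) (boundary M \<inter> U)" using U(1) by (rule openin_open_Int)
      show "a \<in> boundary M \<inter> U" using a U(2) by simp
    qed (erule (2) step)
  qed
  then show ?thesis using c by (simp add: P_def)
qed

end

context surface_map
begin

text \<open>By the Neumann condition only the tangential term of \<open>\<phi>\<close> is left, in the basis consisting of the unit
  tangent and the normal. Moving \<open>T \<cdot>\<close> to the left across \<open>\<nu> \<cdot> \<G>\<close> changes the sign twice.\<close>

lemma frame_spinor_chirality:
  assumes chir: "chirality_operator M G" and c: "c \<in> charts M" and p: "p \<in> cdom c"
    and d: "d \<in> charts N" and fp: "f p \<in> cdom d"
    and neumann: "differential M f c d p (inner_normal M c p) = 0" and defect: "chirality_defect G \<psi> c p = 0"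
  shows "tensor_op (clifford M c p (inner_normal M c p)) id (tensor_op (G c p) id (frame_spinor \<psi> c d p))
    = frame_spinor \<psi> c d p"
proof -
  note bil = metric_bilinear[OF c p]
  let ?u = "tangent_comp c p 1" and ?v = "tangent_comp c p 2"
  let ?T = "?u *\<^sub>R frame M c p 1 + ?v *\<^sub>R frame M c p 2" and ?clT = "?u *\<^sub>R gamma 1 + ?v *\<^sub>R gamma 2"
  define b where "b j = (if j = 1 then ?T else inner_normal M c p)" for j :: 2
  have unit: "?u * ?u + ?v * ?v = 1" "?v * ?v + ?u * ?u = 1"
    using tangent_comp_unit[OF c p] by (simp_all add: power2_eq_square)
  have "orthonormal_basis M c p b"
    using unit
    by (simp add: orthonormal_basis_def forall_2 b_def inner_normal_eq[OF c p] bilinear_ladd[OF bil] bilinear_radd[OF bil]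
        bilinear_lsub[OF bil] bilinear_rsub[OF bil] bilinear_lmul[OF bil] bilinear_rmul[OF bil] metric_frame[OF c p])
  from basis_spinor_eq_frame_spinor[OF c d p fp this, of \<psi>]
  have "frame_spinor \<psi> c d p = tensor (clifford M c p ?T *v \<psi> c p) (differential M f c d p ?T)
      + tensor (clifford M c p (inner_normal M c p) *v \<psi> c p) (differential M f c d p (inner_normal M c p))"
    by (simp add: sum_2 b_def)
  then have phi: "frame_spinor \<psi> c d p = tensor (?clT *v \<psi> c p) (differential M f c d p ?T)"
    by (simp add: neumann bounded_bilinear.zero_right[OF bounded_bilinear_tensor]
        linear_add[OF clifford_linear[OF c p]] linear_scale[OF clifford_linear[OF c p]] clifford_frame[OF c p])
  have cT: "clifford M c p ?T = ?clT"
    by (simp add: linear_add[OF clifford_linear[OF c p]] linear_scale[OF clifford_linear[OF c p]] clifford_frame[OF c p])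
  have anti: "G c p ** ?clT = - (?clT ** G c p)"
    using chirality_anticommutes[OF chir c p, of ?T] by (simp only: cT)
  have op: "tensor_op T id (tensor \<sigma> v) = tensor (T *v \<sigma>) v" for T \<sigma> and v :: "real^'n"
    by (simp add: tensor_op_tensor linear_id)
  have "normal_clifford c p *v (G c p *v (?clT *v \<psi> c p)) = normal_clifford c p *v ((G c p ** ?clT) *v \<psi> c p)"
    by (simp only: matrix_vector_mul_assoc)
  also have "\<dots> = - ((normal_clifford c p ** ?clT) *v (G c p *v \<psi> c p))"
    by (simp only: anti matrix_vector_mult_uminus matrix_vector_mul_assoc matrix_mul_assoc)
  also have "\<dots> = ?clT *v (normal_clifford c p *v (G c p *v \<psi> c p))"
    by (simp only: normal_clifford_def normal_tangent_anticommute matrix_vector_mult_uminus minus_minus matrix_vector_mul_assoc[symmetric])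
  also have "normal_clifford c p *v (G c p *v \<psi> c p) = \<psi> c p"
    using defect by (simp add: chirality_defect_def)
  finally show ?thesis
    by (simp only: phi op clifford_inner_normal[OF c p])
qed

end

section \<open>Dirac-harmonic maps from Killing spinors\<close>

theorem proposition4p1:
  fixes M :: "'m::{t2_space,second_countable_topology} spin_surface"
    and N :: "('q::{t2_space,second_countable_topology}, real^'n) riem"
    and f :: "'m \<Rightarrow> 'q"
    and \<psi> :: "('m, real^2) chart \<Rightarrow> 'm \<Rightarrow> complex^2"
    and G :: "('m, real^2) chart \<Rightarrow> 'm \<Rightarrow> complex^2^2"
    and e :: "('m, real^2) chart \<Rightarrow> 'm \<Rightarrow> 2 \<Rightarrow> real^2"
    and \<alpha> :: complex
  assumes "compact (UNIV :: 'm set)"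
    and "oriented_riemannian_surface_with_boundary M"
    and "connected (boundary M)"
    and "totally_geodesic_boundary M"
    and "spin_structure M"
    and "riemannian_manifold N" and "model N = UNIV"
    and "chirality_operator M G"
    and "harmonic_map M N f"
    and "neumann_condition M N f"
    and "\<alpha> \<in> \<real> \<union> (*) \<i> ` \<real>"
    and "killing_spinor M \<alpha> \<psi>"
    and "\<exists>p\<in>boundary M. \<exists>c\<in>charts_at M p.
           clifford M c p (inner_normal M c p) *v (G c p *v \<psi> c p) = \<psi> c p"
    and "\<forall>p. \<forall>c\<in>charts_at M p. orthonormal_basis M c p (e c p)"
    and "\<phi> = (\<lambda>c d p. \<Sum>j\<in>UNIV.
           tensor (clifford M c p (e c p j) *v \<psi> c p) (differential M f c d p (e c p j)))"
  shows "dirac_harmonic M N f \<phi> \<and> neumann_condition M N f \<and> chirality_condition M N f G \<phi>"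
proof -
  have N: "riemannian N"
    using assms(6,7) thick_UNIV by unfold_locales simp_all
  have smooth: "smooth_map M N f"
    using assms(9) by (simp add: harmonic_map_def)
  interpret surface_map M N f
    using assms(2,5) N smooth
    by (simp add: surface_map_def spin_surface_manifold_def surface_map_axioms_def)
  have psi: "spinor_field M \<psi>"
    using assms(12) by (simp add: killing_spinor_def)
  have phi: "\<phi> c d p = frame_spinor \<psi> c d p"
    if "c \<in> charts M" "p \<in> cdom c" "d \<in> charts N" "f p \<in> cdom d" for c d p
    using basis_spinor_eq_frame_spinor[OF that(1,3,2,4)] assms(14) that
    by (simp add: assms(15) charts_at_def)
  have zero: "tension M N f c d p = 0" if "c \<in> charts_at M p" "d \<in> charts_at N (f p)" for c d p
    using assms(9) that by (simp add: harmonic_map_def)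
  obtain p0 c0 where p0: "p0 \<in> boundary M" and c0: "c0 \<in> charts M" "p0 \<in> cdom c0"
    and "clifford M c0 p0 (inner_normal M c0 p0) *v (G c0 p0 *v \<psi> c0 p0) = \<psi> c0 p0"
    using assms(13) by (auto simp: charts_at_def)
  then have "chirality_defect G \<psi> c0 p0 = 0" by (simp add: chirality_defect_def clifford_inner_normal)
  note defect = chirality_defect_zero_on_boundary[OF assms(4,8,12,3) p0 c0 this]
  have field: "twisted_spinor_field M N f \<phi>"
    unfolding twisted_spinor_field_def
  proof (intro conjI allI ballI)
    fix c d assume c: "c \<in> charts M" and d: "d \<in> charts N"
    show "smooth_in c (cdom c \<inter> f -` cdom d) (\<phi> c d)"
      using frame_spinor_smooth[OF c d psi] unfolding smooth_in_def
      by (rule smooth_on_cong) (use c d in \<open>auto simp: phi param_coord\<close>)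
  next
    fix p c c' d d'
    assume "c \<in> charts_at M p" "c' \<in> charts_at M p" "d \<in> charts_at N (f p)" "d' \<in> charts_at N (f p)"
    then have *: "c \<in> charts M" "p \<in> cdom c" "c' \<in> charts M" "p \<in> cdom c'"
      "d \<in> charts N" "f p \<in> cdom d" "d' \<in> charts N" "f p \<in> cdom d'"
      by (simp_all add: charts_at_def)
    show "\<phi> c d p = tensor_op (spin_rep (spin_lift M c c' p)) (dirder N d' (coord d) (f p)) (\<phi> c' d' p)"
      unfolding phi[OF *(1,2,5,6)] phi[OF *(3,4,7,8)] by (rule frame_spinor_chart_change[OF psi *])
  qed
  have "dirac_harmonic M N f \<phi>"
    unfolding dirac_harmonic_def
  proof (intro conjI allI ballI)
    fix p c d assume cd: "c \<in> charts_at M p" "d \<in> charts_at N (f p)"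
    then have *: "c \<in> charts M" "d \<in> charts N" "p \<in> cdom c" "f p \<in> cdom d"
      by (simp_all add: charts_at_def)
    show "twisted_dirac M N f \<phi> c d p = 0"
      by (rule twisted_dirac_frame_spinor[OF * _ assms(12) zero[OF cd]]) (rule phi[OF *(1) _ *(2)])
    show "tension M N f c d p = (1/2) *\<^sub>R V_field M N f \<phi> c d p"
      by (simp add: zero[OF cd] V_field_frame_spinor[where \<phi> = \<phi> and \<psi> = \<psi>, OF * phi[OF *(1,3,2,4)]])
  qed (fact smooth field)+
  moreover have "chirality_condition M N f G \<phi>"
    unfolding chirality_condition_def
  proof (intro ballI)
    fix p c d assume p: "p \<in> boundary M" and cd: "c \<in> charts_at M p" "d \<in> charts_at N (f p)"
    then have *: "c \<in> charts M" "p \<in> cdom c" "d \<in> charts N" "f p \<in> cdom d"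
      by (simp_all add: charts_at_def)
    have "differential M f c d p (inner_normal M c p) = 0"
      using assms(10) p cd by (simp add: neumann_condition_def)
    then show "tensor_op (clifford M c p (inner_normal M c p)) id (tensor_op (G c p) id (\<phi> c d p)) = \<phi> c d p"
      unfolding phi[OF *] by (rule frame_spinor_chirality[OF assms(8) * _ defect[OF p *(1,2)]])
  qed
  ultimately show ?thesis using assms(10) by blast
qed

end
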